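(* Let $\mathbb{G}\leqslant\mathrm{Aut}(X,\lambda)$ be an ergodic full group on a standard $\sigma$-finite space $(X,\lambda)$. Then $\mathbb{G}$ carries at most one Polish group topology, and such a topology is necessarily coarser than the uniform topology and refines the weak topology, where the uniform and weak topologies on $\mathbb{G}$ are those induced from $\mathrm{Aut}(X,\lambda)$.
   Context: A standard $\sigma$-finite space $(X,\lambda)$ is a standard Borel space $X$ with an atomless $\sigma$-finite Borel measure $\lambda$ such that $\lambda(X)=+\infty$. $\mathrm{Aut}(X,\lambda)$ is the group of Borel bijections $T$ of $X$ with $\lambda(T(A))=\lambda(T^{-1}(A))=\lambda(A)$ for every Borel $A$, where two bijections are identified when they coincide on a conull set. A full group is a subgroup $\mathbb{G}\leqslant\mathrm{Aut}(X,\lambda)$ stable under cutting and pasting: if $T\in\mathrm{Aut}(X,\lambda)$ and there are a countable partition $(A_n)$ of $X$ and elements $T_n\in\mathbb{G}$ with $T_{\restriction A_n}=T_{n\restriction A_n}$ for all $n$, then $T\in\mathbb{G}$. It is ergodic if every Borel $A\subseteq X$ with $\lambda(T(A)\Delta A)=0$ for all $T\in\mathbb{G}$ is null or conull. The uniform topology $\tau_u$ on $\mathrm{Aut}(X,\lambda)$ is the group topology induced by the pseudometrics $d_{u,C}(S,T)=\lambda(\{x\in C: S(x)\neq T(x)\})$, $C$ ranging over Borel sets of finite measure. The weak topology $\tau_w$ on $\mathrm{Aut}(X,\lambda)$ is the (Polish) group topology for which $T_n\to T$ iff $\lambda(T_n(A)\Delta T(A))\to 0$ for every Borel $A$ of finite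 measure. *)

theory Defs
  imports "HOL-Analysis.Analysis" "HOL-Algebra.Coset" "HOL-Algebra.Bij"
begin

definition polish_space_top :: "'a topology \<Rightarrow> bool" where
  "polish_space_top X \<longleftrightarrow> separable_space X \<and> completely_metrizable_space X"

definition group_topology :: "('g, 'b) monoid_scheme \<Rightarrow> 'g topology \<Rightarrow> bool" where
  "group_topology G \<tau> \<longleftrightarrow>
     topspace \<tau> = carrier G \<and>
     continuous_map (prod_topology \<tau> \<tau>) \<tau> (\<lambda>(x, y). x \<otimes>\<^bsub>G\<^esub> y) \<and>
     continuous_map \<tau> \<tau> (\<lambda>x. inv\<^bsub>G\<^esub> x)"

definition polish_group_topology :: "('g, 'b) monoid_scheme \<Rightarrow> 'g topology \<Rightarrow> bool" where
  "polish_group_topology G \<tau> \<longleftrightarrow> group_topology G \<tau> \<and> polish_space_top \<tau>"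

definition coarser :: "'g topology \<Rightarrow> 'g topology \<Rightarrow> bool" where
  "coarser \<sigma> \<tau> \<longleftrightarrow> topspace \<sigma> = topspace \<tau> \<and> (\<forall>U. openin \<sigma> U \<longrightarrow> openin \<tau> U)"


definition standard_borel :: "'a measure \<Rightarrow> bool" where
  "standard_borel M \<longleftrightarrow>
     (\<exists>X. polish_space_top X \<and> topspace X = space M \<and>
          sets M = sigma_sets (space M) {U. openin X U})"

definition atomless :: "'a measure \<Rightarrow> bool" where
  "atomless M \<longleftrightarrow>
     (\<forall>A \<in> sets M. 0 < emeasure M A \<longrightarrow>
        (\<exists>B \<in> sets M. B \<subseteq> A \<and> 0 < emeasure M B \<and> emeasure M B < emeasure M A))"

definition standard_sigma_finite_space :: "'a measure \<Rightarrow> bool" where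
  "standard_sigma_finite_space M \<longleftrightarrow>
     standard_borel M \<and> sigma_finite_measure M \<and> atomless M \<and> emeasure M (space M) = \<infinity>"


text \<open>
  The condition \<open>T ` A \<in> sets M\<close> says that the inverse of \<open>T\<close> is Borel as well. On a standard
  Borel space it is automatic (Lusin--Souslin); it is stated so that \<open>emeasure M (T ` A)\<close> is
  meaningful without appeal to that theorem.
\<close>

definition mp_bij :: "'a measure \<Rightarrow> ('a \<Rightarrow> 'a) set" where
  "mp_bij M = {T \<in> Bij (space M). T \<in> measurable M M \<and>
     (\<forall>A \<in> sets M. T ` A \<in> sets M \<and>
        emeasure M (T ` A) = emeasure M A \<and>
        emeasure M (T -` A \<inter> space M) = emeasure M A)}"

definition mp_group :: "'a measure \<Rightarrow> ('a \<Rightarrow> 'a) monoid" where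
  "mp_group M = BijGroup (space M) \<lparr>carrier := mp_bij M\<rparr>"

definition null_id :: "'a measure \<Rightarrow> ('a \<Rightarrow> 'a) set" where
  "null_id M = {T \<in> mp_bij M. AE x in M. T x = x}"

text \<open>
  Identifying bijections that coincide on a conull set means dividing by the normal subgroup of
  those which are almost everywhere the identity: elements of \<open>carrier (Aut M)\<close> are exactly the
  classes of almost everywhere equality (lemmas \<open>Aut_class\<close> and \<open>carrier_Aut\<close>).
\<close>

definition Aut :: "'a measure \<Rightarrow> ('a \<Rightarrow> 'a) set monoid" where
  "Aut M = mp_group M Mod null_id M"

text \<open>
  A representative of a class. It is only used in expressions that do not change when the
  representative is modified on a null set.
\<close>

definition rep :: "('a \<Rightarrow> 'a) set \<Rightarrow> 'a \<Rightarrow> 'a" where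
  "rep T = (SOME t. t \<in> T)"


text \<open>Pieces of the partition may be empty, so finite partitions are covered too.\<close>

definition full_group :: "'a measure \<Rightarrow> ('a \<Rightarrow> 'a) set set \<Rightarrow> bool" where
  "full_group M \<G> \<longleftrightarrow>
     subgroup \<G> (Aut M) \<and>
     (\<forall>T \<in> carrier (Aut M). \<forall>(A :: nat \<Rightarrow> 'a set) (S :: nat \<Rightarrow> ('a \<Rightarrow> 'a) set).
        (\<forall>n. A n \<in> sets M) \<and> disjoint_family A \<and> (\<Union>n. A n) = space M \<and>
        (\<forall>n. S n \<in> \<G>) \<and> (\<forall>n. AE x in M. x \<in> A n \<longrightarrow> rep T x = rep (S n) x)
        \<longrightarrow> T \<in> \<G>)"

definition ergodic_group :: "'a measure \<Rightarrow> ('a \<Rightarrow> 'a) set set \<Rightarrow> bool" where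
  "ergodic_group M \<G> \<longleftrightarrow>
     (\<forall>A \<in> sets M. (\<forall>T \<in> \<G>. emeasure M (sym_diff (rep T ` A) A) = 0) \<longrightarrow>
        emeasure M A = 0 \<or> emeasure M (space M - A) = 0)"


definition finite_sets :: "'a measure \<Rightarrow> 'a set set" where
  "finite_sets M = {A \<in> sets M. emeasure M A < \<infinity>}"

definition d_unif :: "'a measure \<Rightarrow> 'a set \<Rightarrow> ('a \<Rightarrow> 'a) set \<Rightarrow> ('a \<Rightarrow> 'a) set \<Rightarrow> real" where
  "d_unif M C S T = measure M {x \<in> C. rep S x \<noteq> rep T x}"

definition d_weak :: "'a measure \<Rightarrow> 'a set \<Rightarrow> ('a \<Rightarrow> 'a) set \<Rightarrow> ('a \<Rightarrow> 'a) set \<Rightarrow> real" where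
  "d_weak M A S T = measure M (sym_diff (rep S ` A) (rep T ` A))"

definition uniform_topology :: "'a measure \<Rightarrow> ('a \<Rightarrow> 'a) set topology" where
  "uniform_topology M = topology_generated_by
     {{T \<in> carrier (Aut M). d_unif M C S T < r} | S C r.
        S \<in> carrier (Aut M) \<and> C \<in> finite_sets M \<and> r > 0}"

text \<open>
  The weak topology is the one of the pseudometrics \<open>d_weak M A\<close> with \<open>A\<close> of finite measure. By
  lemma \<open>limitin_weak_topology\<close> below, its convergent sequences are as expected.
\<close>

definition weak_topology :: "'a measure \<Rightarrow> ('a \<Rightarrow> 'a) set topology" where
  "weak_topology M = topology_generated_by
     {{T \<in> carrier (Aut M). d_weak M A S T < r} | S A r.
        S \<in> carrier (Aut M) \<and> A \<in> finite_sets M \<and> r > 0}"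


lemma mp_bijD:
  assumes "T \<in> mp_bij M"
  shows "T \<in> Bij (space M)" "T \<in> measurable M M"
    "\<And>A. A \<in> sets M \<Longrightarrow> T ` A \<in> sets M"
    "\<And>A. A \<in> sets M \<Longrightarrow> emeasure M (T ` A) = emeasure M A"
    "\<And>A. A \<in> sets M \<Longrightarrow> emeasure M (T -` A \<inter> space M) = emeasure M A"
  using assms by (auto simp: mp_bij_def)

lemma vimage_inv_eq_image:
  assumes "T \<in> Bij X" "A \<subseteq> X"
  shows "restrict (inv_into X T) X -` A \<inter> X = T ` A"
    and "restrict (inv_into X T) X ` A = T -` A \<inter> X"
proof -
  have inj: "inj_on T X" and im: "T ` X = X"
    using assms(1) by (auto simp: Bij_def bij_betw_def)
  have fi: "T (inv_into X T x) = x" "inv_into X T x \<in> X" if "x \<in> X" for x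
    using that im by (simp_all add: f_inv_into_f inv_into_into)
  have ifx: "inv_into X T (T x) = x" "T x \<in> X" if "x \<in> X" for x
    using that im inj by auto
  show "restrict (inv_into X T) X -` A \<inter> X = T ` A"
  proof (intro equalityI subsetI)
    fix y assume y: "y \<in> restrict (inv_into X T) X -` A \<inter> X"
    then have "inv_into X T y \<in> A" "T (inv_into X T y) = y" using fi by auto
    then show "y \<in> T ` A" by force
  next
    fix y assume "y \<in> T ` A"
    then obtain x where x: "x \<in> A" "y = T x" by blast
    then show "y \<in> restrict (inv_into X T) X -` A \<inter> X"
      using assms(2) ifx[of x] by auto
  qed
  show "restrict (inv_into X T) X ` A = T -` A \<inter> X"
  proof (intro equalityI subsetI)
    fix y assume "y \<in> restrict (inv_into X T) X ` A"
    then obtain x where x: "x \<in> A" "x \<in> X" "y = inv_into X T x" using assms(2) by auto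
    then show "y \<in> T -` A \<inter> X" using fi[of x] by simp
  next
    fix y assume y: "y \<in> T -` A \<inter> X"
    then have "y = restrict (inv_into X T) X (T y)" using ifx[of y] by simp
    then show "y \<in> restrict (inv_into X T) X ` A" using y by blast
  qed
qed

lemma mp_bij_subgroup: "subgroup (mp_bij M) (BijGroup (space M))"
proof (rule group.subgroupI[OF group_BijGroup])
  show "mp_bij M \<subseteq> carrier (BijGroup (space M))"
    by (auto simp: mp_bij_def BijGroup_def)
  have "(\<lambda>x \<in> space M. x) \<in> mp_bij M"
  proof -
    have "(\<lambda>x \<in> space M. x) \<in> measurable M M"
      by (rule measurable_cong[THEN iffD1, of _ "\<lambda>x. x"]) auto
    moreover have "(\<lambda>x \<in> space M. x) ` A = A"
        "(\<lambda>x \<in> space M. x) -` A \<inter> space M = A" if "A \<in> sets M" for A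
      using sets.sets_into_space[OF that] by (auto simp: image_iff)
    ultimately show ?thesis by (simp add: mp_bij_def id_Bij)
  qed
  then show "mp_bij M \<noteq> {}" by auto
next
  fix T assume T: "T \<in> mp_bij M"
  let ?I = "restrict (inv_into (space M) T) (space M)"
  have B: "T \<in> Bij (space M)" using mp_bijD(1)[OF T] .
  have "?I \<in> mp_bij M"
    unfolding mp_bij_def mem_Collect_eq
  proof (intro conjI ballI)
    show "?I \<in> Bij (space M)" using B by (rule restrict_inv_into_Bij)
    show "?I \<in> measurable M M"
    proof (rule measurableI)
      fix x assume "x \<in> space M" then show "?I x \<in> space M"
        using Bij_inv_into_mem[OF B] by simp
    next
      fix A assume A: "A \<in> sets M"
      show "?I -` A \<inter> space M \<in> sets M"
        using vimage_inv_eq_image(1)[OF B sets.sets_into_space[OF A]] mp_bijD(3)[OF T A] by simp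
    qed
    fix A assume A: "A \<in> sets M"
    note v = vimage_inv_eq_image[OF B sets.sets_into_space[OF A]]
    show "?I ` A \<in> sets M" using v(2) measurable_sets[OF mp_bijD(2)[OF T] A] by simp
    show "emeasure M (?I ` A) = emeasure M A" using v(2) mp_bijD(5)[OF T A] by simp
    show "emeasure M (?I -` A \<inter> space M) = emeasure M A" using v(1) mp_bijD(4)[OF T A] by simp
  qed
  then show "inv\<^bsub>BijGroup (space M)\<^esub> T \<in> mp_bij M" using inv_BijGroup[OF B] by simp
next
  fix S T assume S: "S \<in> mp_bij M" and T: "T \<in> mp_bij M"
  note B = mp_bijD(1)[OF S] mp_bijD(1)[OF T]
  have "compose (space M) S T \<in> mp_bij M"
    unfolding mp_bij_def mem_Collect_eq
  proof (intro conjI ballI)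
    show "compose (space M) S T \<in> Bij (space M)" using B by (rule compose_Bij)
    have "(\<lambda>x. S (T x)) \<in> measurable M M"
      using measurable_compose[OF mp_bijD(2)[OF T] mp_bijD(2)[OF S]] .
    then show "compose (space M) S T \<in> measurable M M"
      by (subst measurable_cong[where g = "\<lambda>x. S (T x)"]) (auto simp: compose_def)
    fix A assume A: "A \<in> sets M"
    note AX = sets.sets_into_space[OF A]
    have i: "compose (space M) S T ` A = S ` (T ` A)"
      using AX by (auto simp: compose_def image_iff subset_iff)
    show "compose (space M) S T ` A \<in> sets M"
      unfolding i using mp_bijD(3)[OF S mp_bijD(3)[OF T A]] .
    show "emeasure M (compose (space M) S T ` A) = emeasure M A"
      unfolding i using mp_bijD(4)[OF S mp_bijD(3)[OF T A]] mp_bijD(4)[OF T A] by simp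
    have v: "compose (space M) S T -` A \<inter> space M = T -` (S -` A \<inter> space M) \<inter> space M"
      using measurable_space[OF mp_bijD(2)[OF T]] by (auto simp: compose_def)
    show "emeasure M (compose (space M) S T -` A \<inter> space M) = emeasure M A"
      unfolding v using mp_bijD(5)[OF T measurable_sets[OF mp_bijD(2)[OF S] A]]
        mp_bijD(5)[OF S A] by simp
  qed
  then show "S \<otimes>\<^bsub>BijGroup (space M)\<^esub> T \<in> mp_bij M"
    using B by (simp add: BijGroup_def)
qed

lemma mp_group_group: "group (mp_group M)"
  unfolding mp_group_def
  by (rule subgroup.subgroup_is_group[OF mp_bij_subgroup group_BijGroup])

lemma carrier_mp_group [simp]: "carrier (mp_group M) = mp_bij M"
  by (simp add: mp_group_def)

lemma one_mp_group: "\<one>\<^bsub>mp_group M\<^esub> = (\<lambda>x \<in> space M. x)"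
  by (simp add: mp_group_def BijGroup_def)

lemma mult_mp_group:
  "S \<in> mp_bij M \<Longrightarrow> T \<in> mp_bij M \<Longrightarrow> S \<otimes>\<^bsub>mp_group M\<^esub> T = compose (space M) S T"
  by (simp add: mp_group_def BijGroup_def mp_bijD(1))

lemma AE_mp_bij:
  assumes T: "T \<in> mp_bij M" and P: "AE x in M. P x"
  shows "AE x in M. P (T x)"
proof -
  obtain N where N: "{x \<in> space M. \<not> P x} \<subseteq> N" "N \<in> sets M" "emeasure M N = 0"
    using P by (auto elim: AE_E)
  show ?thesis
  proof (rule AE_I)
    show "{x \<in> space M. \<not> P (T x)} \<subseteq> T -` N \<inter> space M"
      using N(1) measurable_space[OF mp_bijD(2)[OF T]] by auto
    show "emeasure M (T -` N \<inter> space M) = 0" using mp_bijD(5)[OF T N(2)] N(3) by simp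
    show "T -` N \<inter> space M \<in> sets M" using measurable_sets[OF mp_bijD(2)[OF T] N(2)] .
  qed
qed

lemma mult_inv_mp:
  assumes S: "S \<in> mp_bij M" and T: "T \<in> mp_bij M"
  shows "S \<otimes>\<^bsub>mp_group M\<^esub> inv\<^bsub>mp_group M\<^esub> T \<in> null_id M \<longleftrightarrow> (AE x in M. S x = T x)"
proof -
  interpret G: group "mp_group M" by (rule mp_group_group)
  let ?H = "S \<otimes>\<^bsub>mp_group M\<^esub> inv\<^bsub>mp_group M\<^esub> T"
  have H: "?H \<in> mp_bij M" and I: "inv\<^bsub>mp_group M\<^esub> T \<in> mp_bij M"
    using S T G.m_closed G.inv_closed by auto
  have HT: "?H \<otimes>\<^bsub>mp_group M\<^esub> T = S"
    using S T by (simp add: G.m_assoc G.inv_closed[simplified])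
  have e: "?H (T x) = S x" if "x \<in> space M" for x
    using HT mult_mp_group[OF H T] that by (metis compose_eq)
  have e2: "?H x = S ((inv\<^bsub>mp_group M\<^esub> T) x)" "T ((inv\<^bsub>mp_group M\<^esub> T) x) = x"
    if "x \<in> space M" for x
  proof -
    show "?H x = S ((inv\<^bsub>mp_group M\<^esub> T) x)"
      using mult_mp_group[OF S I] that by (simp add: compose_eq)
    have "T \<otimes>\<^bsub>mp_group M\<^esub> inv\<^bsub>mp_group M\<^esub> T = \<one>\<^bsub>mp_group M\<^esub>" using T by simp
    then show "T ((inv\<^bsub>mp_group M\<^esub> T) x) = x"
      using mult_mp_group[OF T I] that by (metis compose_eq one_mp_group restrict_apply')
  qed
  show ?thesis
  proof
    assume "?H \<in> null_id M"
    then have "AE x in M. ?H x = x" by (simp add: null_id_def)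
    from AE_mp_bij[OF T this] show "AE x in M. S x = T x"
      by (rule AE_mp) (auto simp: e)
  next
    assume "AE x in M. S x = T x"
    from AE_mp_bij[OF I this] have "AE x in M. ?H x = x"
      by (rule AE_mp) (auto simp: e2)
    with H show "?H \<in> null_id M" by (simp add: null_id_def)
  qed
qed

lemma null_id_normal: "null_id M \<lhd> mp_group M"
proof -
  interpret G: group "mp_group M" by (rule mp_group_group)
  have sub: "subgroup (null_id M) (mp_group M)"
  proof (rule G.subgroupI)
    show "null_id M \<subseteq> carrier (mp_group M)" by (auto simp: null_id_def)
    show "null_id M \<noteq> {}"
      using G.one_closed by (auto simp: null_id_def one_mp_group intro!: exI[of _ "\<lambda>x\<in>space M. x"])
  next
    fix T assume T: "T \<in> null_id M"
    then have Tm: "T \<in> mp_bij M" by (simp add: null_id_def)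
    have "AE x in M. \<one>\<^bsub>mp_group M\<^esub> x = T x"
      using T by (auto simp: null_id_def one_mp_group)
    moreover have "\<one>\<^bsub>mp_group M\<^esub> \<in> mp_bij M" using G.one_closed by simp
    ultimately have "\<one>\<^bsub>mp_group M\<^esub> \<otimes>\<^bsub>mp_group M\<^esub> inv\<^bsub>mp_group M\<^esub> T \<in> null_id M"
      using mult_inv_mp Tm by blast
    then show "inv\<^bsub>mp_group M\<^esub> T \<in> null_id M" using Tm by (simp add: G.inv_closed[simplified])
  next
    fix S T assume S: "S \<in> null_id M" and T: "T \<in> null_id M"
    then have m: "S \<in> mp_bij M" "T \<in> mp_bij M" by (auto simp: null_id_def)
    have "AE x in M. S x = x" using S by (simp add: null_id_def)
    from AE_mp_bij[OF m(2) this] have "AE x in M. S (T x) = T x" .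
    moreover have "AE x in M. T x = x" using T by (simp add: null_id_def)
    ultimately have "AE x in M. S (T x) = x" by eventually_elim simp
    then have "AE x in M. compose (space M) S T x = x"
      by (rule AE_mp) (auto simp: compose_def)
    then show "S \<otimes>\<^bsub>mp_group M\<^esub> T \<in> null_id M"
      using m G.m_closed[of S T] by (simp add: null_id_def mult_mp_group)
  qed
  show ?thesis
    unfolding G.normal_inv_iff
  proof (intro conjI sub ballI)
    fix S T assume S: "S \<in> carrier (mp_group M)" and T: "T \<in> null_id M"
    then have m: "S \<in> mp_bij M" "T \<in> mp_bij M" by (auto simp: null_id_def)
    have "AE x in M. T x = x" using T by (simp add: null_id_def)
    then have "AE x in M. compose (space M) S T x = S x" by (auto simp: compose_def)
    then show "S \<otimes>\<^bsub>mp_group M\<^esub> T \<otimes>\<^bsub>mp_group M\<^esub> inv\<^bsub>mp_group M\<^esub> S \<in> null_id M"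
      using mult_inv_mp[of "S \<otimes>\<^bsub>mp_group M\<^esub> T" M S] m G.m_closed[of S T]
      by (simp add: mult_mp_group)
  qed
qed

lemma Aut_group: "group (Aut M)"
  unfolding Aut_def by (rule normal.factorgroup_is_group[OF null_id_normal])

lemma Aut_class:
  assumes T: "T \<in> mp_bij M"
  shows "null_id M #>\<^bsub>mp_group M\<^esub> T = {S \<in> mp_bij M. AE x in M. S x = T x}"
proof -
  interpret G: group "mp_group M" by (rule mp_group_group)
  have "S \<in> null_id M #>\<^bsub>mp_group M\<^esub> T \<longleftrightarrow> S \<in> mp_bij M \<and> (AE x in M. S x = T x)" for S
  proof
    assume "S \<in> null_id M #>\<^bsub>mp_group M\<^esub> T"
    then obtain h where h: "h \<in> null_id M" "S = h \<otimes>\<^bsub>mp_group M\<^esub> T"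
      by (auto simp: r_coset_def)
    then have hm: "h \<in> mp_bij M" by (simp add: null_id_def)
    have Sm: "S \<in> mp_bij M" using h(2) hm T G.m_closed by auto
    have "S \<otimes>\<^bsub>mp_group M\<^esub> inv\<^bsub>mp_group M\<^esub> T = h"
      using h(2) hm T by (simp add: G.m_assoc G.inv_closed[simplified])
    then show "S \<in> mp_bij M \<and> (AE x in M. S x = T x)"
      using Sm mult_inv_mp[OF Sm T] h(1) by simp
  next
    assume S: "S \<in> mp_bij M \<and> (AE x in M. S x = T x)"
    then have "S \<otimes>\<^bsub>mp_group M\<^esub> inv\<^bsub>mp_group M\<^esub> T \<in> null_id M"
      using mult_inv_mp T by blast
    moreover have "S \<otimes>\<^bsub>mp_group M\<^esub> inv\<^bsub>mp_group M\<^esub> T \<otimes>\<^bsub>mp_group M\<^esub> T = S"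
      using S T by (simp add: G.m_assoc G.inv_closed[simplified])
    ultimately show "S \<in> null_id M #>\<^bsub>mp_group M\<^esub> T"
      unfolding r_coset_def by force
  qed
  then show ?thesis by blast
qed

lemma carrier_Aut:
  "carrier (Aut M) = (\<lambda>T. {S \<in> mp_bij M. AE x in M. S x = T x}) ` mp_bij M"
  unfolding Aut_def carrier_FactGroup by (simp add: Aut_class cong: image_cong)

lemma rep_mp_bij: "T \<in> carrier (Aut M) \<Longrightarrow> rep T \<in> mp_bij M"
proof -
  assume "T \<in> carrier (Aut M)"
  then obtain t where t: "t \<in> mp_bij M" "T = {S \<in> mp_bij M. AE x in M. S x = t x}"
    by (auto simp: carrier_Aut)
  then have "t \<in> T" by auto
  then have "rep T \<in> T" unfolding rep_def by (rule someI[of "\<lambda>u. u \<in> T"])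
  then show ?thesis using t by auto
qed

lemma d_weak_self: "d_weak M A T T = 0"
  by (simp add: d_weak_def)

lemma d_weak_triangle:
  assumes "R \<in> carrier (Aut M)" "S \<in> carrier (Aut M)" "T \<in> carrier (Aut M)"
    and A: "A \<in> finite_sets M"
  shows "d_weak M A R T \<le> d_weak M A R S + d_weak M A S T"
proof -
  have f: "rep Q ` A \<in> fmeasurable M" if "Q \<in> carrier (Aut M)" for Q
    using mp_bijD(3,4)[OF rep_mp_bij[OF that]] A
    by (auto simp: fmeasurable_def finite_sets_def)
  note fs = assms(1-3)[THEN f]
  have "measure M (sym_diff (rep R ` A) (rep T ` A)) \<le>
      measure M (sym_diff (rep R ` A) (rep S ` A) \<union> sym_diff (rep S ` A) (rep T ` A))"
    by (rule measure_mono_fmeasurable)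
       (use fs in \<open>auto intro!: fmeasurable.Un fmeasurable.Diff dest: fmeasurableD\<close>)
  also have "\<dots> \<le> measure M (sym_diff (rep R ` A) (rep S ` A)) +
      measure M (sym_diff (rep S ` A) (rep T ` A))"
    by (rule measure_Un_le) (use fs in \<open>auto dest: fmeasurableD\<close>)
  finally show ?thesis by (simp add: d_weak_def)
qed

lemma topspace_weak_topology: "topspace (weak_topology M) = carrier (Aut M)"
proof -
  have "{} \<in> finite_sets M" by (simp add: finite_sets_def)
  then show ?thesis
    unfolding weak_topology_def topology_generated_by_topspace
    by (auto simp: d_weak_self) (metis (no_types, lifting) d_weak_self mem_Collect_eq zero_less_one)
qed

lemma limitin_weak_topology:
  assumes Tn: "\<And>n. Tn n \<in> carrier (Aut M)" and T: "T \<in> carrier (Aut M)"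
  shows "limitin (weak_topology M) Tn T sequentially \<longleftrightarrow>
    (\<forall>A \<in> finite_sets M. (\<lambda>n. measure M (sym_diff (rep (Tn n) ` A) (rep T ` A))) \<longlonglongrightarrow> 0)"
proof
  assume L: "limitin (weak_topology M) Tn T sequentially"
  show "\<forall>A \<in> finite_sets M. (\<lambda>n. measure M (sym_diff (rep (Tn n) ` A) (rep T ` A))) \<longlonglongrightarrow> 0"
  proof
    fix A assume A: "A \<in> finite_sets M"
    have "\<forall>\<^sub>F n in sequentially. dist (d_weak M A T (Tn n)) 0 < r" if r: "r > 0" for r
    proof -
      have "openin (weak_topology M) {S \<in> carrier (Aut M). d_weak M A T S < r}"
        unfolding weak_topology_def by (rule topology_generated_by_Basis) (use A T r in auto)
      moreover have "T \<in> {S \<in> carrier (Aut M). d_weak M A T S < r}"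
        using T r by (simp add: d_weak_self)
      ultimately have "\<forall>\<^sub>F n in sequentially. Tn n \<in> {S \<in> carrier (Aut M). d_weak M A T S < r}"
        using L unfolding limitin_def by blast
      then show ?thesis
        by eventually_elim (simp add: d_weak_def)
    qed
    then have "(\<lambda>n. d_weak M A T (Tn n)) \<longlonglongrightarrow> 0" by (rule tendstoI)
    then show "(\<lambda>n. measure M (sym_diff (rep (Tn n) ` A) (rep T ` A))) \<longlonglongrightarrow> 0"
      by (simp add: d_weak_def Un_commute)
  qed
next
  assume C: "\<forall>A \<in> finite_sets M.
    (\<lambda>n. measure M (sym_diff (rep (Tn n) ` A) (rep T ` A))) \<longlonglongrightarrow> 0"
  have "T \<in> U \<Longrightarrow> \<forall>\<^sub>F n in sequentially. Tn n \<in> U"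
    if "generate_topology_on {{T \<in> carrier (Aut M). d_weak M A S T < r} | S A r.
        S \<in> carrier (Aut M) \<and> A \<in> finite_sets M \<and> r > 0} U" for U
    using that
  proof induction
    case Empty then show ?case by simp
  next
    case (Int a b) then show ?case by (auto simp: eventually_conj_iff)
  next
    case (UN K)
    then obtain k where "k \<in> K" "T \<in> k" by auto
    with UN have "\<forall>\<^sub>F n in sequentially. Tn n \<in> k" by auto
    then show ?case by eventually_elim (use \<open>k \<in> K\<close> in auto)
  next
    case (Basis s)
    then obtain S A r where s: "s = {T \<in> carrier (Aut M). d_weak M A S T < r}"
      and S: "S \<in> carrier (Aut M)" and A: "A \<in> finite_sets M" by auto
    have "(\<lambda>n. d_weak M A T (Tn n)) \<longlonglongrightarrow> 0"
      using C A by (simp add: d_weak_def Un_commute)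
    moreover have "0 < r - d_weak M A S T" using Basis s by simp
    ultimately have "\<forall>\<^sub>F n in sequentially. d_weak M A T (Tn n) < r - d_weak M A S T"
      by (rule order_tendstoD(2))
    then show ?case
    proof eventually_elim
      case (elim n)
      then show ?case using d_weak_triangle[OF S T Tn A, of n] Tn s by auto
    qed
  qed
  then show "limitin (weak_topology M) Tn T sequentially"
    using T unfolding limitin_def topspace_weak_topology
    by (simp add: weak_topology_def openin_topology_generated_by_iff)
qed

end

theory Submission
  imports Defs
begin

text \<open>
  Let \<open>\<tau>\<close> be a Polish group topology on the ergodic full group \<open>\<G>\<close>. By ergodicity two sets of
  equal finite measure are exchanged by an involution in \<open>\<G>\<close>; hence the elements supported in \<open>A\<close>
  are those commuting with every element supported off \<open>A\<close>, and both this subgroup and the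
  stabiliser of \<open>A\<close> are \<open>\<tau>\<close>-closed. If \<open>B\<close> has small measure, the products
  \<open>g s g\<^sup>-\<^sup>1 u\<close> with \<open>s\<close> supported in \<open>B\<close> and \<open>u\<close> stabilising \<open>A\<close> form an
  analytic set of elements that move \<open>A\<close> little, and countably many translates of it cover
  \<open>\<G>\<close>. An analytic nonmeager set is comeager in some nonempty open set, so by Pettis' argument
  \<open>\<tau>\<close> refines the weak topology.

  Two topologies refining a common Hausdorff topology make the graph of the identity closed. The
  closed graph theorem for Polish groups then gives uniqueness. Applied to the uniform closure of a
  countable subgroup, which is a Polish group for the uniform topology, it shows that a sequence
  converging uniformly to the identity converges in \<open>\<tau>\<close>.
\<close>

section \<open>Meager sets and continuous images of Polish spaces\<close>

text \<open>The topology \<tau> is tied to the measure by nothing but the group operations, so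
  whatever enters a category argument must be described algebraically or be a continuous image of
  sets that are. Hence supports appear as centralisers and stabilisers through conjugation:
  conditions of this kind are closed in every Hausdorff group topology. The elements that move
  \<open>A\<close> little have no such description. The products do: they are the image of a product
  of three Polish spaces under a continuous map, and the free conjugator lets a single small set
  \<open>B\<close> absorb every small support.

  The measure is infinite and gives a family of pseudometrics only. An equivalent finite measure
  \<open>nu\<close> yields one metric; it is not invariant, and where invariance would be used, its
  place is taken by the fact that preimages of \<open>nu\<close>-small sets under a fixed
  measure-preserving bijection are \<open>nu\<close>-small.\<close>

definition meager_in :: "'a topology \<Rightarrow> 'a set \<Rightarrow> bool" where
  "meager_in X S \<longleftrightarrow> (\<exists>\<N>. countable \<N> \<and> (\<forall>N\<in>\<N>. closedin X N \<and> X interior_of N = {}) \<and> S \<subseteq> \<Union>\<N>)"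

lemma meager_in_subset: "meager_in X T \<Longrightarrow> S \<subseteq> T \<Longrightarrow> meager_in X S"
  unfolding meager_in_def by (meson order_trans)

lemma meager_in_closed: "closedin X N \<Longrightarrow> X interior_of N = {} \<Longrightarrow> meager_in X N"
  unfolding meager_in_def by (intro exI[of _ "{N}"]) auto

lemma meager_in_empty [simp]: "meager_in X {}"
  by (rule meager_in_closed) auto

lemma meager_in_UN:
  assumes "countable I" "\<And>i. i \<in> I \<Longrightarrow> meager_in X (S i)"
  shows "meager_in X (\<Union>i\<in>I. S i)"
proof -
  obtain \<N> where \<N>: "\<And>i. i \<in> I \<Longrightarrow> countable (\<N> i)"
    "\<And>i N. i \<in> I \<Longrightarrow> N \<in> \<N> i \<Longrightarrow> closedin X N \<and> X interior_of N = {}"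
    "\<And>i. i \<in> I \<Longrightarrow> S i \<subseteq> \<Union>(\<N> i)"
    using assms(2) unfolding meager_in_def by metis
  have "countable (\<Union>i\<in>I. \<N> i)" using assms(1) \<N>(1) by (rule countable_UN)
  moreover have "\<forall>N\<in>(\<Union>i\<in>I. \<N> i). closedin X N \<and> X interior_of N = {}" using \<N>(2) by blast
  moreover have "(\<Union>i\<in>I. S i) \<subseteq> \<Union>(\<Union>i\<in>I. \<N> i)"
  proof
    fix x assume "x \<in> (\<Union>i\<in>I. S i)"
    then obtain i where i: "i \<in> I" "x \<in> S i" by blast
    then obtain N where "N \<in> \<N> i" "x \<in> N" using \<N>(3)[OF i(1)] by blast
    then show "x \<in> \<Union>(\<Union>i\<in>I. \<N> i)" using i(1) by (intro UnionI[of N]) auto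
  qed
  ultimately show ?thesis unfolding meager_in_def by (intro exI[of _ "\<Union>i\<in>I. \<N> i"] conjI)
qed

lemma meager_in_Un: "meager_in X S \<Longrightarrow> meager_in X T \<Longrightarrow> meager_in X (S \<union> T)"
  using meager_in_UN[of "{True, False}" X "\<lambda>b. if b then S else T"] by (simp add: Un_commute)

lemma meager_in_diff_interior:
  assumes "closedin X C"
  shows "meager_in X (C - X interior_of C)"
proof (rule meager_in_closed)
  show cl: "closedin X (C - X interior_of C)" using assms by (simp add: closedin_diff)
  have "X interior_of (C - X interior_of C) \<subseteq> X interior_of C"
    by (rule interior_of_mono) auto
  moreover have "X interior_of (C - X interior_of C) \<subseteq> C - X interior_of C"
    by (rule interior_of_subset)
  ultimately show "X interior_of (C - X interior_of C) = {}" by blast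
qed

lemma meager_in_closure_diff:
  assumes "openin X U"
  shows "meager_in X (X closure_of U - U)"
proof (rule meager_in_closed)
  show "closedin X (X closure_of U - U)" using assms by (simp add: closedin_diff)
  show "X interior_of (X closure_of U - U) = {}"
  proof (rule ccontr)
    assume "\<not> ?thesis"
    then obtain x where x: "x \<in> X interior_of (X closure_of U - U)" by blast
    let ?I = "X interior_of (X closure_of U - U)"
    have I: "openin X ?I" by simp
    have I': "?I \<subseteq> X closure_of U - U" by (rule interior_of_subset)
    then have "x \<in> X closure_of U" using x by blast
    then obtain y where "y \<in> U" "y \<in> ?I" using I x unfolding in_closure_of by blast
    then show False using I' by blast
  qed
qed

lemma not_meager_in_open:
  assumes "completely_metrizable_space X" "openin X U" "U \<noteq> {}"
  shows "\<not> meager_in X U"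
proof
  assume "meager_in X U"
  then obtain \<N> where \<N>: "countable \<N>" "\<forall>N\<in>\<N>. closedin X N \<and> X interior_of N = {}" "U \<subseteq> \<Union>\<N>"
    unfolding meager_in_def by blast
  then have "X interior_of \<Union>\<N> = {}" using Baire_category_alt[of X \<N>] assms(1) by blast
  then show False using interior_of_maximal[OF \<N>(3) assms(2)] assms(3) by blast
qed

lemma meager_in_homeomorphic_image:
  assumes "homeomorphic_map X X f" "meager_in X S"
  shows "meager_in X (f ` S)"
proof -
  obtain \<N> where \<N>: "countable \<N>" "\<forall>N\<in>\<N>. closedin X N \<and> X interior_of N = {}" "S \<subseteq> \<Union>\<N>"
    using assms(2) unfolding meager_in_def by blast
  show ?thesis unfolding meager_in_def
  proof (intro exI[of _ "(`) f ` \<N>"] conjI ballI)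
    fix N assume "N \<in> (`) f ` \<N>"
    then obtain K where K: "K \<in> \<N>" "N = f ` K" by blast
    then show "closedin X N"
      using \<N>(2) assms(1) homeomorphic_map_closedness_eq[of X X f K] by blast
    show "X interior_of N = {}"
      using homeomorphic_map_interior_of[OF assms(1), of K] \<N>(2) K closedin_subset by auto
  next
    show "f ` S \<subseteq> \<Union>((`) f ` \<N>)" using \<N>(3) by blast
  qed (use \<N> in simp)
qed

section \<open>Second countability and closure properties of Polish spaces\<close>

lemma second_countable_if_separable:
  assumes "metrizable_space X" "separable_space X"
  shows "second_countable X"
proof -
  obtain M d where "Metric_space M d" and X: "X = Metric_space.mtopology M d"
    using assms(1) unfolding metrizable_space_def by blast
  then interpret Metric_space M d by simp
  obtain C where C: "countable C" "C \<subseteq> M" "mtopology closure_of C = M"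
    using assms(2) unfolding separable_space_def X by auto
  let ?B = "(\<lambda>(c, n). mball c (inverse (Suc n))) ` (C \<times> (UNIV :: nat set))"
  have "\<exists>V\<in>?B. x \<in> V \<and> V \<subseteq> U" if U: "openin mtopology U" and x: "x \<in> U" for U x
  proof -
    obtain r where r: "r > 0" "mball x r \<subseteq> U" using U x openin_mtopology by blast
    obtain n where n: "inverse (real (Suc n)) < r / 2" using reals_Archimedean[of "r / 2"] r by auto
    have xM: "x \<in> M" using U x openin_mtopology by blast
    then have "x \<in> mtopology closure_of C" using C by simp
    then obtain c where c: "c \<in> C" "c \<in> mball x (inverse (Suc n))"
      unfolding in_closure_of using openin_mball xM centre_in_mball_iff commute
      by (smt (verit) in_mball inverse_positive_iff_positive of_nat_0_less_iff zero_less_Suc)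
    have "mball c (inverse (Suc n)) \<subseteq> mball x r"
    proof
      fix y assume y: "y \<in> mball c (inverse (Suc n))"
      then have "d x y \<le> d x c + d c y" using triangle c xM by simp
      then show "y \<in> mball x r" using y c n xM by simp
    qed
    then show ?thesis using c r commute by (intro bexI[of _ "mball c (inverse (Suc n))"]) auto
  qed
  moreover have "countable ?B" using C(1) by simp
  moreover have "\<forall>V\<in>?B. openin mtopology V" by auto
  ultimately show ?thesis unfolding second_countable_def X by (intro exI[of _ ?B]) blast
qed

lemma second_countable_prod_topology:
  assumes "second_countable X" "second_countable Y"
  shows "second_countable (prod_topology X Y)"
proof -
  obtain \<A> where \<A>: "countable \<A>" "\<forall>V\<in>\<A>. openin X V"
    "\<forall>U x. openin X U \<and> x \<in> U \<longrightarrow> (\<exists>V\<in>\<A>. x \<in> V \<and> V \<subseteq> U)"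
    using assms(1) unfolding second_countable_def by blast
  obtain \<B> where \<B>: "countable \<B>" "\<forall>V\<in>\<B>. openin Y V"
    "\<forall>U x. openin Y U \<and> x \<in> U \<longrightarrow> (\<exists>V\<in>\<B>. x \<in> V \<and> V \<subseteq> U)"
    using assms(2) unfolding second_countable_def by blast
  let ?C = "(\<lambda>(A, B). A \<times> B) ` (\<A> \<times> \<B>)"
  have "\<exists>V\<in>?C. z \<in> V \<and> V \<subseteq> U" if "openin (prod_topology X Y) U" "z \<in> U" for U z
  proof -
    obtain x y where z: "z = (x, y)" by (cases z)
    have "\<exists>V W. openin X V \<and> openin Y W \<and> x \<in> V \<and> y \<in> W \<and> V \<times> W \<subseteq> U"
      using that(1)[unfolded openin_prod_topology_alt, rule_format, of x y] that(2) z by simp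
    then obtain V W where VW: "openin X V" "openin Y W" "x \<in> V" "y \<in> W" "V \<times> W \<subseteq> U"
      by (elim exE conjE)
    obtain A where A: "A \<in> \<A>" "x \<in> A" "A \<subseteq> V" using \<A>(3) VW by blast
    obtain B where B: "B \<in> \<B>" "y \<in> B" "B \<subseteq> W" using \<B>(3) VW by blast
    show ?thesis using A B VW(5) z by (intro bexI[of _ "A \<times> B"]) auto
  qed
  moreover have "countable ?C" using \<A>(1) \<B>(1) by simp
  moreover have "\<forall>V\<in>?C. openin (prod_topology X Y) V"
    using \<A>(2) \<B>(2) by (auto simp: openin_prod_Times_iff)
  ultimately show ?thesis unfolding second_countable_def by (intro exI[of _ ?C]) blast
qed

lemma polish_space_topD:
  assumes "polish_space_top X"
  shows "completely_metrizable_space X" "second_countable X" "Hausdorff_space X"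
  using assms second_countable_if_separable completely_metrizable_imp_metrizable_space
    metrizable_imp_Hausdorff_space
  unfolding polish_space_top_def by blast+

lemma polish_space_top_iff:
  "polish_space_top X \<longleftrightarrow> completely_metrizable_space X \<and> second_countable X"
  using polish_space_topD second_countable_imp_separable_space unfolding polish_space_top_def by blast

lemma polish_space_top_closedin:
  "polish_space_top X \<Longrightarrow> closedin X S \<Longrightarrow> polish_space_top (subtopology X S)"
  unfolding polish_space_top_iff
  using completely_metrizable_space_closedin second_countable_subtopology by blast

lemma polish_space_top_openin:
  "polish_space_top X \<Longrightarrow> openin X S \<Longrightarrow> polish_space_top (subtopology X S)"
  unfolding polish_space_top_iff
  using completely_metrizable_space_openin second_countable_subtopology by blast

lemma polish_space_top_prod:
  "polish_space_top X \<Longrightarrow> polish_space_top Y \<Longrightarrow> polish_space_top (prod_topology X Y)"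
  unfolding polish_space_top_iff
  by (auto simp: completely_metrizable_space_prod_topology intro: second_countable_prod_topology)

text \<open>The essential closure: the points all of whose neighbourhoods meet \<open>S\<close> in a nonmeager set.\<close>

definition ess_closure :: "'a topology \<Rightarrow> 'a set \<Rightarrow> 'a set" where
  "ess_closure X S = topspace X - \<Union>{U. openin X U \<and> meager_in X (S \<inter> U)}"

lemma closedin_ess_closure: "closedin X (ess_closure X S)"
  unfolding ess_closure_def by (intro closedin_diff) auto

lemma ess_closure_disjoint: "openin X U \<Longrightarrow> meager_in X (S \<inter> U) \<Longrightarrow> U \<inter> ess_closure X S = {}"
  unfolding ess_closure_def by blast

lemma meager_in_diff_ess_closure:
  assumes "second_countable X" "S \<subseteq> topspace X"
  shows "meager_in X (S - ess_closure X S)"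
proof -
  obtain \<B> where \<B>: "countable \<B>" "\<forall>V\<in>\<B>. openin X V"
    "\<forall>U x. openin X U \<and> x \<in> U \<longrightarrow> (\<exists>V\<in>\<B>. x \<in> V \<and> V \<subseteq> U)"
    using assms(1) unfolding second_countable_def by blast
  let ?I = "{V \<in> \<B>. meager_in X (S \<inter> V)}"
  have "meager_in X (\<Union>V\<in>?I. S \<inter> V)"
    by (rule meager_in_UN) (use \<B>(1) in auto)
  moreover have "S - ess_closure X S \<subseteq> (\<Union>V\<in>?I. S \<inter> V)"
  proof
    fix x assume x: "x \<in> S - ess_closure X S"
    then obtain U where U: "openin X U" "meager_in X (S \<inter> U)" "x \<in> U"
      using assms(2) unfolding ess_closure_def by blast
    then obtain V where V: "V \<in> \<B>" "x \<in> V" "V \<subseteq> U" using \<B>(3) by blast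
    then have "meager_in X (S \<inter> V)" using U(2) meager_in_subset by blast
    then show "x \<in> (\<Union>V\<in>?I. S \<inter> V)" using V x by blast
  qed
  ultimately show ?thesis by (rule meager_in_subset)
qed

text \<open>Let \<open>O'\<close> be the union of the interiors of the essential closures of the
  \<open>T i\<close>. Inside the interior of \<open>ess_closure X S\<close> but off the closure of
  \<open>O'\<close>, the set \<open>S\<close> is covered by the meager sets
  \<open>T i - ess_closure X (T i)\<close> and by the boundaries of these closures; an open set of
  essential points that meets \<open>S\<close> in a meager set is empty. What remains lies in two
  boundaries, which are meager.\<close>

lemma meager_in_ess_closure_diff:
  assumes "second_countable X" "countable I" "\<And>i. i \<in> I \<Longrightarrow> T i \<subseteq> topspace X" "S \<subseteq> (\<Union>i\<in>I. T i)"
  shows "meager_in X (ess_closure X S - (\<Union>i\<in>I. ess_closure X (T i)))"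
proof -
  define C where "C = ess_closure X S"
  define O' where "O' = (\<Union>i\<in>I. X interior_of ess_closure X (T i))"
  define V where "V = X interior_of C - X closure_of O'"
  have V: "openin X V" unfolding V_def by (intro openin_diff) auto
  have O': "openin X O'" unfolding O'_def by auto
  have "meager_in X (\<Union>i\<in>I. (T i - ess_closure X (T i)) \<union>
      (ess_closure X (T i) - X interior_of ess_closure X (T i)))"
    by (intro meager_in_UN meager_in_Un meager_in_diff_ess_closure meager_in_diff_interior
        closedin_ess_closure assms)
  moreover have "S \<inter> V \<subseteq> (\<Union>i\<in>I. (T i - ess_closure X (T i)) \<union>
      (ess_closure X (T i) - X interior_of ess_closure X (T i)))"
  proof
    fix x assume x: "x \<in> S \<inter> V"
    then obtain i where i: "i \<in> I" "x \<in> T i" using assms(4) by blast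
    have "O' \<subseteq> X closure_of O'" using O' by (simp add: closure_of_subset openin_subset)
    then have "x \<notin> O'" using x unfolding V_def by blast
    then show "x \<in> (\<Union>i\<in>I. (T i - ess_closure X (T i)) \<union>
      (ess_closure X (T i) - X interior_of ess_closure X (T i)))"
      using i unfolding O'_def by blast
  qed
  ultimately have "meager_in X (S \<inter> V)" by (rule meager_in_subset)
  then have "V \<inter> C = {}" using ess_closure_disjoint V unfolding C_def by blast
  moreover have "V \<subseteq> C" unfolding V_def using interior_of_subset[of X C] by blast
  ultimately have "V = {}" by blast
  then have "X interior_of C \<subseteq> X closure_of O'" unfolding V_def by blast
  moreover have "O' \<subseteq> (\<Union>i\<in>I. ess_closure X (T i))"
    unfolding O'_def by (intro UN_mono order_refl interior_of_subset)
  ultimately have "ess_closure X S - (\<Union>i\<in>I. ess_closure X (T i)) \<subseteq>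
      (C - X interior_of C) \<union> (X closure_of O' - O')"
    unfolding C_def[symmetric] by blast
  moreover have "meager_in X ((C - X interior_of C) \<union> (X closure_of O' - O'))"
    unfolding C_def
    by (intro meager_in_Un meager_in_diff_interior meager_in_closure_diff closedin_ess_closure O')
  ultimately show ?thesis by (rule meager_in_subset[rotated])
qed

text \<open>
  A scheme of smaller and smaller open pieces of the domain is followed along a branch: outside
  a meager set a point of the essential closure of the image of a piece lies in the essential
  closure of the image of one of its subpieces, and completeness yields a preimage.
\<close>

lemma meager_in_ess_closure_diff_image:
  assumes H: "polish_space_top H" and Y: "polish_space_top Y" and f: "continuous_map H Y f"
  shows "meager_in Y (ess_closure Y (f ` topspace H) - f ` topspace H)"
proof -
  note Y' = polish_space_topD[OF Y]
  obtain M d where "Metric_space M d" and cm: "Metric_space.mcomplete M d"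
    and HM: "H = Metric_space.mtopology M d"
    using H unfolding polish_space_top_def completely_metrizable_space_def by blast
  then interpret Metric_space M d by simp
  obtain \<B>' where \<B>': "countable \<B>'" "\<forall>V\<in>\<B>'. openin H V"
    "\<forall>U x. openin H U \<and> x \<in> U \<longrightarrow> (\<exists>V\<in>\<B>'. x \<in> V \<and> V \<subseteq> U)"
    using polish_space_topD(2)[OF H] unfolding second_countable_def by blast
  \<comment> \<open>The whole space is added so that a branch of the scheme has somewhere to
    start.\<close>
  define \<B> where "\<B> = insert (topspace H) \<B>'"
  have \<B>: "countable \<B>" "\<And>V. V \<in> \<B> \<Longrightarrow> openin H V" using \<B>' unfolding \<B>_def by auto
  have \<B>3: "V \<subseteq> M" if "V \<in> \<B>" for V using openin_subset[OF \<B>(2)[OF that]] HM by simp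
  \<comment> \<open>Subpieces with closure inside \<open>B\<close> make the closures along a branch
    decrease, and the radius bound makes them shrink.\<close>
  define R where "R B n = {V \<in> \<B>. H closure_of V \<subseteq> B \<and> (\<exists>c. V \<subseteq> mcball c (inverse (Suc n)))}"
    for B and n :: nat
  have cover: "B \<subseteq> \<Union>(R B n)" if B: "B \<in> \<B>" for B n
  proof
    fix x assume x: "x \<in> B"
    then have xM: "x \<in> M" using \<B>3[OF B] by blast
    obtain r where r: "r > 0" "mball x r \<subseteq> B"
      using \<B>(2)[OF B] x unfolding HM openin_mtopology by blast
    define s where "s = min (r / 2) (inverse (real (Suc n)))"
    have s: "s > 0" "s < r" "s \<le> inverse (real (Suc n))" using r unfolding s_def by auto
    obtain V where V: "V \<in> \<B>'" "x \<in> V" "V \<subseteq> mball x s"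
      using \<B>'(3) s(1) xM openin_mball unfolding HM
      by (metis centre_in_mball_iff)
    have "mtopology closure_of V \<subseteq> mcball x s"
      by (rule closure_of_minimal) (use V mball_subset_mcball in \<open>auto simp: closedin_mcball\<close>)
    also have "\<dots> \<subseteq> mball x r" using s by auto
    finally have "H closure_of V \<subseteq> B" using r HM by blast
    moreover have "V \<subseteq> mcball x (inverse (Suc n))" using V(3) s(3) by auto
    ultimately show "x \<in> \<Union>(R B n)" using V unfolding R_def \<B>_def by blast
  qed
  have cR: "countable (R B n)" for B n using \<B>(1) unfolding R_def by auto
  have im: "f ` V \<subseteq> topspace Y" if "V \<subseteq> M" for V
    using continuous_map_image_subset_topspace[OF f] that HM by auto
  \<comment> \<open>One exceptional set serves all pieces and all scales, since there are countably
    many pairs; off \<open>E\<close> a point of an essential closure can always be handed on to a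
    subpiece.\<close>
  define E where "E = (\<Union>(B, n)\<in>\<B> \<times> UNIV. ess_closure Y (f ` B) - (\<Union>V\<in>R B n. ess_closure Y (f ` V)))"
  have "meager_in Y E" unfolding E_def
  proof (rule meager_in_UN)
    show "countable (\<B> \<times> (UNIV :: nat set))" using \<B>(1) by simp
    fix p :: "'a set \<times> nat" assume "p \<in> \<B> \<times> UNIV"
    then obtain B n where p: "p = (B, n)" "B \<in> \<B>" by auto
    have "meager_in Y (ess_closure Y (f ` B) - (\<Union>V\<in>R B n. ess_closure Y (f ` V)))"
    proof (rule meager_in_ess_closure_diff[OF Y'(2) cR])
      show "f ` V \<subseteq> topspace Y" if "V \<in> R B n" for V using that im \<B>3 unfolding R_def by blast
      show "f ` B \<subseteq> (\<Union>V\<in>R B n. f ` V)" using cover[OF p(2), of n] by blast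
    qed
    then show "meager_in Y (case p of (B, n) \<Rightarrow> ess_closure Y (f ` B) - (\<Union>V\<in>R B n. ess_closure Y (f ` V)))"
      using p by simp
  qed
  moreover have "ess_closure Y (f ` topspace H) - f ` topspace H \<subseteq> E"
  proof (rule ccontr)
    assume "\<not> ?thesis"
    then obtain y where y: "y \<in> ess_closure Y (f ` topspace H)" "y \<notin> f ` topspace H" "y \<notin> E" by blast
    define Q where "Q B \<longleftrightarrow> B \<in> \<B> \<and> y \<in> ess_closure Y (f ` B)" for B
    have step: "\<exists>V. Q V \<and> V \<in> R B n" if "Q B" for B n
      using that y(3) unfolding Q_def E_def R_def by blast
    have "\<exists>B. \<forall>n. Q (B n) \<and> B (Suc n) \<in> R (B n) n"
      by (rule dependent_nat_choice[where Q = "\<lambda>n B V. V \<in> R B n"])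
        (use y(1) step in \<open>auto simp: Q_def \<B>_def\<close>)
    then obtain B where B: "\<And>n. Q (B n)" "\<And>n. B (Suc n) \<in> R (B n) n" by blast
    define C where "C n = mtopology closure_of (B (Suc n))" for n
    have CB: "C n \<subseteq> B n" for n using B(2)[of n] unfolding R_def C_def HM by blast
    have BC: "B (Suc n) \<subseteq> C n" for n
      unfolding C_def by (rule closure_of_subset) (use B(1) \<B>3 in \<open>auto simp: Q_def\<close>)
    have dec: "decseq C"
    proof (rule decseq_SucI)
      show "C (Suc n) \<subseteq> C n" for n using CB[of "Suc n"] BC[of n] by (rule order_trans)
    qed
    have small: "\<exists>n a. C n \<subseteq> mcball a e" if "e > 0" for e
    proof -
      obtain n where n: "inverse (real (Suc n)) < e" using reals_Archimedean[OF \<open>e > 0\<close>] by blast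
      obtain c where "B (Suc n) \<subseteq> mcball c (inverse (Suc n))" using B(2)[of n] unfolding R_def by blast
      then have "C n \<subseteq> mcball c (inverse (Suc n))" unfolding C_def
        by (intro closure_of_minimal) (auto simp: closedin_mcball)
      then show ?thesis using n by (intro exI[of _ n] exI[of _ c]) auto
    qed
    have ne: "V \<noteq> {}" if "Q V" for V
      using that unfolding Q_def ess_closure_def by (auto simp: )
    have "\<Inter>(range C) \<noteq> {}"
    proof -
      have "\<forall>n. closedin mtopology (C n)" unfolding C_def by simp
      moreover have "C n \<noteq> {}" for n using BC[of n] ne[OF B(1)[of "Suc n"]] by blast
      ultimately show ?thesis
        using cm[unfolded mcomplete_nest, rule_format, of C] dec small by simp
    qed
    then obtain x where x: "x \<in> C n" for n by blast
    have xM: "x \<in> M" using x[of 0] CB[of 0] B(1)[of 0] \<B>3 unfolding Q_def by blast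
    then have fx: "f x \<in> f ` topspace H" "f x \<in> topspace Y" using im[of M] HM by auto
    then have "f x \<noteq> y" using y(2) by blast
    moreover have yY: "y \<in> topspace Y" using y(1) unfolding ess_closure_def by blast
    \<comment> \<open>A late piece around \<open>x\<close> is mapped into \<open>V\<close>, so its
      image misses the neighbourhood \<open>W\<close> of \<open>y\<close>, although \<open>y\<close>
      is an essential point of that image.\<close>
    ultimately obtain V W where VW: "openin Y V" "openin Y W" "f x \<in> V" "y \<in> W" "disjnt V W"
      using Y'(3) fx(2) unfolding Hausdorff_space_def by metis
    have "openin H {z \<in> topspace H. f z \<in> V}" using f VW(1) openin_continuous_map_preimage by blast
    then obtain r where r: "r > 0" "mball x r \<subseteq> {z \<in> topspace H. f z \<in> V}"
      using VW(3) xM unfolding HM openin_mtopology topspace_mtopology by blast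
    obtain n a where na: "C n \<subseteq> mcball a (r / 3)" using small[of "r / 3"] r by auto
    have "B (Suc n) \<subseteq> mball x r"
    proof
      fix z assume "z \<in> B (Suc n)"
      then have "z \<in> mcball a (r / 3)" "x \<in> mcball a (r / 3)"
        using BC[of n] na x[of n] by blast+
      then have "d a z \<le> r / 3" "d a x \<le> r / 3" "z \<in> M" "a \<in> M" by auto
      then show "z \<in> mball x r" using triangle[of x a z] commute[of a x] r xM by auto
    qed
    then have "f ` B (Suc n) \<inter> W = {}" using r(2) VW(5) unfolding disjnt_def by blast
    then have "W \<inter> ess_closure Y (f ` B (Suc n)) = {}"
      using ess_closure_disjoint[OF VW(2)] by simp
    then show False using VW(4) B(1)[of "Suc n"] unfolding Q_def by blast
  qed
  ultimately show ?thesis by (rule meager_in_subset)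
qed

text \<open>The image is meager off its essential closure, and the boundary of that closed set is
  meager; so its interior \<open>U\<close> is nonempty unless the image is meager. This much of the
  Baire property of analytic sets is all that Pettis' argument asks for.\<close>

lemma nonmeager_image_comeager_in_open:
  assumes H: "polish_space_top H" and Y: "polish_space_top Y" and f: "continuous_map H Y f"
    and nm: "\<not> meager_in Y (f ` topspace H)"
  obtains U where "openin Y U" "U \<noteq> {}" "meager_in Y (U - f ` topspace H)"
proof -
  let ?F = "f ` topspace H"
  define U where "U = Y interior_of (ess_closure Y ?F)"
  have "?F \<subseteq> topspace Y" using f continuous_map_image_subset_topspace by blast
  then have "meager_in Y (?F - ess_closure Y ?F)"
    using polish_space_topD(2)[OF Y] meager_in_diff_ess_closure by blast
  then have "meager_in Y ((?F - ess_closure Y ?F) \<union> (ess_closure Y ?F - U))"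
    unfolding U_def by (intro meager_in_Un meager_in_diff_interior closedin_ess_closure)
  then have "U \<noteq> {}" using nm meager_in_subset[of Y _ ?F] by blast
  moreover have "U - ?F \<subseteq> ess_closure Y ?F - ?F"
    unfolding U_def by (intro Diff_mono interior_of_subset order_refl)
  then have "meager_in Y (U - ?F)"
    using meager_in_ess_closure_diff_image[OF H Y f] meager_in_subset by blast
  ultimately show ?thesis using that[of U] unfolding U_def by simp
qed

section \<open>Polish groups\<close>

locale top_group = group G for G (structure) +
  fixes \<tau> :: "'a topology"
  assumes is_group_topology: "group_topology G \<tau>"
begin

lemma topspace [simp]: "topspace \<tau> = carrier G"
  using is_group_topology unfolding group_topology_def by blast

lemma continuous_mult:
  assumes "continuous_map X \<tau> f" "continuous_map X \<tau> g"
  shows "continuous_map X \<tau> (\<lambda>x. f x \<otimes> g x)"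
proof -
  have "continuous_map X (prod_topology \<tau> \<tau>) (\<lambda>x. (f x, g x))"
    using assms by (rule continuous_map_pairedI)
  moreover have "continuous_map (prod_topology \<tau> \<tau>) \<tau> (\<lambda>(x, y). x \<otimes> y)"
    using is_group_topology unfolding group_topology_def by blast
  ultimately show ?thesis using continuous_map_compose by (fastforce simp: comp_def)
qed

lemma continuous_inv:
  assumes "continuous_map X \<tau> f"
  shows "continuous_map X \<tau> (\<lambda>x. inv (f x))"
proof -
  have "continuous_map \<tau> \<tau> (\<lambda>x. inv x)"
    using is_group_topology unfolding group_topology_def by blast
  then show ?thesis using continuous_map_compose[OF assms] by (fastforce simp: comp_def)
qed

lemma continuous_const: "a \<in> carrier G \<Longrightarrow> continuous_map X \<tau> (\<lambda>x. a)"
  by simp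

lemma continuous_ident: "continuous_map \<tau> \<tau> (\<lambda>x. x)"
  by simp

lemmas group_continuous_intros = continuous_mult continuous_inv continuous_const continuous_ident

lemma openin_preimage: "continuous_map \<tau> \<tau> f \<Longrightarrow> openin \<tau> U \<Longrightarrow> openin \<tau> {x \<in> carrier G. f x \<in> U}"
  using openin_continuous_map_preimage by fastforce

lemma homeomorphic_map_left:
  assumes "a \<in> carrier G" shows "homeomorphic_map \<tau> \<tau> (\<lambda>x. a \<otimes> x)"
proof (rule homeomorphic_maps_imp_map)
  show "homeomorphic_maps \<tau> \<tau> (\<lambda>x. a \<otimes> x) (\<lambda>x. inv a \<otimes> x)"
    unfolding homeomorphic_maps_def
    using assms by (auto intro!: continuous_mult simp: m_assoc[symmetric])
qed

lemma homeomorphic_map_right: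
  assumes "a \<in> carrier G" shows "homeomorphic_map \<tau> \<tau> (\<lambda>x. x \<otimes> a)"
proof (rule homeomorphic_maps_imp_map)
  show "homeomorphic_maps \<tau> \<tau> (\<lambda>x. x \<otimes> a) (\<lambda>x. x \<otimes> inv a)"
    unfolding homeomorphic_maps_def
    using assms by (auto intro!: continuous_mult simp: m_assoc)
qed

lemma openin_left_translate:
  assumes "a \<in> carrier G" "openin \<tau> U" shows "openin \<tau> ((\<lambda>x. a \<otimes> x) ` U)"
  using homeomorphic_map_left[OF assms(1)] assms(2) openin_subset[OF assms(2)]
  by (simp add: homeomorphic_map_openness)

lemma obtain_quotient_nbhd:
  assumes "openin \<tau> U" "\<one> \<in> U"
  obtains V where "openin \<tau> V" "\<one> \<in> V" "\<And>x y. x \<in> V \<Longrightarrow> y \<in> V \<Longrightarrow> inv x \<otimes> y \<in> U"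
proof -
  let ?f = "\<lambda>p. inv (fst p) \<otimes> snd p"
  have "continuous_map (prod_topology \<tau> \<tau>) \<tau> ?f"
    by (intro continuous_mult continuous_inv continuous_map_fst continuous_map_snd)
  then have "openin (prod_topology \<tau> \<tau>) {p \<in> topspace (prod_topology \<tau> \<tau>). ?f p \<in> U}" (is "openin _ ?P")
    using assms(1) by (rule openin_continuous_map_preimage)
  moreover have "(\<one>, \<one>) \<in> ?P" using assms by simp
  ultimately have "\<exists>V W. openin \<tau> V \<and> openin \<tau> W \<and> \<one> \<in> V \<and> \<one> \<in> W \<and> V \<times> W \<subseteq> ?P"
    unfolding openin_prod_topology_alt by (elim allE impE) assumption+
  then obtain V W where VW: "openin \<tau> V" "openin \<tau> W" "\<one> \<in> V" "\<one> \<in> W" "V \<times> W \<subseteq> ?P"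
    by (elim exE conjE)
  show ?thesis
  proof (rule that[of "V \<inter> W"])
    fix x y assume "x \<in> V \<inter> W" "y \<in> V \<inter> W"
    then have "(x, y) \<in> ?P" using VW(5) by blast
    then show "inv x \<otimes> y \<in> U" by simp
  qed (use VW in auto)
qed

end

locale polish_group = top_group +
  assumes polish: "polish_space_top \<tau>"
begin

text \<open>For fixed \<open>x\<close> the elements \<open>c\<close> with
  \<open>inv c \<otimes> x\<close> in \<open>V\<close> form an open neighbourhood of
  \<open>x\<close>, which a dense set meets.\<close>

lemma countable_translates:
  assumes "openin \<tau> V" "\<one> \<in> V"
  obtains C where "countable C" "C \<subseteq> carrier G" "\<And>x. x \<in> carrier G \<Longrightarrow> \<exists>c\<in>C. inv c \<otimes> x \<in> V"
proof -
  obtain C where C: "countable C" "C \<subseteq> carrier G" "\<tau> closure_of C = carrier G"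
    using polish unfolding polish_space_top_def separable_space_def by auto
  have "\<exists>c\<in>C. inv c \<otimes> x \<in> V" if x: "x \<in> carrier G" for x
  proof -
    have "openin \<tau> {c \<in> carrier G. inv c \<otimes> x \<in> V}"
      using assms(1) x by (intro openin_preimage group_continuous_intros)
    moreover have "x \<in> {c \<in> carrier G. inv c \<otimes> x \<in> V}" using x assms(2) by simp
    moreover have "x \<in> \<tau> closure_of C" using x C by simp
    ultimately obtain c where "c \<in> C" "c \<in> {c \<in> carrier G. inv c \<otimes> x \<in> V}"
      unfolding in_closure_of by meson
    then show ?thesis by blast
  qed
  with C(1,2) show ?thesis by (rule that)
qed

lemma not_meager_if_countable_translates:
  assumes "countable C" "C \<subseteq> carrier G" "\<And>x. x \<in> carrier G \<Longrightarrow> \<exists>c\<in>C. inv c \<otimes> x \<in> F"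
  shows "\<not> meager_in \<tau> F"
proof
  assume m: "meager_in \<tau> F"
  have "meager_in \<tau> (\<Union>c\<in>C. (\<lambda>x. c \<otimes> x) ` F)"
    by (rule meager_in_UN[OF assms(1)])
      (use assms(2) m homeomorphic_map_left meager_in_homeomorphic_image in blast)
  moreover have "carrier G \<subseteq> (\<Union>c\<in>C. (\<lambda>x. c \<otimes> x) ` F)"
  proof
    fix x assume x: "x \<in> carrier G"
    then obtain c where c: "c \<in> C" "inv c \<otimes> x \<in> F" using assms(3) by blast
    then have "c \<otimes> (inv c \<otimes> x) = x" using x assms(2) by (simp add: m_assoc[symmetric] subset_iff)
    then show "x \<in> (\<Union>c\<in>C. (\<lambda>x. c \<otimes> x) ` F)" using c by force
  qed
  ultimately have "meager_in \<tau> (carrier G)" by (rule meager_in_subset)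
  then show False
    using not_meager_in_open[of \<tau> "carrier G"] polish_space_topD(1)[OF polish] openin_topspace[of \<tau>]
    by auto
qed

text \<open>Pettis' argument. For \<open>v\<close> near the identity, \<open>U\<close> and its right
  translate by \<open>inv v\<close> meet in a nonempty open set \<open>W\<close>. This is not
  meager, so some \<open>z\<close> in \<open>W\<close> avoids both \<open>U - F\<close> and the
  translate of \<open>U - F\<close>. Then \<open>z\<close> and \<open>z \<otimes> v\<close> lie in
  \<open>F\<close>, and \<open>v\<close> is their quotient.\<close>

lemma quotients_contain_nbhd:
  assumes "openin \<tau> U" "U \<noteq> {}" "meager_in \<tau> (U - F)"
  obtains V where "openin \<tau> V" "\<one> \<in> V" "\<And>v. v \<in> V \<Longrightarrow> \<exists>x\<in>F. \<exists>y\<in>F. x \<in> carrier G \<and> y \<in> carrier G \<and> v = inv x \<otimes> y"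
proof -
  have UG: "U \<subseteq> carrier G" using openin_subset[OF assms(1)] by simp
  obtain a where a: "a \<in> U" "a \<in> carrier G" using assms(2) UG by blast
  define V where "V = {v \<in> carrier G. a \<otimes> v \<in> U}"
  have "openin \<tau> V" unfolding V_def
    using assms(1) a by (intro openin_preimage group_continuous_intros)
  moreover have "\<one> \<in> V" using a unfolding V_def by simp
  moreover have "\<exists>x\<in>F. \<exists>y\<in>F. x \<in> carrier G \<and> y \<in> carrier G \<and> v = inv x \<otimes> y" if "v \<in> V" for v
  proof -
    have v: "v \<in> carrier G" "a \<otimes> v \<in> U" using that unfolding V_def by auto
    define W where "W = U \<inter> {z \<in> carrier G. z \<otimes> v \<in> U}"
    have "openin \<tau> {z \<in> carrier G. z \<otimes> v \<in> U}"
      using assms(1) v by (intro openin_preimage group_continuous_intros)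
    then have "openin \<tau> W" unfolding W_def using assms(1) by blast
    moreover have "a \<in> W" using a v unfolding W_def by blast
    ultimately have nm: "\<not> meager_in \<tau> W"
      using not_meager_in_open polish_space_topD(1)[OF polish] by blast
    have "meager_in \<tau> ((\<lambda>z. z \<otimes> inv v) ` (U - F))"
      using meager_in_homeomorphic_image[OF homeomorphic_map_right assms(3)] v by simp
    then have "meager_in \<tau> ((U - F) \<union> (\<lambda>z. z \<otimes> inv v) ` (U - F))"
      using assms(3) by (intro meager_in_Un)
    then have "\<not> W \<subseteq> (U - F) \<union> (\<lambda>z. z \<otimes> inv v) ` (U - F)" using nm meager_in_subset by blast
    then obtain z where z: "z \<in> W" "z \<notin> U - F" "z \<notin> (\<lambda>z. z \<otimes> inv v) ` (U - F)" by blast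
    have zG: "z \<in> carrier G" "z \<in> F" "z \<otimes> v \<in> U" using z UG unfolding W_def by auto
    have "z = (z \<otimes> v) \<otimes> inv v" using zG v by (simp add: m_assoc)
    then have "z \<otimes> v \<in> F" using z(3) zG(3) by blast
    moreover have "v = inv z \<otimes> (z \<otimes> v)" using zG v by (simp add: m_assoc[symmetric])
    ultimately show ?thesis using zG v by (intro bexI[of _ z] bexI[of _ "z \<otimes> v"]) auto
  qed
  ultimately show ?thesis by (rule that)
qed

text \<open>The common engine of the closed graph theorem and of the comparison with the weak
  topology: by Baire's theorem the image is not meager, since countably many left translates of it
  cover the group.\<close>

lemma analytic_quotients_contain_nbhd:
  assumes "polish_space_top H" "continuous_map H \<tau> f"
    and "countable C" "C \<subseteq> carrier G"
    and "\<And>x. x \<in> carrier G \<Longrightarrow> \<exists>c\<in>C. inv c \<otimes> x \<in> f ` topspace H"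
  obtains V where "openin \<tau> V" "\<one> \<in> V"
    "\<And>v. v \<in> V \<Longrightarrow> \<exists>x\<in>f ` topspace H. \<exists>y\<in>f ` topspace H. x \<in> carrier G \<and> y \<in> carrier G \<and> v = inv x \<otimes> y"
proof -
  have "\<not> meager_in \<tau> (f ` topspace H)"
    using not_meager_if_countable_translates assms(3-5) by blast
  then obtain U where "openin \<tau> U" "U \<noteq> {}" "meager_in \<tau> (U - f ` topspace H)"
    by (rule nonmeager_image_comeager_in_open[OF assms(1) polish assms(2)])
  then show ?thesis by (rule quotients_contain_nbhd) (rule that)
qed

end

section \<open>Countable subgroups, closures of subgroups, and homomorphisms with closed
  graph\<close>

lemma (in group) countable_subgroup_containing:
  assumes S: "countable S" "S \<subseteq> carrier G"
  obtains L where "subgroup L G" "countable L" "S \<subseteq> L"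
proof -
  \<comment> \<open>Closing under the single operation \<open>a \<otimes> inv b\<close> suffices:
    with \<open>\<one>\<close> present it yields inverses, and then products.\<close>
  define A where "A = rec_nat (insert \<one> S) (\<lambda>_ C. C \<union> (\<lambda>(a, b). a \<otimes> inv b) ` (C \<times> C))"
  have A0: "A 0 = insert \<one> S" and AS: "A (Suc n) = A n \<union> (\<lambda>(a, b). a \<otimes> inv b) ` (A n \<times> A n)" for n
    unfolding A_def by auto
  have cA: "countable (A n) \<and> A n \<subseteq> carrier G" for n
  proof (induction n)
    case 0 show ?case using S unfolding A0 by simp
  next
    case (Suc n) then show ?case unfolding AS by auto
  qed
  have mono: "A m \<subseteq> A n" if "m \<le> n" for m n
    using that by (induction rule: dec_induct) (auto simp: AS)
  define L where "L = (\<Union>n. A n)"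
  have quot: "a \<otimes> inv b \<in> L" if "a \<in> L" "b \<in> L" for a b
  proof -
    obtain m n where "a \<in> A m" "b \<in> A n" using \<open>a \<in> L\<close> \<open>b \<in> L\<close> unfolding L_def by auto
    then have "a \<in> A (max m n)" "b \<in> A (max m n)" using mono[of m "max m n"] mono[of n "max m n"] by auto
    then have "a \<otimes> inv b \<in> A (Suc (max m n))" unfolding AS by force
    then show ?thesis unfolding L_def by blast
  qed
  have one: "\<one> \<in> L" and SL: "S \<subseteq> L" unfolding L_def using A0 by blast+
  have LG: "L \<subseteq> carrier G" unfolding L_def using cA by blast
  have inv: "inv a \<in> L" if "a \<in> L" for a using quot[OF one that] that LG by auto
  have "subgroup L G"
  proof (rule subgroupI)
    show "L \<noteq> {}" using one by blast
    show "a \<otimes> b \<in> L" if "a \<in> L" "b \<in> L" for a b using quot[OF that(1) inv[OF that(2)]] that LG by auto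
  qed (use LG inv in auto)
  moreover have "countable L" unfolding L_def using cA by blast
  ultimately show ?thesis using SL by (rule that)
qed

context top_group
begin

text \<open>The closure of \<open>L \<times> L\<close> is the product of the closures, so the
  continuous map \<open>?f\<close> sends it into the closure of \<open>L\<close>.\<close>

lemma subgroup_closure_of:
  assumes L: "subgroup L G" shows "subgroup (\<tau> closure_of L) G"
proof -
  let ?C = "\<tau> closure_of L"
  have LG: "L \<subseteq> carrier G" by (rule subgroup.subset[OF L])
  have LC: "L \<subseteq> ?C" by (rule closure_of_subset) (simp add: LG)
  have CG: "?C \<subseteq> carrier G" using closure_of_subset_topspace[of \<tau> L] by simp
  let ?f = "\<lambda>p. fst p \<otimes> inv (snd p)"
  have f: "continuous_map (prod_topology \<tau> \<tau>) \<tau> ?f"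
    by (intro continuous_mult continuous_inv continuous_map_fst continuous_map_snd)
  have quot: "a \<otimes> inv b \<in> ?C" if "a \<in> ?C" "b \<in> ?C" for a b
  proof -
    have "(a, b) \<in> prod_topology \<tau> \<tau> closure_of (L \<times> L)" using that by (simp add: closure_of_Times)
    then have "?f (a, b) \<in> \<tau> closure_of (?f ` (L \<times> L))"
      using continuous_map_image_closure_subset[OF f, of "L \<times> L"] by blast
    moreover have "?f ` (L \<times> L) \<subseteq> L"
      using subgroup.m_closed[OF L] subgroup.m_inv_closed[OF L] by auto
    ultimately show ?thesis using closure_of_mono[of "?f ` (L \<times> L)" L \<tau>] by auto
  qed
  have one: "\<one> \<in> ?C" using LC subgroup.one_closed[OF L] by blast
  have inv: "inv a \<in> ?C" if "a \<in> ?C" for a using quot[OF one that] that CG by auto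
  show ?thesis
  proof (rule subgroupI)
    show "?C \<noteq> {}" using one by blast
    show "a \<otimes> b \<in> ?C" if "a \<in> ?C" "b \<in> ?C" for a b using quot[OF that(1) inv[OF that(2)]] that CG by auto
  qed (use CG inv in auto)
qed

lemma top_group_subgroup:
  assumes K: "subgroup K G" shows "top_group (G\<lparr>carrier := K\<rparr>) (subtopology \<tau> K)"
proof -
  have KG: "K \<subseteq> carrier G" by (rule subgroup.subset[OF K])
  let ?\<sigma> = "subtopology \<tau> K"
  have "continuous_map (prod_topology ?\<sigma> ?\<sigma>) ?\<sigma> (\<lambda>p. fst p \<otimes> snd p)"
    unfolding continuous_map_in_subtopology
  proof
    have "continuous_map (prod_topology ?\<sigma> ?\<sigma>) \<tau> fst" "continuous_map (prod_topology ?\<sigma> ?\<sigma>) \<tau> snd"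
      using continuous_map_into_fulltopology[OF continuous_map_fst[of ?\<sigma> ?\<sigma>]]
        continuous_map_into_fulltopology[OF continuous_map_snd[of ?\<sigma> ?\<sigma>]] by auto
    then show "continuous_map (prod_topology ?\<sigma> ?\<sigma>) \<tau> (\<lambda>p. fst p \<otimes> snd p)" by (rule continuous_mult)
    show "(\<lambda>p. fst p \<otimes> snd p) \<in> topspace (prod_topology ?\<sigma> ?\<sigma>) \<rightarrow> K"
      using subgroup.m_closed[OF K] by auto
  qed
  moreover have "continuous_map ?\<sigma> ?\<sigma> (\<lambda>x. inv\<^bsub>G\<lparr>carrier := K\<rparr>\<^esub> x)"
  proof (rule continuous_map_eq)
    show "continuous_map ?\<sigma> ?\<sigma> (\<lambda>x. inv x)" unfolding continuous_map_in_subtopology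
    proof
      show "continuous_map ?\<sigma> \<tau> (\<lambda>x. inv x)"
        by (intro continuous_inv continuous_map_from_subtopology continuous_ident)
      show "(\<lambda>x. inv x) \<in> topspace ?\<sigma> \<rightarrow> K" using subgroup.m_inv_closed[OF K] by auto
    qed
    show "inv x = inv\<^bsub>G\<lparr>carrier := K\<rparr>\<^esub> x" if "x \<in> topspace ?\<sigma>" for x
      using m_inv_consistent[OF K, of x] that by simp
  qed
  moreover have "topspace ?\<sigma> = K" using KG by auto
  ultimately have "group_topology (G\<lparr>carrier := K\<rparr>) ?\<sigma>"
    unfolding group_topology_def by (simp add: case_prod_unfold)
  then show ?thesis
    using subgroup.subgroup_is_group[OF K is_group] by (simp add: top_group_def top_group_axioms_def)
qed

end

lemma continuous_map_hom:
  assumes "top_group K \<sigma>" "top_group G \<tau>" and h: "h \<in> hom K G"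
    and U: "\<And>U. openin \<tau> U \<Longrightarrow> \<one>\<^bsub>G\<^esub> \<in> U \<Longrightarrow> \<exists>V. openin \<sigma> V \<and> \<one>\<^bsub>K\<^esub> \<in> V \<and> h ` V \<subseteq> U"
  shows "continuous_map \<sigma> \<tau> h"
proof -
  interpret K: top_group K \<sigma> by fact
  interpret G: top_group G \<tau> by fact
  interpret h: group_hom K G h by unfold_locales (rule h)
  show ?thesis
  proof (rule continuous_map_eq_topcontinuous_at[THEN iffD2], intro ballI)
    fix x assume "x \<in> topspace \<sigma>"
    then have x: "x \<in> carrier K" "h x \<in> carrier G" by auto
    show "topcontinuous_at \<sigma> \<tau> h x" unfolding topcontinuous_at_def
    proof (intro conjI allI impI)
      fix W assume W: "openin \<tau> W \<and> h x \<in> W"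
      let ?U = "{u \<in> carrier G. h x \<otimes>\<^bsub>G\<^esub> u \<in> W}"
      have "openin \<tau> ?U" using W x by (intro G.openin_preimage G.group_continuous_intros) auto
      moreover have "\<one>\<^bsub>G\<^esub> \<in> ?U" using W x by simp
      ultimately obtain V where V: "openin \<sigma> V" "\<one>\<^bsub>K\<^esub> \<in> V" "h ` V \<subseteq> ?U" using U by blast
      have VK: "V \<subseteq> carrier K" using openin_subset[OF V(1)] by simp
      show "\<exists>U. openin \<sigma> U \<and> x \<in> U \<and> (\<forall>y\<in>U. h y \<in> W)"
      proof (intro exI[of _ "(\<lambda>y. x \<otimes>\<^bsub>K\<^esub> y) ` V"] conjI ballI)
        show "openin \<sigma> ((\<lambda>y. x \<otimes>\<^bsub>K\<^esub> y) ` V)" using K.openin_left_translate x V by blast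
        show "x \<in> (\<lambda>y. x \<otimes>\<^bsub>K\<^esub> y) ` V" using V(2) x by (force simp: image_iff)
        fix y assume "y \<in> (\<lambda>y. x \<otimes>\<^bsub>K\<^esub> y) ` V"
        then obtain v where v: "v \<in> V" "y = x \<otimes>\<^bsub>K\<^esub> v" by blast
        then have "h x \<otimes>\<^bsub>G\<^esub> h v \<in> W" "v \<in> carrier K" using V(3) VK by auto
        then show "h y \<in> W" using v x by simp
      qed
    qed (use x in auto)
  qed
qed

text \<open>The set of points that \<open>h\<close> sends into \<open>W\<close> is the first
  projection of an open part of the graph. A closed graph is Polish, so this set is a continuous
  image of a Polish space although nothing is known about the regularity of \<open>h\<close>. Its
  quotients contain a neighbourhood of the identity, and \<open>h\<close> sends them into
  \<open>U\<close>.\<close>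

theorem closed_graph_polish_groups:
  assumes "polish_group K \<sigma>" "polish_group G \<tau>" and h: "h \<in> hom K G"
    and graph: "closedin (prod_topology \<sigma> \<tau>) ((\<lambda>x. (x, h x)) ` carrier K)"
  shows "continuous_map \<sigma> \<tau> h"
proof -
  interpret K: polish_group K \<sigma> by fact
  interpret G: polish_group G \<tau> by fact
  interpret h: group_hom K G h by unfold_locales (rule h)
  show ?thesis
  proof (rule continuous_map_hom[OF K.top_group_axioms G.top_group_axioms h])
    fix U assume "openin \<tau> U" "\<one>\<^bsub>G\<^esub> \<in> U"
    then obtain W where W: "openin \<tau> W" "\<one>\<^bsub>G\<^esub> \<in> W"
      and WU: "\<And>x y. x \<in> W \<Longrightarrow> y \<in> W \<Longrightarrow> inv\<^bsub>G\<^esub> x \<otimes>\<^bsub>G\<^esub> y \<in> U"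
      by (rule G.obtain_quotient_nbhd) blast
    obtain W0 where W0: "openin \<tau> W0" "\<one>\<^bsub>G\<^esub> \<in> W0"
      and W0W: "\<And>x y. x \<in> W0 \<Longrightarrow> y \<in> W0 \<Longrightarrow> inv\<^bsub>G\<^esub> x \<otimes>\<^bsub>G\<^esub> y \<in> W"
      using G.obtain_quotient_nbhd[OF W] by metis
    let ?\<Gamma> = "(\<lambda>x. (x, h x)) ` carrier K"
    define H where "H = subtopology (subtopology (prod_topology \<sigma> \<tau>) ?\<Gamma>) ((carrier K \<times> W) \<inter> ?\<Gamma>)"
    have "polish_space_top (subtopology (prod_topology \<sigma> \<tau>) ?\<Gamma>)"
      by (intro polish_space_top_closedin polish_space_top_prod K.polish G.polish graph)
    moreover have "openin (prod_topology \<sigma> \<tau>) (carrier K \<times> W)"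
      using W(1) openin_topspace[of \<sigma>] by (simp add: openin_prod_Times_iff)
    ultimately have Hp: "polish_space_top H" unfolding H_def
      by (rule polish_space_top_openin[OF _ openin_subtopology_Int])
    have fst: "continuous_map H \<sigma> fst" unfolding H_def
      by (intro continuous_map_from_subtopology continuous_map_fst)
    have F: "fst ` topspace H = {x \<in> carrier K. h x \<in> W}" (is "_ = ?F")
    proof -
      have "W \<subseteq> carrier G" using openin_subset[OF W(1)] by simp
      then have "topspace H = (\<lambda>x. (x, h x)) ` ?F" unfolding H_def by auto
      then show ?thesis by (simp add: image_image)
    qed
    obtain C0 where C0: "countable C0" "C0 \<subseteq> carrier G"
      and cov: "\<And>x. x \<in> carrier G \<Longrightarrow> \<exists>c\<in>C0. inv\<^bsub>G\<^esub> c \<otimes>\<^bsub>G\<^esub> x \<in> W0"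
      using G.countable_translates[OF W0] by metis
    \<comment> \<open>The countable set \<open>C0\<close> lives in \<open>G\<close> and may miss the
      image of \<open>h\<close>, so \<open>k c\<close> is a point of \<open>K\<close> sent into the
      translate of \<open>W0\<close> by \<open>c\<close>. Where there is none the choice is
      arbitrary, hence the intersection with \<open>carrier K\<close> below. Two points sent into
      the same translate of \<open>W0\<close> have their quotient sent into
      \<open>W\<close>.\<close>
    define k where "k c = (SOME k. k \<in> carrier K \<and> inv\<^bsub>G\<^esub> c \<otimes>\<^bsub>G\<^esub> h k \<in> W0)" for c
    define C where "C = k ` C0 \<inter> carrier K"
    have cC: "countable C" "C \<subseteq> carrier K"
      unfolding C_def by (intro countable_Int1 countable_image C0(1), rule Int_lower2)
    have covK: "\<exists>c\<in>C. inv\<^bsub>K\<^esub> c \<otimes>\<^bsub>K\<^esub> x \<in> ?F" if x: "x \<in> carrier K" for x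
    proof -
      obtain c where c: "c \<in> C0" "inv\<^bsub>G\<^esub> c \<otimes>\<^bsub>G\<^esub> h x \<in> W0" using cov[of "h x"] x by auto
      then have "\<exists>k. k \<in> carrier K \<and> inv\<^bsub>G\<^esub> c \<otimes>\<^bsub>G\<^esub> h k \<in> W0" using x by (intro exI[of _ x] conjI)
      then have "k c \<in> carrier K \<and> inv\<^bsub>G\<^esub> c \<otimes>\<^bsub>G\<^esub> h (k c) \<in> W0"
        unfolding k_def by (rule someI_ex)
      then have k: "k c \<in> carrier K" "inv\<^bsub>G\<^esub> c \<otimes>\<^bsub>G\<^esub> h (k c) \<in> W0" by auto
      have cG: "c \<in> carrier G" using c C0 by blast
      have hk: "h (k c) \<in> carrier G" "h x \<in> carrier G" using k x by auto
      have "c \<otimes>\<^bsub>G\<^esub> (inv\<^bsub>G\<^esub> c \<otimes>\<^bsub>G\<^esub> h x) = h x"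
        using cG hk by (simp add: G.m_assoc[symmetric])
      then have "inv\<^bsub>G\<^esub> (inv\<^bsub>G\<^esub> c \<otimes>\<^bsub>G\<^esub> h (k c)) \<otimes>\<^bsub>G\<^esub> (inv\<^bsub>G\<^esub> c \<otimes>\<^bsub>G\<^esub> h x) =
          inv\<^bsub>G\<^esub> h (k c) \<otimes>\<^bsub>G\<^esub> h x"
        using cG hk by (simp add: G.inv_mult_group G.m_assoc)
      also have "\<dots> = h (inv\<^bsub>K\<^esub> k c \<otimes>\<^bsub>K\<^esub> x)" using k x by simp
      finally have "h (inv\<^bsub>K\<^esub> k c \<otimes>\<^bsub>K\<^esub> x) \<in> W" using W0W[OF k(2) c(2)] by simp
      then have "inv\<^bsub>K\<^esub> k c \<otimes>\<^bsub>K\<^esub> x \<in> ?F" using k x by simp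
      moreover have "k c \<in> C" unfolding C_def using c k by blast
      ultimately show ?thesis by blast
    qed
    obtain V where V: "openin \<sigma> V" "\<one>\<^bsub>K\<^esub> \<in> V"
      "\<And>v. v \<in> V \<Longrightarrow> \<exists>x\<in>?F. \<exists>y\<in>?F. x \<in> carrier K \<and> y \<in> carrier K \<and> v = inv\<^bsub>K\<^esub> x \<otimes>\<^bsub>K\<^esub> y"
      by (rule K.analytic_quotients_contain_nbhd[OF Hp fst cC, unfolded F], erule covK) (rule that)
    have "h v \<in> U" if v: "v \<in> V" for v
    proof -
      obtain x y where xy: "x \<in> ?F" "y \<in> ?F" "v = inv\<^bsub>K\<^esub> x \<otimes>\<^bsub>K\<^esub> y" using V(3)[OF v] by blast
      then have "h v = inv\<^bsub>G\<^esub> h x \<otimes>\<^bsub>G\<^esub> h y" by simp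
      then show ?thesis using WU xy by simp
    qed
    then have "h ` V \<subseteq> U" by (rule image_subsetI)
    then show "\<exists>V. openin \<sigma> V \<and> \<one>\<^bsub>K\<^esub> \<in> V \<and> h ` V \<subseteq> U" using V(1,2) by (intro exI conjI)
  qed
qed

section \<open>Measure-preserving bijections\<close>

text \<open>Inequalities for \<open>T\<close> and for its inverse \<open>S\<close> suffice:
  \<open>A\<close> is the preimage under \<open>S\<close> of its preimage under \<open>T\<close>, so
  each bound reverses the other. Limits and glued maps come with such inequalities.\<close>

lemma mp_bijI:
  assumes T: "T \<in> measurable M M" and S: "S \<in> measurable M M"
    and ST: "\<And>x. x \<in> space M \<Longrightarrow> S (T x) = x" and TS: "\<And>x. x \<in> space M \<Longrightarrow> T (S x) = x"
    and mT: "\<And>A. A \<in> sets M \<Longrightarrow> emeasure M (T -` A \<inter> space M) \<le> emeasure M A"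
    and mS: "\<And>A. A \<in> sets M \<Longrightarrow> emeasure M (S -` A \<inter> space M) \<le> emeasure M A"
  shows "restrict T (space M) \<in> mp_bij M"
proof -
  let ?T = "restrict T (space M)"
  have Tsp: "T x \<in> space M" and Ssp: "S x \<in> space M" if "x \<in> space M" for x
    using that measurable_space[OF T] measurable_space[OF S] by auto
  have bij: "bij_betw T (space M) (space M)"
    by (rule bij_betwI[where g = S]) (use Tsp Ssp ST TS in auto)
  have eqT: "emeasure M (T -` A \<inter> space M) = emeasure M A" if A: "A \<in> sets M" for A
  proof (rule antisym[OF mT[OF A]])
    have "A = S -` (T -` A \<inter> space M) \<inter> space M"
      using Ssp TS sets.sets_into_space[OF A] by auto
    then show "emeasure M A \<le> emeasure M (T -` A \<inter> space M)"
      using mS[OF measurable_sets[OF T A]] by simp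
  qed
  have eqS: "emeasure M (S -` A \<inter> space M) = emeasure M A" if A: "A \<in> sets M" for A
  proof (rule antisym[OF mS[OF A]])
    have "A = T -` (S -` A \<inter> space M) \<inter> space M"
      using Tsp ST sets.sets_into_space[OF A] by auto
    then show "emeasure M A \<le> emeasure M (S -` A \<inter> space M)"
      using mT[OF measurable_sets[OF S A]] by simp
  qed
  have vim: "?T -` A \<inter> space M = T -` A \<inter> space M" for A by auto
  have im: "?T ` A = S -` A \<inter> space M" if A: "A \<in> sets M" for A
  proof (intro equalityI subsetI)
    fix y assume "y \<in> ?T ` A"
    then show "y \<in> S -` A \<inter> space M" using sets.sets_into_space[OF A] ST Tsp by auto
  next
    fix y assume y: "y \<in> S -` A \<inter> space M"
    then have "y = ?T (S y)" using Ssp TS by simp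
    then show "y \<in> ?T ` A" using y by blast
  qed
  have meas: "?T \<in> measurable M M"
    by (rule measurable_cong[THEN iffD1, OF _ T]) simp
  have Bij: "?T \<in> Bij (space M)"
    using bij by (auto simp: Bij_def bij_betw_restrict_eq)
  show ?thesis unfolding mp_bij_def mem_Collect_eq
  proof (intro conjI ballI Bij meas)
    fix A assume A: "A \<in> sets M"
    show "?T ` A \<in> sets M" unfolding im[OF A] using measurable_sets[OF S A] .
    show "emeasure M (?T ` A) = emeasure M A" unfolding im[OF A] using eqS[OF A] .
    show "emeasure M (?T -` A \<inter> space M) = emeasure M A" unfolding vim using eqT[OF A] .
  qed
qed

locale std_space =
  fixes M :: "'a measure"
  assumes std: "standard_sigma_finite_space M"

sublocale std_space \<subseteq> sigma_finite_measure M
  using std unfolding standard_sigma_finite_space_def by blast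

context std_space
begin

text \<open>A countable base of the Polish topology, with the whole space added so that the
  enumerated family is nonempty. Separation of points makes sets of coincidence measurable;
  generation will give countably many sets that are dense in measure.\<close>

lemma countable_separating_generator:
  obtains B :: "nat \<Rightarrow> 'a set" where "range B \<subseteq> sets M" "sets M = sigma_sets (space M) (range B)"
    "\<And>x y. x \<in> space M \<Longrightarrow> y \<in> space M \<Longrightarrow> x \<noteq> y \<Longrightarrow> \<exists>n. x \<in> B n \<and> y \<notin> B n"
proof -
  obtain X where X: "polish_space_top X" "topspace X = space M"
    and sM: "sets M = sigma_sets (space M) {U. openin X U}"
    using std unfolding standard_sigma_finite_space_def standard_borel_def by blast
  obtain \<B> where \<B>: "countable \<B>" "\<forall>V\<in>\<B>. openin X V"
    "\<forall>U x. openin X U \<and> x \<in> U \<longrightarrow> (\<exists>V\<in>\<B>. x \<in> V \<and> V \<subseteq> U)"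
    using polish_space_topD(2)[OF X(1)] unfolding second_countable_def by blast
  define B where "B = from_nat_into (insert (space M) \<B>)"
  have rB: "range B = insert (space M) \<B>"
    unfolding B_def using \<B>(1) by (intro range_from_nat_into) auto
  have opB: "openin X V" if "V \<in> range B" for V
    using that \<B>(2) openin_topspace[of X] X(2) rB by auto
  have sub: "range B \<subseteq> sets M"
    using opB unfolding sM by (auto intro: sigma_sets.Basic)
  have "{U. openin X U} \<subseteq> sigma_sets (space M) (range B)"
  proof
    fix U assume "U \<in> {U. openin X U}"
    then have U: "openin X U" by simp
    have "U = \<Union>{V \<in> \<B>. V \<subseteq> U}" (is "_ = \<Union>?C")
    proof (intro equalityI subsetI)
      fix x assume "x \<in> U"
      then obtain V where "V \<in> \<B>" "x \<in> V" "V \<subseteq> U" using \<B>(3)[rule_format, of U x] U by auto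
      then show "x \<in> \<Union>?C" by auto
    qed auto
    moreover have "\<Union>?C \<in> sigma_sets (space M) (range B)"
    proof (rule sigma_algebra.countable_Union)
      show "sigma_algebra (space M) (sigma_sets (space M) (range B))"
        by (rule sigma_algebra_sigma_sets) (use sub sets.sets_into_space in auto)
      show "countable ?C" using \<B>(1) by (rule countable_subset[rotated]) auto
      show "?C \<subseteq> sigma_sets (space M) (range B)" unfolding rB by (auto intro: sigma_sets.Basic)
    qed
    ultimately show "U \<in> sigma_sets (space M) (range B)" by simp
  qed
  then have "sets M \<subseteq> sigma_sets (space M) (range B)"
    unfolding sM by (rule sigma_sets_mono)
  moreover have "sigma_sets (space M) (range B) \<subseteq> sets M"
    using sub by (rule sets.sigma_sets_subset)
  ultimately have gen: "sets M = sigma_sets (space M) (range B)" by (rule antisym)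
  have "\<exists>n. x \<in> B n \<and> y \<notin> B n" if xy: "x \<in> space M" "y \<in> space M" "x \<noteq> y" for x y
  proof -
    obtain U V where UV: "openin X U" "openin X V" "x \<in> U" "y \<in> V" "disjnt U V"
      using polish_space_topD(3)[OF X(1)] xy X(2) unfolding Hausdorff_space_def by metis
    obtain W where W: "W \<in> \<B>" "x \<in> W" "W \<subseteq> U" using \<B>(3)[rule_format, of U x] UV by auto
    obtain n where "W = B n" using W(1) rB by (metis insertCI rangeE)
    then show ?thesis using W UV unfolding disjnt_def by blast
  qed
  then show ?thesis using that[OF sub gen] by blast
qed

lemma sets_eq_fun:
  assumes "f \<in> measurable N M" "g \<in> measurable N M"
  shows "{x \<in> space N. f x = g x} \<in> sets N"
proof -
  obtain B :: "nat \<Rightarrow> 'a set" where B: "range B \<subseteq> sets M"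
    and sep: "\<And>x y. x \<in> space M \<Longrightarrow> y \<in> space M \<Longrightarrow> x \<noteq> y \<Longrightarrow> \<exists>n. x \<in> B n \<and> y \<notin> B n"
    using countable_separating_generator by metis
  let ?D = "\<Union>n. (f -` B n \<inter> space N) - (g -` B n \<inter> space N)"
  have "?D \<in> sets N"
    using measurable_sets[OF assms(1)] measurable_sets[OF assms(2)] B
    by (intro sets.countable_UN sets.Diff) auto
  moreover have "{x \<in> space N. f x = g x} = space N - ?D"
  proof (intro equalityI subsetI)
    fix x assume x: "x \<in> space N - ?D"
    show "x \<in> {x \<in> space N. f x = g x}"
    proof (rule ccontr)
      assume "\<not> ?thesis"
      then have "f x \<noteq> g x" using x by simp
      then obtain n where "f x \<in> B n" "g x \<notin> B n"
        using sep[of "f x" "g x"] measurable_space[OF assms(1)] measurable_space[OF assms(2)] x by auto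
      then show False using x by auto
    qed
  qed auto
  ultimately show ?thesis by auto
qed

lemma sets_neq_fun:
  assumes "f \<in> measurable N M" "g \<in> measurable N M"
  shows "{x \<in> space N. f x \<noteq> g x} \<in> sets N"
proof -
  have "{x \<in> space N. f x \<noteq> g x} = space N - {x \<in> space N. f x = g x}" by auto
  then show ?thesis using sets_eq_fun[OF assms] by auto
qed

text \<open>A bound on preimages is enough, so that limits not yet known to be invertible are
  covered.\<close>

lemma AE_compose:
  assumes T: "T \<in> measurable M M"
    and mT: "\<And>A. A \<in> sets M \<Longrightarrow> emeasure M (T -` A \<inter> space M) \<le> emeasure M A"
    and P: "AE x in M. P x"
  shows "AE x in M. P (T x)"
proof -
  obtain N where N: "{x \<in> space M. \<not> P x} \<subseteq> N" "N \<in> sets M" "emeasure M N = 0"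
    using P by (auto elim: AE_E)
  show ?thesis
  proof (rule AE_I)
    show "{x \<in> space M. \<not> P (T x)} \<subseteq> T -` N \<inter> space M"
      using N(1) measurable_space[OF T] by auto
    show "emeasure M (T -` N \<inter> space M) = 0" using mT[OF N(2)] N(3) by simp
    show "T -` N \<inter> space M \<in> sets M" using measurable_sets[OF T N(2)] .
  qed
qed

text \<open>
  The points all of whose images under words in \<open>S\<close> and \<open>T\<close> behave well form an invariant
  conull set, off which the map is replaced by the identity.
\<close>

lemma mp_bij_of_AE_inverse:
  assumes T: "T \<in> measurable M M" and S: "S \<in> measurable M M"
    and ST: "AE x in M. S (T x) = x" and TS: "AE x in M. T (S x) = x"
    and mT: "\<And>A. A \<in> sets M \<Longrightarrow> emeasure M (T -` A \<inter> space M) \<le> emeasure M A"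
    and mS: "\<And>A. A \<in> sets M \<Longrightarrow> emeasure M (S -` A \<inter> space M) \<le> emeasure M A"
  obtains t where "t \<in> mp_bij M" "AE x in M. t x = T x"
proof -
  \<comment> \<open>\<open>W w\<close> applies the letters of \<open>w\<close> in order,
    \<open>True\<close> standing for \<open>T\<close> and \<open>False\<close> for \<open>S\<close>;
    prefixing a letter is what makes \<open>X0\<close> invariant under both maps.\<close>
  define W where "W = fold (\<lambda>b y. if b then T y else S y)"
  define good where "good y \<longleftrightarrow> S (T y) = y \<and> T (S y) = y" for y
  define X0 where "X0 = {x \<in> space M. \<forall>w. good (W w x)}"
  have W_Cons: "W (b # w) x = W w (if b then T x else S x)" for b w x unfolding W_def by simp
  have W_meas: "W w \<in> measurable M M" for w
  proof (induction w)
    case (Cons b w)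
    have "W (b # w) = (\<lambda>x. W w ((if b then T else S) x))" using W_Cons by auto
    then show ?case using measurable_compose[OF _ Cons, of "if b then T else S"] S T by auto
  qed (simp add: W_def)
  have AE_good: "AE x in M. good (W w x)" for w
  proof (induction w)
    case Nil
    show ?case using ST TS unfolding good_def W_def by simp
  next
    case (Cons b w)
    show ?case
      using AE_compose[OF T mT Cons.IH] AE_compose[OF S mS Cons.IH] unfolding W_Cons by (cases b) auto
  qed
  have gs: "{x \<in> space M. good (W w x)} \<in> sets M" for w
  proof -
    have "{x \<in> space M. good (W w x)} =
        {x \<in> space M. S (T (W w x)) = W w x} \<inter> {x \<in> space M. T (S (W w x)) = W w x}"
      unfolding good_def by auto
    moreover have "(\<lambda>x. S (T (W w x))) \<in> measurable M M" "(\<lambda>x. T (S (W w x))) \<in> measurable M M"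
      by (rule measurable_compose[OF measurable_compose[OF W_meas T] S],
          rule measurable_compose[OF measurable_compose[OF W_meas S] T])
    ultimately show ?thesis using sets_eq_fun[OF _ W_meas[of w]] by simp
  qed
  have "X0 = (\<Inter>w. {x \<in> space M. good (W w x)})" unfolding X0_def by auto
  then have X0: "X0 \<in> sets M" using gs by (auto intro!: sets.countable_INT)
  have "AE x in M. \<forall>w. good (W w x)" using AE_good by (simp add: AE_all_countable)
  then have AE0: "AE x in M. x \<in> X0" unfolding X0_def by (rule AE_mp) auto
  then have null: "emeasure M (space M - X0) = 0"
    using X0 by (subst (asm) AE_iff_measurable[of "space M - X0"]) auto
  have g0: "good x" if "x \<in> X0" for x
  proof -
    have "good (W [] x)" using that unfolding X0_def by blast
    then show ?thesis by (simp add: W_def)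
  qed
  have TX: "T x \<in> X0" if x: "x \<in> X0" for x
  proof -
    have "good (W w (T x))" for w
    proof -
      have "good (W (True # w) x)" using x unfolding X0_def by blast
      then show ?thesis by (simp add: W_Cons)
    qed
    then show ?thesis using x measurable_space[OF T] unfolding X0_def by auto
  qed
  have SX: "S x \<in> X0" if x: "x \<in> X0" for x
  proof -
    have "good (W w (S x))" for w
    proof -
      have "good (W (False # w) x)" using x unfolding X0_def by blast
      then show ?thesis by (simp add: W_Cons)
    qed
    then show ?thesis using x measurable_space[OF S] unfolding X0_def by auto
  qed
  define T' where "T' x = (if x \<in> X0 then T x else x)" for x
  define S' where "S' x = (if x \<in> X0 then S x else x)" for x
  have le: "emeasure M ((\<lambda>x. if x \<in> X0 then U x else x) -` A \<inter> space M) \<le> emeasure M A"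
    if U: "U \<in> measurable M M" and mU: "emeasure M (U -` A \<inter> space M) \<le> emeasure M A"
      and A: "A \<in> sets M" for U A
  proof -
    have "emeasure M ((\<lambda>x. if x \<in> X0 then U x else x) -` A \<inter> space M) \<le>
        emeasure M ((U -` A \<inter> space M) \<union> (space M - X0))"
      by (rule emeasure_mono) (use X0 measurable_sets[OF U A] in auto)
    also have "\<dots> \<le> emeasure M (U -` A \<inter> space M) + emeasure M (space M - X0)"
      by (rule emeasure_subadditive) (use X0 measurable_sets[OF U A] in auto)
    finally show ?thesis using null mU by simp
  qed
  have meas: "(\<lambda>x. if x \<in> X0 then U x else x) \<in> measurable M M" if "U \<in> measurable M M" for U
    using that X0 by (intro measurable_If_set) auto
  have "restrict T' (space M) \<in> mp_bij M"
  proof (rule mp_bijI[where S = S'])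
    show "T' \<in> measurable M M" "S' \<in> measurable M M"
      using meas[OF T] meas[OF S] unfolding T'_def S'_def by auto
    show "S' (T' x) = x" "T' (S' x) = x" for x
      using TX g0 SX unfolding T'_def S'_def good_def by auto
    show "emeasure M (T' -` A \<inter> space M) \<le> emeasure M A"
      "emeasure M (S' -` A \<inter> space M) \<le> emeasure M A" if "A \<in> sets M" for A
      using le[OF T mT[OF that] that] le[OF S mS[OF that] that] unfolding T'_def S'_def by auto
  qed
  moreover have "AE x in M. restrict T' (space M) x = T x"
    using AE0 by (rule AE_mp) (auto simp: T'_def)
  ultimately show ?thesis by (rule that)
qed

subsection \<open>An equivalent finite measure\<close>

text \<open>Positivity gives \<open>nu\<close> the null sets of \<open>M\<close>, integrability
  makes it finite, and the bound \<open>1\<close> keeps it below \<open>M\<close>.\<close>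

definition dens :: "'a \<Rightarrow> ennreal" where
  "dens = (SOME h. h \<in> borel_measurable M \<and> integral\<^sup>N M h \<noteq> \<infinity> \<and> (\<forall>x\<in>space M. 0 < h x \<and> h x \<le> 1))"

lemma dens:
  "dens \<in> borel_measurable M" "integral\<^sup>N M dens \<noteq> \<infinity>"
  "\<And>x. x \<in> space M \<Longrightarrow> 0 < dens x" "\<And>x. x \<in> space M \<Longrightarrow> dens x \<le> 1"
proof -
  obtain h where h: "h \<in> borel_measurable M" "integral\<^sup>N M h \<noteq> \<infinity>" "\<forall>x\<in>space M. 0 < h x \<and> h x < \<infinity>"
    using Ex_finite_integrable_function by blast
  have "integral\<^sup>N M (\<lambda>x. min (h x) 1) \<le> integral\<^sup>N M h" by (rule nn_integral_mono) simp
  then have "integral\<^sup>N M (\<lambda>x. min (h x) 1) \<noteq> \<infinity>" using h(2) by (auto simp: top_unique)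
  moreover have "(\<lambda>x. min (h x) 1) \<in> borel_measurable M" using h(1) by simp
  moreover have "\<forall>x\<in>space M. 0 < min (h x) 1 \<and> min (h x) 1 \<le> 1" using h(3) by simp
  ultimately have "\<exists>h. h \<in> borel_measurable M \<and> integral\<^sup>N M h \<noteq> \<infinity> \<and> (\<forall>x\<in>space M. 0 < h x \<and> h x \<le> 1)"
    by (intro exI[of _ "\<lambda>x. min (h x) 1"] conjI)
  then have d: "dens \<in> borel_measurable M \<and> integral\<^sup>N M dens \<noteq> \<infinity> \<and> (\<forall>x\<in>space M. 0 < dens x \<and> dens x \<le> 1)"
    unfolding dens_def by (rule someI_ex)
  then show "dens \<in> borel_measurable M" "integral\<^sup>N M dens \<noteq> \<infinity>"
    "\<And>x. x \<in> space M \<Longrightarrow> 0 < dens x" "\<And>x. x \<in> space M \<Longrightarrow> dens x \<le> 1" by auto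
qed

definition nu :: "'a measure" where "nu = density M dens"

text \<open>The set where \<open>dens\<close> is at least \<open>1 / (k + 1)\<close>, with the
  factor on the other side of the inequality to avoid a division in \<open>ennreal\<close>. There
  \<open>M\<close> is at most \<open>Suc k\<close> times \<open>nu\<close>; so these sets have
  finite measure, exhaust the space, and let bounds pass from \<open>nu\<close> to
  \<open>M\<close>.\<close>

definition lev :: "nat \<Rightarrow> 'a set" where "lev k = {x \<in> space M. 1 \<le> of_nat (Suc k) * dens x}"

lemma sets_nu [simp]: "sets nu = sets M" and space_nu [simp]: "space nu = space M"
  unfolding nu_def by auto

lemma emeasure_nu: "A \<in> sets M \<Longrightarrow> emeasure nu A = (\<integral>\<^sup>+x. dens x * indicator A x \<partial>M)"
  unfolding nu_def by (rule emeasure_density[OF dens(1)])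

lemma finite_nu: "finite_measure nu"
proof (rule finite_measureI)
  have "emeasure nu (space M) = integral\<^sup>N M dens"
    by (subst emeasure_nu) (auto intro!: nn_integral_cong)
  then show "emeasure nu (space nu) \<noteq> \<infinity>" using dens(2) by simp
qed

sublocale nu: finite_measure nu
  by (rule finite_nu)

lemma emeasure_nu_le: "A \<in> sets M \<Longrightarrow> emeasure nu A \<le> emeasure M A"
proof -
  assume A: "A \<in> sets M"
  have "(\<integral>\<^sup>+x. dens x * indicator A x \<partial>M) \<le> (\<integral>\<^sup>+x. indicator A x \<partial>M)"
    by (rule nn_integral_mono) (auto simp: indicator_def dens(4))
  then show ?thesis using emeasure_nu[OF A] A by simp
qed

lemma sets_lev [measurable]: "lev k \<in> sets M"
  unfolding lev_def using dens(1) by measurable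

lemma emeasure_Int_lev_le:
  assumes A: "A \<in> sets M"
  shows "emeasure M (A \<inter> lev k) \<le> of_nat (Suc k) * emeasure nu A"
proof -
  have m: "A \<inter> lev k \<in> sets M" using A by auto
  have "emeasure M (A \<inter> lev k) = (\<integral>\<^sup>+x. indicator (A \<inter> lev k) x \<partial>M)" using m by simp
  also have "\<dots> \<le> (\<integral>\<^sup>+x. of_nat (Suc k) * (dens x * indicator A x) \<partial>M)"
    by (rule nn_integral_mono) (auto simp: indicator_def lev_def)
  also have "\<dots> = of_nat (Suc k) * (\<integral>\<^sup>+x. dens x * indicator A x \<partial>M)"
    by (rule nn_integral_cmult) (use dens(1) A in auto)
  finally show ?thesis using emeasure_nu[OF A] by simp
qed

lemma emeasure_lev_finite: "emeasure M (lev k) < \<infinity>"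
proof -
  have "emeasure M (lev k \<inter> lev k) \<le> of_nat (Suc k) * emeasure nu (lev k)"
    by (rule emeasure_Int_lev_le) simp
  also have "\<dots> = ennreal (real (Suc k) * measure nu (lev k))"
    by (simp add: nu.emeasure_eq_measure ennreal_mult ennreal_of_nat_eq_real_of_nat)
  also have "\<dots> < \<infinity>" by simp
  finally show ?thesis by simp
qed

lemma lev_finite_sets: "lev k \<in> finite_sets M"
  unfolding finite_sets_def using emeasure_lev_finite by simp

lemma incseq_lev: "incseq lev"
proof (rule incseq_SucI, rule subsetI)
  fix k x assume "x \<in> lev k"
  moreover have "of_nat (Suc k) * dens x \<le> of_nat (Suc (Suc k)) * dens x"
    by (intro mult_right_mono) auto
  ultimately show "x \<in> lev (Suc k)" unfolding lev_def using order_trans by blast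
qed

lemma UN_lev: "(\<Union>k. lev k) = space M"
proof (intro equalityI subsetI)
  fix x assume x: "x \<in> space M"
  have d: "0 < dens x" "dens x \<le> 1" using dens(3,4) x by auto
  define r where "r = enn2real (dens x)"
  have "dens x < \<infinity>" using d(2) by (rule le_less_trans) simp
  then have r: "dens x = ennreal r" "0 < r" unfolding r_def using d(1)
    by (simp_all add: enn2real_positive_iff)
  obtain k where "inverse (real (Suc k)) < r" using reals_Archimedean[OF r(2)] by blast
  then have "1 \<le> real (Suc k) * r" by (simp add: field_simps)
  moreover have "of_nat (Suc k) * dens x = ennreal (real (Suc k) * r)"
    unfolding r(1) ennreal_of_nat_eq_real_of_nat using r(2) by (intro ennreal_mult[symmetric]) auto
  ultimately have "1 \<le> of_nat (Suc k) * dens x" using ennreal_leI[of 1] by simp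
  then show "x \<in> (\<Union>k. lev k)" using x unfolding lev_def by blast
qed (auto simp: lev_def)

lemma measure_Int_lev_le:
  assumes A: "A \<in> sets M"
  shows "measure M (A \<inter> lev k) \<le> real (Suc k) * measure nu A"
proof -
  have "emeasure M (A \<inter> lev k) \<le> ennreal (real (Suc k) * measure nu A)"
    using emeasure_Int_lev_le[OF A, of k]
    by (simp add: nu.emeasure_eq_measure ennreal_mult ennreal_of_nat_eq_real_of_nat)
  then show ?thesis unfolding measure_def by (intro enn2real_leI) auto
qed

lemma finite_setsD: "A \<in> finite_sets M \<Longrightarrow> A \<in> sets M" "A \<in> finite_sets M \<Longrightarrow> A \<in> fmeasurable M"
  unfolding finite_sets_def fmeasurable_def by auto

lemma finite_sets_fmeasurable: "finite_sets M = fmeasurable M"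
  unfolding finite_sets_def fmeasurable_def by auto

lemma measure_nu_le:
  assumes "A \<in> fmeasurable M" shows "measure nu A \<le> measure M A"
  using emeasure_nu_le[of A] assms
  by (simp add: nu.emeasure_eq_measure emeasure_eq_measure2 fmeasurableD)

lemma measure_diff_lev_tendsto:
  assumes A: "A \<in> fmeasurable M"
  shows "(\<lambda>k. measure M (A - lev k)) \<longlonglongrightarrow> 0"
proof -
  have "(\<lambda>k. measure M (A - lev k)) \<longlonglongrightarrow> measure M (\<Inter>k. A - lev k)"
  proof (rule Lim_measure_decseq)
    show "range (\<lambda>k. A - lev k) \<subseteq> sets M" using A by auto
    show "decseq (\<lambda>k. A - lev k)" using incseq_lev unfolding incseq_def decseq_def by blast
    show "emeasure M (A - lev k) \<noteq> \<infinity>" for k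
      using fmeasurableD2[OF fmeasurable_Diff[OF A sets_lev]] by simp
  qed
  moreover have "(\<Inter>k. A - lev k) = {}"
    using UN_lev sets.sets_into_space[OF fmeasurableD[OF A]] by blast
  ultimately show ?thesis by (simp only: measure_empty)
qed

lemma measure_nu_diff_lev:
  assumes "e > 0"
  obtains k where "measure nu (space M - lev k) < e"
proof -
  have "(\<lambda>k. measure nu (space M - lev k)) \<longlonglongrightarrow> measure nu (\<Inter>k. space M - lev k)"
    by (rule nu.finite_Lim_measure_decseq)
      (use incseq_lev in \<open>auto simp: incseq_def decseq_def\<close>)
  moreover have "(\<Inter>k. space M - lev k) = {}" using UN_lev by blast
  ultimately have "(\<lambda>k. measure nu (space M - lev k)) \<longlonglongrightarrow> 0" by (simp only: measure_empty)
  then have "\<forall>\<^sub>F k in sequentially. measure nu (space M - lev k) < e"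
    using assms by (rule order_tendstoD(2))
  then show ?thesis using that by (auto simp: eventually_sequentially)
qed

text \<open>The part of \<open>A\<close> outside a suitable \<open>lev k\<close> has measure below
  \<open>e / 2\<close>; inside \<open>lev k\<close> the measures compare with the factor
  \<open>Suc k\<close>, which dictates \<open>d\<close>. This is absolute continuity of
  \<open>M\<close> on \<open>A\<close> with respect to \<open>nu\<close>.\<close>

lemma measure_Int_le_if_nu_small:
  assumes A: "A \<in> fmeasurable M" and e: "e > 0"
  obtains d where "d > 0" "\<And>D. D \<in> sets M \<Longrightarrow> measure nu D < d \<Longrightarrow> measure M (A \<inter> D) < e"
proof -
  have "\<forall>\<^sub>F k in sequentially. measure M (A - lev k) < e / 2"
    using measure_diff_lev_tendsto[OF A] e by (intro order_tendstoD(2)) auto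
  then obtain k where k: "measure M (A - lev k) < e / 2" by (auto simp: eventually_sequentially)
  define d where "d = e / (2 * real (Suc k))"
  have d: "d > 0" "real (Suc k) * d = e / 2" using e unfolding d_def by (auto simp: field_simps)
  have "measure M (A \<inter> D) < e" if D: "D \<in> sets M" "measure nu D < d" for D
  proof -
    have f1: "A - lev k \<in> fmeasurable M" using A by (intro fmeasurable_Diff) auto
    have f2: "D \<inter> lev k \<in> fmeasurable M"
      using fmeasurable_Int_fmeasurable[OF finite_setsD(2)[OF lev_finite_sets, of k] D(1)]
      by (simp add: Int_commute)
    have "measure M (A \<inter> D) \<le> measure M ((A - lev k) \<union> (D \<inter> lev k))"
      using A D f1 f2 by (intro measure_mono_fmeasurable) auto
    also have "\<dots> \<le> measure M (A - lev k) + measure M (D \<inter> lev k)"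
      using f1 f2 by (intro measure_Un_le) auto
    also have "measure M (D \<inter> lev k) \<le> real (Suc k) * measure nu D"
      by (rule measure_Int_lev_le) (rule D)
    also have "real (Suc k) * measure nu D \<le> real (Suc k) * d"
      using D by (intro mult_left_mono) auto
    finally show ?thesis using k d by linarith
  qed
  then show ?thesis using d(1) that by blast
qed

lemma null_nu_iff: "A \<in> sets M \<Longrightarrow> measure nu A = 0 \<longleftrightarrow> emeasure M A = 0"
proof -
  assume A: "A \<in> sets M"
  have "emeasure nu A = 0 \<longleftrightarrow> (AE x in M. dens x * indicator A x = 0)"
    using emeasure_nu[OF A] dens(1) A by (simp add: nn_integral_0_iff_AE)
  also have "\<dots> \<longleftrightarrow> (AE x in M. x \<notin> A)"
  proof (rule AE_cong)
    fix x assume "x \<in> space M"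
    then show "dens x * indicator A x = 0 \<longleftrightarrow> x \<notin> A" using dens(3)[of x] by (auto simp: indicator_def)
  qed
  also have "\<dots> \<longleftrightarrow> emeasure M A = 0"
    using A sets.sets_into_space[OF A] by (subst AE_iff_measurable[of A]) auto
  finally show ?thesis by (simp add: nu.emeasure_eq_measure)
qed

lemma AE_nu_iff: "(AE x in nu. P x) \<longleftrightarrow> (AE x in M. P x)"
  unfolding nu_def AE_density[OF dens(1)]
  by (rule AE_cong) (use dens(3) in simp)

end

section \<open>Images of sets and the measure of symmetric differences\<close>

lemma mp_bij_maps:
  assumes "t \<in> mp_bij M"
  shows "inj_on t (space M)" "t ` space M = space M" "\<And>x. x \<in> space M \<Longrightarrow> t x \<in> space M"
  using mp_bijD(1)[OF assms] by (auto simp: Bij_def bij_betw_def)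

lemma fmeasurable_image_mp_bij:
  "t \<in> mp_bij M \<Longrightarrow> A \<in> fmeasurable M \<Longrightarrow> t ` A \<in> fmeasurable M"
  using mp_bijD(3,4) unfolding fmeasurable_def by fastforce

lemma measure_image_mp_bij:
  "t \<in> mp_bij M \<Longrightarrow> A \<in> sets M \<Longrightarrow> measure M (t ` A) = measure M A"
  using mp_bijD(4) unfolding measure_def by metis

text \<open>As \<open>measure\<close> gives \<open>0\<close> to sets of infinite measure, the
  triangle inequality can fail beyond sets of finite measure.\<close>

definition sdist :: "'a measure \<Rightarrow> 'a set \<Rightarrow> 'a set \<Rightarrow> real" where
  "sdist M A B = measure M (sym_diff A B)"

lemma sdist_commute: "sdist M A B = sdist M B A"
  by (simp add: sdist_def Un_commute)

lemma sdist_self [simp]: "sdist M A A = 0"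
  by (simp add: sdist_def)

lemma sdist_triangle:
  assumes "A \<in> fmeasurable M" "B \<in> fmeasurable M" "C \<in> fmeasurable M"
  shows "sdist M A C \<le> sdist M A B + sdist M B C"
proof -
  have "measure M (sym_diff A C) \<le> measure M (sym_diff A B \<union> sym_diff B C)"
    by (rule measure_mono_fmeasurable)
      (use assms in \<open>auto intro!: fmeasurable.Un fmeasurable.Diff dest: fmeasurableD\<close>)
  also have "\<dots> \<le> measure M (sym_diff A B) + measure M (sym_diff B C)"
    by (rule measure_Un_le) (use assms in \<open>auto dest: fmeasurableD\<close>)
  finally show ?thesis by (simp add: sdist_def)
qed

lemma sdist_image:
  assumes t: "t \<in> mp_bij M" and A: "A \<in> sets M" "B \<in> sets M"
  shows "sdist M (t ` A) (t ` B) = sdist M A B"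
proof -
  have "sym_diff (t ` A) (t ` B) = t ` sym_diff A B"
    using inj_on_image_set_diff[OF mp_bij_maps(1)[OF t]] sets.sets_into_space[OF A(1)]
      sets.sets_into_space[OF A(2)] by (auto simp: image_Un)
  then show ?thesis unfolding sdist_def using measure_image_mp_bij[OF t, of "sym_diff A B"] A by auto
qed

context std_space
begin

text \<open>\<open>nu\<close> is not invariant under \<open>t\<close>, but \<open>M\<close> is. Up
  to a small remainder the preimage sits in some \<open>lev k\<close>; there its \<open>nu\<close>
  measure is at most its \<open>M\<close> measure, and \<open>t\<close> carries it onto the part of
  \<open>D\<close> in the image of \<open>lev k\<close>, a set of finite measure. The lemma stands
  in for invariance in the study of the uniform metric.\<close>

lemma measure_nu_vimage_small:
  assumes t: "t \<in> mp_bij M" and e: "e > 0"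
  obtains d where "d > 0"
    "\<And>D. D \<in> sets M \<Longrightarrow> measure nu D < d \<Longrightarrow> measure nu (t -` D \<inter> space M) < e"
proof -
  obtain k where k: "measure nu (space M - lev k) < e / 2" using measure_nu_diff_lev[of "e / 2"] e by auto
  have lf: "lev k \<in> fmeasurable M" using lev_finite_sets finite_setsD by blast
  obtain d where d: "d > 0" "\<And>D. D \<in> sets M \<Longrightarrow> measure nu D < d \<Longrightarrow> measure M (t ` lev k \<inter> D) < e / 2"
    using measure_Int_le_if_nu_small[OF fmeasurable_image_mp_bij[OF t lf], of "e / 2"] e by auto
  have "measure nu (t -` D \<inter> space M) < e" if D: "D \<in> sets M" "measure nu D < d" for D
  proof -
    have tD: "t -` D \<inter> space M \<in> sets M" using measurable_sets[OF mp_bijD(2)[OF t] D(1)] .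
    have E: "t -` D \<inter> lev k = lev k \<inter> (t -` D \<inter> space M)" unfolding lev_def by auto
    then have Ef: "t -` D \<inter> lev k \<in> fmeasurable M" using fmeasurable_Int_fmeasurable[OF lf tD] by simp
    have "measure nu (t -` D \<inter> space M) \<le> measure nu ((space M - lev k) \<union> (t -` D \<inter> lev k))"
      using fmeasurableD[OF Ef] by (intro nu.finite_measure_mono) auto
    also have "\<dots> \<le> measure nu (space M - lev k) + measure nu (t -` D \<inter> lev k)"
      using fmeasurableD[OF Ef] by (intro measure_Un_le) auto
    also have "measure nu (t -` D \<inter> lev k) \<le> measure M (t -` D \<inter> lev k)"
      by (rule measure_nu_le[OF Ef])
    also have "measure M (t -` D \<inter> lev k) = measure M (t ` (t -` D \<inter> lev k))"
      using measure_image_mp_bij[OF t fmeasurableD[OF Ef]] by simp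
    also have "t ` (t -` D \<inter> lev k) = t ` lev k \<inter> D" by auto
    also have "measure M \<dots> < e / 2" using d(2)[OF D] .
    finally show ?thesis using k by simp
  qed
  then show ?thesis using d(1) that by blast
qed

text \<open>The sets approximable in \<open>nu\<close> by members of a countable algebra containing
  a generator form a sigma-algebra, hence all measurable sets are approximable. Cutting the members
  of the algebra with the sets \<open>lev k\<close> passes from \<open>nu\<close> to
  \<open>M\<close>.\<close>

lemma countable_dense_sets:
  obtains A :: "nat \<Rightarrow> 'a set" where "\<And>n. A n \<in> fmeasurable M"
    "\<And>E e. E \<in> fmeasurable M \<Longrightarrow> e > 0 \<Longrightarrow> \<exists>n. sdist M E (A n) < e"
proof -
  obtain B :: "nat \<Rightarrow> 'a set" where B: "range B \<subseteq> sets M" "sets M = sigma_sets (space M) (range B)"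
    using countable_separating_generator by metis
  \<comment> \<open>Closing under the complement of a union is enough: complements and unions both
    arise from it.\<close>
  define \<A> where "\<A> = rec_nat (range B) (\<lambda>_ \<C>. \<C> \<union> (\<lambda>(a, b). space M - (a \<union> b)) ` (\<C> \<times> \<C>))"
  have \<A>0: "\<A> 0 = range B" and \<A>S: "\<A> (Suc n) = \<A> n \<union> (\<lambda>(a, b). space M - (a \<union> b)) ` (\<A> n \<times> \<A> n)" for n
    unfolding \<A>_def by auto
  have c\<A>: "countable (\<A> n) \<and> \<A> n \<subseteq> sets M" for n
  proof (induction n)
    case 0 show ?case using B(1) unfolding \<A>0 by simp
  next
    case (Suc n) then show ?case unfolding \<A>S by auto
  qed
  have mono: "\<A> m \<subseteq> \<A> n" if "m \<le> n" for m n
    using that by (induction rule: dec_induct) (auto simp: \<A>S)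
  define \<R> where "\<R> = (\<Union>n. \<A> n)"
  have \<R>: "countable \<R>" "\<R> \<subseteq> sets M" unfolding \<R>_def using c\<A> by auto
  have nor: "space M - (a \<union> b) \<in> \<R>" if "a \<in> \<R>" "b \<in> \<R>" for a b
  proof -
    obtain m n where "a \<in> \<A> m" "b \<in> \<A> n" using \<open>a \<in> \<R>\<close> \<open>b \<in> \<R>\<close> unfolding \<R>_def by auto
    then have "a \<in> \<A> (max m n)" "b \<in> \<A> (max m n)" using mono[of m "max m n"] mono[of n "max m n"] by auto
    then have "space M - (a \<union> b) \<in> \<A> (Suc (max m n))" unfolding \<A>S by force
    then show ?thesis unfolding \<R>_def by blast
  qed
  have compl: "space M - a \<in> \<R>" if "a \<in> \<R>" for a using nor[OF that that] by simp
  have un: "a \<union> b \<in> \<R>" if "a \<in> \<R>" "b \<in> \<R>" for a b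
  proof -
    have "a \<union> b \<subseteq> space M" using that \<R>(2) sets.sets_into_space by blast
    then have "space M - (space M - (a \<union> b)) = a \<union> b" by blast
    then show ?thesis using compl[OF nor[OF that]] by simp
  qed
  have BR: "range B \<subseteq> \<R>" unfolding \<R>_def using \<A>0 by blast
  have emp: "{} \<in> \<R>"
  proof -
    have "B 0 \<in> \<R>" using BR by blast
    from nor[OF this compl[OF this]] show ?thesis by (simp add: Diff_eq_empty_iff[THEN iffD2] subsetI)
  qed
  define K where "K = {E \<in> sets M. \<forall>e>0. \<exists>a\<in>\<R>. sdist nu E a < e}"
  have fm: "E \<in> fmeasurable nu" if "E \<in> sets M" for E using that by (simp add: nu.fmeasurable_eq_sets)
  have KU: "E \<union> F \<in> K" if E: "E \<in> K" and F: "F \<in> K" for E F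
  proof -
    have "\<exists>a\<in>\<R>. sdist nu (E \<union> F) a < e" if e: "e > 0" for e
    proof -
      obtain a where a: "a \<in> \<R>" "sdist nu E a < e / 2" using E e unfolding K_def by (auto dest: spec[of _ "e / 2"])
      obtain b where b: "b \<in> \<R>" "sdist nu F b < e / 2" using F e unfolding K_def by (auto dest: spec[of _ "e / 2"])
      have s: "E \<in> sets M" "F \<in> sets M" "a \<in> sets M" "b \<in> sets M" using E F a b \<R>(2) unfolding K_def by auto
      have "sdist nu (E \<union> F) (a \<union> b) \<le> measure nu (sym_diff E a \<union> sym_diff F b)"
        unfolding sdist_def by (rule nu.finite_measure_mono) (use s in auto)
      also have "\<dots> \<le> sdist nu E a + sdist nu F b"
        unfolding sdist_def by (rule measure_Un_le) (use s in auto)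
      finally show ?thesis using a b un by (intro bexI[of _ "a \<union> b"]) auto
    qed
    then show ?thesis using E F unfolding K_def by auto
  qed
  have "sigma_sets (space M) (range B) \<subseteq> K"
  proof
    fix E assume "E \<in> sigma_sets (space M) (range B)"
    then show "E \<in> K"
    proof induction
      case (Basic a)
      then show ?case using BR B(1) unfolding K_def by (auto intro!: bexI[of _ a])
    next
      case Empty
      then show ?case using emp unfolding K_def by (auto intro!: bexI[of _ "{}"])
    next
      case (Compl E)
      have "\<exists>a\<in>\<R>. sdist nu (space M - E) a < e" if e: "e > 0" for e
      proof -
        obtain a where a: "a \<in> \<R>" "sdist nu E a < e" using Compl.IH e unfolding K_def by auto
        have "sym_diff (space M - E) (space M - a) = sym_diff E a"
          using Compl.IH a \<R>(2) sets.sets_into_space unfolding K_def by blast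
        then show ?thesis using a compl by (intro bexI[of _ "space M - a"]) (auto simp: sdist_def)
      qed
      then show ?case using Compl.IH unfolding K_def by auto
    next
      case (Union E)
      have Es: "E i \<in> sets M" for i using Union.IH[of i] unfolding K_def by blast
      have fin: "(\<Union>i<n. E i) \<in> K" for n
      proof (induction n)
        case 0
        show ?case using emp unfolding K_def by (auto intro!: bexI[of _ "{}"])
      next
        case (Suc n)
        have "(\<Union>i<Suc n. E i) = (\<Union>i<n. E i) \<union> E n" by (auto simp: less_Suc_eq)
        then show ?case using KU[OF Suc Union.IH[of n]] by simp
      qed
      have lim: "(\<lambda>n. measure nu (\<Union>i<n. E i)) \<longlonglongrightarrow> measure nu (\<Union>n. \<Union>i<n. E i)"
      proof (rule nu.finite_Lim_measure_incseq)
        show "range (\<lambda>n. \<Union>i<n. E i) \<subseteq> sets nu" using Es by auto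
        show "incseq (\<lambda>n. \<Union>i<n. E i)" by (intro monoI UN_mono) auto
      qed
      have U: "(\<Union>n. \<Union>i<n. E i) = (\<Union>i. E i)" by auto
      have "\<exists>a\<in>\<R>. sdist nu (\<Union>i. E i) a < e" if e: "e > 0" for e
      proof -
        have "measure nu (\<Union>i. E i) - e / 2 < measure nu (\<Union>i. E i)" using e by simp
        then have "\<forall>\<^sub>F n in sequentially. measure nu (\<Union>i. E i) - e / 2 < measure nu (\<Union>i<n. E i)"
          using lim unfolding U by (intro order_tendstoD(1)) auto
        then obtain n where n: "measure nu (\<Union>i. E i) - e / 2 < measure nu (\<Union>i<n. E i)"
          by (auto simp: eventually_sequentially)
        obtain a where a: "a \<in> \<R>" "sdist nu (\<Union>i<n. E i) a < e / 2"
          using fin[of n] e unfolding K_def by (auto dest: spec[of _ "e / 2"])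
        have s1: "(\<Union>i<n. E i) \<in> sets nu" "(\<Union>i. E i) \<in> sets nu" using Es by auto
        have s2: "(\<Union>i<n. E i) \<subseteq> (\<Union>i. E i)" by blast
        have "sdist nu (\<Union>i. E i) (\<Union>i<n. E i) = measure nu ((\<Union>i. E i) - (\<Union>i<n. E i))"
          unfolding sdist_def using s2 by (intro arg_cong[where f = "measure nu"]) blast
        also have "\<dots> = measure nu (\<Union>i. E i) - measure nu (\<Union>i<n. E i)"
          using s1 s2 by (intro nu.finite_measure_Diff) auto
        finally have "sdist nu (\<Union>i. E i) (\<Union>i<n. E i) < e / 2" using n by simp
        moreover have "sdist nu (\<Union>i. E i) a \<le> sdist nu (\<Union>i. E i) (\<Union>i<n. E i) + sdist nu (\<Union>i<n. E i) a"
          using s1 a(1) \<R>(2) by (intro sdist_triangle fm) auto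
        ultimately show ?thesis using a by (intro bexI[of _ a]) auto
      qed
      then show ?case using Es unfolding K_def by auto
    qed
  qed
  then have K: "\<exists>a\<in>\<R>. sdist nu E a < e" if "E \<in> sets M" "e > 0" for E e
    using that B(2) unfolding K_def by blast
  define A where "A n = (case prod_decode n of (i, k) \<Rightarrow> from_nat_into \<R> i \<inter> lev k)" for n
  have \<R>n: "from_nat_into \<R> i \<in> sets M" for i
    using from_nat_into[of \<R> i] emp \<R>(2) by blast
  have lf: "lev k \<in> fmeasurable M" for k using lev_finite_sets finite_setsD(2) by blast
  have "A n \<in> fmeasurable M" for n
    unfolding A_def using fmeasurable_Int_fmeasurable[OF lf \<R>n]
    by (auto split: prod.split simp: Int_commute)
  moreover have "\<exists>n. sdist M E (A n) < e" if E: "E \<in> fmeasurable M" and e: "e > 0" for E e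
  proof -
    have "\<forall>\<^sub>F k in sequentially. measure M (E - lev k) < e / 2"
      using measure_diff_lev_tendsto[OF E] e by (intro order_tendstoD(2)) auto
    then obtain k where k: "measure M (E - lev k) < e / 2" by (auto simp: eventually_sequentially)
    \<comment> \<open>Inside \<open>lev k\<close> the error is at most \<open>Suc k\<close> times
      the error in \<open>nu\<close>; this choice allots \<open>e / 2\<close> to it.\<close>
    define d where "d = e / (2 * real (Suc k))"
    have d: "d > 0" "real (Suc k) * d = e / 2" using e unfolding d_def by (auto simp: field_simps)
    obtain a where a: "a \<in> \<R>" "sdist nu E a < d" using K[OF fmeasurableD[OF E] d(1)] by blast
    obtain i where i: "from_nat_into \<R> i = a" using a(1) \<R>(1) from_nat_into_surj by metis
    have as: "a \<in> sets M" using a \<R>(2) by blast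
    have Es: "E \<in> sets M" using E by (rule fmeasurableD)
    have f2: "sym_diff E a \<inter> lev k \<in> fmeasurable M"
      using fmeasurable_Int_fmeasurable[OF lf[of k], of "sym_diff E a"] as Es
      by (simp add: Int_commute)
    have f1: "E - lev k \<in> fmeasurable M" using E by (intro fmeasurable_Diff) auto
    have "sdist M E (a \<inter> lev k) \<le> measure M ((E - lev k) \<union> (sym_diff E a \<inter> lev k))"
      unfolding sdist_def using f1 f2 Es as by (intro measure_mono_fmeasurable) auto
    also have "\<dots> \<le> measure M (E - lev k) + measure M (sym_diff E a \<inter> lev k)"
      using f1 f2 by (intro measure_Un_le) auto
    also have "measure M (sym_diff E a \<inter> lev k) \<le> real (Suc k) * measure nu (sym_diff E a)"
      by (rule measure_Int_lev_le) (use Es as in auto)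
    also have "real (Suc k) * measure nu (sym_diff E a) \<le> real (Suc k) * d"
      using a(2) unfolding sdist_def by (intro mult_left_mono) auto
    finally have "sdist M E (a \<inter> lev k) < e" using k d by linarith
    moreover have "A (prod_encode (i, k)) = a \<inter> lev k" unfolding A_def using i by simp
    ultimately show ?thesis by metis
  qed
  ultimately show ?thesis by (rule that)
qed

end

section \<open>Classes modulo null sets\<close>

definition cls :: "'a measure \<Rightarrow> ('a \<Rightarrow> 'a) \<Rightarrow> ('a \<Rightarrow> 'a) set" where
  "cls M t = {s \<in> mp_bij M. AE x in M. s x = t x}"

definition tinv :: "'a measure \<Rightarrow> ('a \<Rightarrow> 'a) \<Rightarrow> 'a \<Rightarrow> 'a" where
  "tinv M t = restrict (inv_into (space M) t) (space M)"

lemma tinv: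
  assumes t: "t \<in> mp_bij M"
  shows "tinv M t \<in> mp_bij M"
    "\<And>x. x \<in> space M \<Longrightarrow> tinv M t (t x) = x" "\<And>x. x \<in> space M \<Longrightarrow> t (tinv M t x) = x"
proof -
  have "inv\<^bsub>BijGroup (space M)\<^esub> t = tinv M t"
    unfolding tinv_def by (rule inv_BijGroup[OF mp_bijD(1)[OF t]])
  then show "tinv M t \<in> mp_bij M"
    using subgroup.m_inv_closed[OF mp_bij_subgroup t] by simp
  show "tinv M t (t x) = x" if "x \<in> space M" for x
    unfolding tinv_def using mp_bij_maps[OF t] that by simp
  show "t (tinv M t x) = x" if "x \<in> space M" for x
    unfolding tinv_def using mp_bij_maps(2)[OF t] that by (simp add: f_inv_into_f)
qed

lemma id_mp_bij: "restrict (\<lambda>x. x) (space M) \<in> mp_bij M"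
  using subgroup.one_closed[OF mp_bij_subgroup] by (simp add: BijGroup_def)

lemma compose_mp_bij:
  assumes "s \<in> mp_bij M" "t \<in> mp_bij M"
  shows "compose (space M) s t \<in> mp_bij M"
  using subgroup.m_closed[OF mp_bij_subgroup assms] mp_bijD(1)[OF assms(1)] mp_bijD(1)[OF assms(2)]
  by (simp add: BijGroup_def)

lemma cls_carrier: "t \<in> mp_bij M \<Longrightarrow> cls M t \<in> carrier (Aut M)"
  unfolding carrier_Aut cls_def by blast

lemma cls_eq_iff: "s \<in> mp_bij M \<Longrightarrow> t \<in> mp_bij M \<Longrightarrow> cls M s = cls M t \<longleftrightarrow> (AE x in M. s x = t x)"
proof
  assume s: "s \<in> mp_bij M" "t \<in> mp_bij M" and "cls M s = cls M t"
  then have "s \<in> cls M t" by (auto simp: cls_def)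
  then show "AE x in M. s x = t x" by (simp add: cls_def)
next
  assume s: "s \<in> mp_bij M" "t \<in> mp_bij M" and ae: "AE x in M. s x = t x"
  have "(AE x in M. u x = s x) \<longleftrightarrow> (AE x in M. u x = t x)" for u
  proof
    assume "AE x in M. u x = s x"
    with ae show "AE x in M. u x = t x" by eventually_elim simp
  next
    assume "AE x in M. u x = t x"
    with ae show "AE x in M. u x = s x" by eventually_elim simp
  qed
  then show "cls M s = cls M t" unfolding cls_def by simp
qed

lemma rep_cls: "t \<in> mp_bij M \<Longrightarrow> AE x in M. rep (cls M t) x = t x"
proof -
  assume t: "t \<in> mp_bij M"
  then have "t \<in> cls M t" by (simp add: cls_def)
  then have "rep (cls M t) \<in> cls M t" unfolding rep_def by (rule someI[of "\<lambda>u. u \<in> cls M t"])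
  then show ?thesis by (simp add: cls_def)
qed

lemma cls_rep:
  assumes "T \<in> carrier (Aut M)" shows "cls M (rep T) = T"
proof -
  obtain t where t: "t \<in> mp_bij M" "T = cls M t"
    using assms unfolding carrier_Aut cls_def by blast
  then show ?thesis using cls_eq_iff[OF rep_mp_bij[OF assms] t(1)] rep_cls[OF t(1)] by simp
qed

lemma Aut_eqI:
  assumes "S \<in> carrier (Aut M)" "T \<in> carrier (Aut M)" "AE x in M. rep S x = rep T x"
  shows "S = T"
  using cls_eq_iff[OF rep_mp_bij[OF assms(1)] rep_mp_bij[OF assms(2)]] assms cls_rep by metis

lemma cls_mult:
  assumes s: "s \<in> mp_bij M" and t: "t \<in> mp_bij M"
  shows "cls M s \<otimes>\<^bsub>Aut M\<^esub> cls M t = cls M (compose (space M) s t)"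
proof -
  have c: "cls M u = null_id M #>\<^bsub>mp_group M\<^esub> u" if "u \<in> mp_bij M" for u
    using Aut_class[OF that] by (simp add: cls_def)
  have "cls M s \<otimes>\<^bsub>Aut M\<^esub> cls M t = null_id M #>\<^bsub>mp_group M\<^esub> (s \<otimes>\<^bsub>mp_group M\<^esub> t)"
    unfolding c[OF s] c[OF t] Aut_def FactGroup_def
    using normal.rcos_sum[OF null_id_normal, of s M t] s t by simp
  then show ?thesis using c[OF compose_mp_bij[OF s t]] mult_mp_group[OF s t] by simp
qed

lemma rep_mult:
  assumes S: "S \<in> carrier (Aut M)" and T: "T \<in> carrier (Aut M)"
  shows "AE x in M. rep (S \<otimes>\<^bsub>Aut M\<^esub> T) x = rep S (rep T x)"
proof -
  note r = rep_mp_bij[OF S] rep_mp_bij[OF T]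
  have "S \<otimes>\<^bsub>Aut M\<^esub> T = cls M (compose (space M) (rep S) (rep T))"
    using cls_mult[OF r] cls_rep[OF S] cls_rep[OF T] by simp
  then have "AE x in M. rep (S \<otimes>\<^bsub>Aut M\<^esub> T) x = compose (space M) (rep S) (rep T) x"
    using rep_cls[OF compose_mp_bij[OF r]] by simp
  then show ?thesis by (rule AE_mp) (auto simp: compose_def)
qed

lemma one_Aut: "\<one>\<^bsub>Aut M\<^esub> = cls M (restrict (\<lambda>x. x) (space M))"
proof -
  interpret A: group "Aut M" by (rule Aut_group)
  let ?e = "cls M (restrict (\<lambda>x. x) (space M))"
  have "?e \<otimes>\<^bsub>Aut M\<^esub> ?e = cls M (compose (space M) (restrict (\<lambda>x. x) (space M)) (restrict (\<lambda>x. x) (space M)))"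
    by (rule cls_mult[OF id_mp_bij id_mp_bij])
  also have "\<dots> = ?e"
    by (intro arg_cong[where f = "cls M"] ext) (auto simp: compose_def)
  finally show ?thesis using A.l_cancel_one'[of ?e ?e] cls_carrier[OF id_mp_bij, of M] by metis
qed

lemma rep_one: "AE x in M. rep (\<one>\<^bsub>Aut M\<^esub>) x = x"
  unfolding one_Aut using rep_cls[OF id_mp_bij, of M] by (rule AE_mp) auto

lemma rep_inv_tinv:
  assumes T: "T \<in> carrier (Aut M)"
  shows "AE x in M. rep (inv\<^bsub>Aut M\<^esub> T) x = tinv M (rep T) x"
proof -
  interpret A: group "Aut M" by (rule Aut_group)
  note r = rep_mp_bij[OF T]
  let ?S = "cls M (tinv M (rep T))"
  have "?S \<otimes>\<^bsub>Aut M\<^esub> T = cls M (compose (space M) (tinv M (rep T)) (rep T))"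
    using cls_mult[OF tinv(1)[OF r] r] cls_rep[OF T] by simp
  also have "\<dots> = \<one>\<^bsub>Aut M\<^esub>"
    unfolding one_Aut using tinv(2)[OF r] by (intro arg_cong[where f = "cls M"] ext) (auto simp: compose_def)
  finally have "inv\<^bsub>Aut M\<^esub> T = ?S" by (rule A.inv_equality[OF _ T cls_carrier[OF tinv(1)[OF r]]])
  then show ?thesis using rep_cls[OF tinv(1)[OF r]] by simp
qed

lemma AE_rep:
  assumes T: "T \<in> carrier (Aut M)" and P: "AE x in M. P x"
  shows "AE x in M. P (rep T x)"
  by (rule AE_mp_bij[OF rep_mp_bij[OF T] P])

lemma rep_inv:
  assumes T: "T \<in> carrier (Aut M)"
  shows "AE x in M. rep (inv\<^bsub>Aut M\<^esub> T) (rep T x) = x" "AE x in M. rep T (rep (inv\<^bsub>Aut M\<^esub> T) x) = x"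
proof -
  note r = rep_mp_bij[OF T]
  show "AE x in M. rep (inv\<^bsub>Aut M\<^esub> T) (rep T x) = x"
    using AE_rep[OF T rep_inv_tinv[OF T]] by (rule AE_mp) (auto simp: tinv(2)[OF r])
  show "AE x in M. rep T (rep (inv\<^bsub>Aut M\<^esub> T) x) = x"
    using rep_inv_tinv[OF T] by (rule AE_mp) (auto simp: tinv(3)[OF r])
qed

text \<open>The images differ only inside the images of a null set, and measure-preserving
  bijections keep these null. Hence distances between images do not depend on the
  representative.\<close>

lemma sdist_AE_cong:
  assumes "s \<in> mp_bij M" "t \<in> mp_bij M" "AE x in M. s x = t x"
    and A: "A \<in> sets M" "B \<in> sets M"
  shows "sdist M (s ` A) B = sdist M (t ` A) B"
proof -
  have sm: "s ` A \<in> sets M" "t ` A \<in> sets M" using mp_bijD(3) assms A by auto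
  obtain N where N: "{x \<in> space M. s x \<noteq> t x} \<subseteq> N" "N \<in> sets M" "emeasure M N = 0"
    using assms(3) by (auto elim: AE_E)
  have sN: "s ` N \<in> null_sets M" "t ` N \<in> null_sets M"
    using mp_bijD(3,4)[OF assms(1) N(2)] mp_bijD(3,4)[OF assms(2) N(2)] N(3) by (auto intro: null_setsI)
  have Asp: "A \<subseteq> space M" using A sets.sets_into_space by blast
  have "x \<in> s ` A \<longleftrightarrow> x \<in> t ` A" if "x \<notin> s ` N" "x \<notin> t ` N" for x
  proof
    assume "x \<in> s ` A"
    then obtain a where "a \<in> A" "x = s a" by blast
    then show "x \<in> t ` A" using that N(1) Asp by (metis (mono_tags, lifting) image_eqI mem_Collect_eq subsetD)
  next
    assume "x \<in> t ` A"
    then obtain a where "a \<in> A" "x = t a" by blast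
    then show "x \<in> s ` A" using that N(1) Asp by (metis (mono_tags, lifting) image_eqI mem_Collect_eq subsetD)
  qed
  then have "AE x in M. x \<in> s ` A \<longleftrightarrow> x \<in> t ` A"
    using AE_not_in[OF sN(1)] AE_not_in[OF sN(2)] by (auto elim: eventually_elim2)
  then have "AE x in M. x \<in> sym_diff (s ` A) B \<longleftrightarrow> x \<in> sym_diff (t ` A) B"
    by eventually_elim auto
  then show ?thesis unfolding sdist_def by (rule measure_eq_AE) (use sm A in auto)
qed

lemma AE_notin_iff:
  assumes "A \<in> sets M" shows "(AE x in M. x \<notin> A) \<longleftrightarrow> emeasure M A = 0"
  using assms sets.sets_into_space[OF assms] by (subst AE_iff_measurable[of A]) auto

subsection \<open>Gluing\<close>

lemma piecewise_vimage:
  assumes "(\<Union>i. E i) = space M" "\<And>i x. x \<in> E i \<Longrightarrow> T x = f i x"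
  shows "T -` A \<inter> space M = (\<Union>i. E i \<inter> (f i -` A \<inter> space M))"
proof (intro equalityI subsetI)
  fix x assume x: "x \<in> T -` A \<inter> space M"
  then obtain i where i: "x \<in> E i" using assms(1) by blast
  then show "x \<in> (\<Union>i. E i \<inter> (f i -` A \<inter> space M))" using x assms(2)[OF i] by auto
qed (use assms(2) in auto)

text \<open>The inverse is glued from the inverses of the pieces along the partition of the range,
  so the estimate \<open>main\<close> applies to both maps; its bound on preimages is countable
  additivity over the pieces.\<close>

lemma glue_mp_bij:
  fixes E :: "'i::countable \<Rightarrow> 'a set"
  assumes f: "\<And>i. f i \<in> mp_bij M" and E: "\<And>i. E i \<in> sets M"
    and disj: "disjoint_family E" and un: "(\<Union>i. E i) = space M"
    and disj': "disjoint_family (\<lambda>i. f i ` E i)" and un': "(\<Union>i. f i ` E i) = space M"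
  obtains t where "t \<in> mp_bij M" "\<And>i x. x \<in> E i \<Longrightarrow> t x = f i x"
proof -
  have idx: "\<exists>T. \<forall>i. \<forall>x\<in>E' i. T x = g i x" if "disjoint_family E'" for E' :: "'i \<Rightarrow> 'a set" and g
  proof -
    have "g (THE i. x \<in> E' i) x = g i x" if "x \<in> E' i" for i x
    proof -
      have "(THE i. x \<in> E' i) = i"
        using that \<open>disjoint_family E'\<close> unfolding disjoint_family_on_def by (intro the_equality) auto
      then show ?thesis by simp
    qed
    then show ?thesis by (intro exI[of _ "\<lambda>x. g (THE i. x \<in> E' i) x"]) auto
  qed
  have fE: "f i ` E i \<in> sets M" for i by (rule mp_bijD(3)[OF f E])
  have Esp: "E i \<subseteq> space M" for i by (rule sets.sets_into_space[OF E])
  obtain T where T: "\<And>i x. x \<in> E i \<Longrightarrow> T x = f i x" using idx[OF disj, of f] by auto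
  obtain S where S: "\<And>i x. x \<in> f i ` E i \<Longrightarrow> S x = tinv M (f i) x"
    using idx[OF disj', of "\<lambda>i. tinv M (f i)"] by auto
  have ti: "tinv M (f i) ` f i ` E i = E i" for i
    using tinv(2)[OF f[of i]] Esp[of i] by (force simp: image_iff)
  have main: "U \<in> measurable M M \<and> (\<forall>A\<in>sets M. emeasure M (U -` A \<inter> space M) \<le> emeasure M A)"
    if g: "\<And>i. g i \<in> mp_bij M" and E': "\<And>i. E' i \<in> sets M" and d1: "disjoint_family E'"
      and d2: "disjoint_family (\<lambda>i. g i ` E' i)" and u1: "(\<Union>i. E' i) = space M"
      and u2: "(\<Union>i. g i ` E' i) = space M" and U: "\<And>i x. x \<in> E' i \<Longrightarrow> U x = g i x"
    for U g and E' :: "'i \<Rightarrow> 'a set"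
  proof -
    have v: "U -` A \<inter> space M = (\<Union>i. E' i \<inter> (g i -` A \<inter> space M))" for A
      by (rule piecewise_vimage[OF u1]) (rule U)
    have gm: "g i -` A \<inter> space M \<in> sets M" if "A \<in> sets M" for i A
      by (rule measurable_sets[OF mp_bijD(2)[OF g] that])
    have "U \<in> measurable M M"
    proof (rule measurableI)
      fix x assume "x \<in> space M"
      then obtain i where i: "x \<in> E' i" using u1 by blast
      then show "U x \<in> space M" using U[OF i] u2 by blast
    next
      fix A assume A: "A \<in> sets M"
      show "U -` A \<inter> space M \<in> sets M" unfolding v using gm[OF A] E'
        by (intro sets.countable_UN') auto
    qed
    moreover have "emeasure M (U -` A \<inter> space M) \<le> emeasure M A" if A: "A \<in> sets M" for A
    proof -
      let ?P = "\<lambda>i. E' i \<inter> (g i -` A \<inter> space M)"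
      have P: "?P i \<in> sets M" for i using gm[OF A, of i] E'[of i] by blast
      have gP: "g i ` ?P i = g i ` E' i \<inter> A" for i
        using sets.sets_into_space[OF E'[of i]] by auto
      have dP: "disjoint_family ?P" using d1 unfolding disjoint_family_on_def by blast
      have dgP: "disjoint_family (\<lambda>i. g i ` ?P i)" using d2 unfolding gP disjoint_family_on_def by blast
      have gPm: "g i ` ?P i \<in> sets M" for i by (rule mp_bijD(3)[OF g P])
      have "emeasure M (\<Union>i. ?P i) = (\<integral>\<^sup>+i. emeasure M (?P i) \<partial>count_space UNIV)"
        by (rule emeasure_UN_countable) (use P dP in auto)
      also have "\<dots> = (\<integral>\<^sup>+i. emeasure M (g i ` ?P i) \<partial>count_space UNIV)"
        by (intro nn_integral_cong) (simp only: mp_bijD(4)[OF g P])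
      also have "\<dots> = emeasure M (\<Union>i. g i ` ?P i)"
        by (rule emeasure_UN_countable[symmetric]) (use gPm dgP in auto)
      also have "\<dots> \<le> emeasure M A"
        by (rule emeasure_mono) (use A in \<open>auto\<close>)
      finally show ?thesis unfolding v .
    qed
    ultimately show ?thesis by blast
  qed
  have mT: "T \<in> measurable M M \<and> (\<forall>A\<in>sets M. emeasure M (T -` A \<inter> space M) \<le> emeasure M A)"
    by (rule main[OF f E disj disj' un un']) (rule T)
  have mS: "S \<in> measurable M M \<and> (\<forall>A\<in>sets M. emeasure M (S -` A \<inter> space M) \<le> emeasure M A)"
    by (rule main[of "\<lambda>i. tinv M (f i)" "\<lambda>i. f i ` E i"])
      (use tinv(1)[OF f] fE disj disj' un un' S in \<open>auto simp: ti\<close>)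
  have "restrict T (space M) \<in> mp_bij M"
  proof (rule mp_bijI)
    show "T \<in> measurable M M" "S \<in> measurable M M" using mT mS by auto
    show "emeasure M (T -` A \<inter> space M) \<le> emeasure M A" "emeasure M (S -` A \<inter> space M) \<le> emeasure M A"
      if "A \<in> sets M" for A using mT mS that by auto
    fix x assume x: "x \<in> space M"
    obtain i where i: "x \<in> E i" using un x by blast
    then show "S (T x) = x" using T[OF i] S[of "f i x" i] tinv(2)[OF f x] by auto
    obtain j where j: "x \<in> f j ` E j" using un' x by blast
    then obtain y where y: "y \<in> E j" "x = f j y" by blast
    then have "S x = y" using S[OF j] tinv(2)[OF f] Esp by auto
    then show "T (S x) = x" using T[OF y(1)] y by simp
  qed
  moreover have "restrict T (space M) x = f i x" if "x \<in> E i" for i x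
    using T[OF that] Esp that by auto
  ultimately show ?thesis by (rule that)
qed

section \<open>Ergodic full groups\<close>

context std_space
begin

abbreviation Aut_mult (infixl "\<odot>" 70) where "S \<odot> T \<equiv> S \<otimes>\<^bsub>Aut M\<^esub> T"

abbreviation Aut_inv ("ainv _" [81] 80) where "ainv T \<equiv> inv\<^bsub>Aut M\<^esub> T"

abbreviation Aut_one ("\<one>\<^sub>A") where "\<one>\<^sub>A \<equiv> \<one>\<^bsub>Aut M\<^esub>"

lemma positive_Int_lev:
  assumes A: "A \<in> sets M" "0 < emeasure M A"
  obtains k where "0 < emeasure M (A \<inter> lev k)"
proof -
  have "\<exists>k. emeasure M (A \<inter> lev k) \<noteq> 0"
  proof (rule ccontr)
    assume "\<not> ?thesis"
    then have "A \<inter> lev k \<in> null_sets M" for k using A(1) by auto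
    then have "(\<Union>k. A \<inter> lev k) \<in> null_sets M" by (rule null_sets_UN)
    moreover have "(\<Union>k. A \<inter> lev k) = A" using UN_lev sets.sets_into_space[OF A(1)] by blast
    ultimately show False using A(2) by auto
  qed
  then show ?thesis using that by (auto simp: zero_less_iff_neq_zero)
qed

lemma Int_lev_fmeasurable: "A \<in> sets M \<Longrightarrow> A \<inter> lev k \<in> fmeasurable M"
  using fmeasurable_Int_fmeasurable[of "lev k" M A] lev_finite_sets finite_setsD(2)
  by (simp add: Int_commute)

end

locale ergodic_full_group = std_space +
  fixes \<G> :: "('a \<Rightarrow> 'a) set set"
  assumes full: "full_group M \<G>" and erg: "ergodic_group M \<G>"

sublocale ergodic_full_group \<subseteq> Aut: group "Aut M"
  by (rule Aut_group)

sublocale ergodic_full_group \<subseteq> subgroup \<G> "Aut M"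
  using full unfolding full_group_def by blast

context ergodic_full_group
begin

text \<open>The maps \<open>f i\<close> are kept apart from the representatives of the
  \<open>S i\<close> because the partitions of domain and range must match exactly, while
  \<open>rep\<close> is determined only up to null sets. The inverse of a class, for instance, is
  represented by \<open>tinv\<close> only almost everywhere.\<close>

lemma glue:
  fixes E :: "'i::countable \<Rightarrow> 'a set"
  assumes S: "\<And>i. S i \<in> \<G>" and f: "\<And>i. f i \<in> mp_bij M" and Sf: "\<And>i. AE x in M. rep (S i) x = f i x"
    and E: "\<And>i. E i \<in> sets M"
    and disj: "disjoint_family E" and un: "(\<Union>i. E i) = space M"
    and disj': "disjoint_family (\<lambda>i. f i ` E i)" and un': "(\<Union>i. f i ` E i) = space M"
  obtains T where "T \<in> \<G>" "\<And>i. AE x in M. x \<in> E i \<longrightarrow> rep T x = f i x"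
proof -
  obtain t where t: "t \<in> mp_bij M" "\<And>i x. x \<in> E i \<Longrightarrow> t x = f i x"
    using glue_mp_bij[OF f E disj un disj' un'] by blast
  define T where "T = cls M t"
  have Tt: "AE x in M. rep T x = t x" unfolding T_def by (rule rep_cls[OF t(1)])
  \<comment> \<open>Numbers that code no index receive the empty piece, as fullness is stated for
    sequences of pieces.\<close>
  define A where "A n = (if n \<in> range (to_nat :: 'i \<Rightarrow> nat) then E (from_nat n) else {})" for n
  define R where "R n = S (from_nat n)" for n
  have A_to: "A (to_nat i) = E i" for i unfolding A_def by simp
  have A_cases: "A n = {} \<or> (\<exists>i. n = to_nat i \<and> A n = E i)" for n
    unfolding A_def by auto
  have "T \<in> \<G>"
  proof (rule full[unfolded full_group_def, THEN conjunct2, rule_format, of T A R])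
    show "T \<in> carrier (Aut M)" unfolding T_def by (rule cls_carrier[OF t(1)])
    have dA: "disjoint_family A"
      unfolding disjoint_family_on_def
    proof (intro ballI impI)
      fix m n :: nat assume "m \<noteq> n"
      then show "A m \<inter> A n = {}"
        using A_cases[of m] A_cases[of n] disj unfolding disjoint_family_on_def by (metis Int_empty_left Int_empty_right UNIV_I)
    qed
    have uA: "(\<Union>n. A n) = space M"
    proof (intro equalityI subsetI)
      fix x assume "x \<in> (\<Union>n. A n)"
      then obtain n where "x \<in> A n" by blast
      then show "x \<in> space M" using A_cases[of n] un by auto
    next
      fix x assume "x \<in> space M"
      then obtain i where "x \<in> E i" using un by blast
      then show "x \<in> (\<Union>n. A n)" using A_to[of i] by blast
    qed
    have aeA: "AE x in M. x \<in> A n \<longrightarrow> rep T x = rep (R n) x" for n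
    proof (cases "A n = {}")
      case False
      then obtain i where i: "n = to_nat i" "A n = E i" using A_cases[of n] by blast
      have "R n = S i" unfolding R_def i by simp
      then show ?thesis using Tt Sf[of i] t(2)[of _ i] i(2) by (auto elim: eventually_elim2)
    qed simp
    show "(\<forall>n. A n \<in> sets M) \<and> disjoint_family A \<and> (\<Union>n. A n) = space M \<and> (\<forall>n. R n \<in> \<G>) \<and>
        (\<forall>n. AE x in M. x \<in> A n \<longrightarrow> rep T x = rep (R n) x)"
      using dA uA aeA S E unfolding R_def A_def by auto
  qed
  moreover have "AE x in M. x \<in> E i \<longrightarrow> rep T x = f i x" for i
    using Tt by (rule AE_mp) (auto simp: t(2))
  ultimately show ?thesis by (rule that)
qed

lemma rep_mp: "T \<in> \<G> \<Longrightarrow> rep T \<in> mp_bij M"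
  using rep_mp_bij mem_carrier by blast

lemma rep_fmeasurable: "T \<in> \<G> \<Longrightarrow> E \<in> fmeasurable M \<Longrightarrow> rep T ` E \<in> fmeasurable M"
  by (rule fmeasurable_image_mp_bij[OF rep_mp])

text \<open>For each triple of indices an element carrying \<open>A i\<close> to within
  \<open>1 / (k + 1)\<close> of \<open>A j\<close> is chosen whenever there is one. The comparison
  of \<open>D n\<close> with \<open>T\<close> passes from \<open>E\<close> to \<open>A i\<close>,
  from there to \<open>A j\<close>, and back the same way: four errors, each below
  \<open>e / 4\<close>. One set at a time is approximated, which is the form used later.\<close>

lemma countable_weakly_dense:
  obtains D :: "nat \<Rightarrow> ('a \<Rightarrow> 'a) set" where "\<And>n. D n \<in> \<G>"
    "\<And>T E e. T \<in> \<G> \<Longrightarrow> E \<in> fmeasurable M \<Longrightarrow> e > 0 \<Longrightarrow> \<exists>n. sdist M (rep (D n) ` E) (rep T ` E) < e"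
proof -
  obtain A :: "nat \<Rightarrow> 'a set" where A: "\<And>n. A n \<in> fmeasurable M"
    "\<And>E e. E \<in> fmeasurable M \<Longrightarrow> e > 0 \<Longrightarrow> \<exists>n. sdist M E (A n) < e"
    using countable_dense_sets by metis
  define good where "good i j k T \<longleftrightarrow> T \<in> \<G> \<and> sdist M (rep T ` A i) (A j) < inverse (real (Suc k))" for i j k T
  \<comment> \<open>The identity is the default, so that every \<open>D n\<close> belongs to the
    group.\<close>
  define pick where "pick i j k = (if \<exists>T. good i j k T then SOME T. good i j k T else \<one>\<^sub>A)" for i j k
  have pick: "pick i j k \<in> \<G>" "good i j k T \<Longrightarrow> good i j k (pick i j k)" for i j k T
    unfolding pick_def using someI[of "good i j k"] one_closed by (auto simp: good_def)
  define D where "D n = (case prod_decode n of (i, m) \<Rightarrow> case prod_decode m of (j, k) \<Rightarrow> pick i j k)" for n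
  have D: "D (prod_encode (i, prod_encode (j, k))) = pick i j k" for i j k unfolding D_def by simp
  have "D n \<in> \<G>" for n unfolding D_def using pick(1) by (auto split: prod.split)
  moreover have "\<exists>n. sdist M (rep (D n) ` E) (rep T ` E) < e"
    if T: "T \<in> \<G>" and E: "E \<in> fmeasurable M" and e: "e > 0" for T E e
  proof -
    obtain k where k: "inverse (real (Suc k)) < e / 4" using reals_Archimedean[of "e / 4"] e by auto
    obtain i where i: "sdist M E (A i) < e / 4" using A(2)[OF E, of "e / 4"] e by auto
    obtain j where j: "sdist M (rep T ` A i) (A j) < inverse (real (Suc k))"
      using A(2)[OF rep_fmeasurable[OF T A(1)]] by (metis inverse_positive_iff_positive of_nat_0_less_iff zero_less_Suc)
    define P where "P = pick i j k"
    have P: "P \<in> \<G>" "sdist M (rep P ` A i) (A j) < inverse (real (Suc k))"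
      using pick(2)[of i j k T] T j unfolding P_def good_def by auto
    note fm = rep_fmeasurable[OF P(1) E] rep_fmeasurable[OF P(1) A(1)[of i]] A(1)[of j]
      rep_fmeasurable[OF T A(1)[of i]] rep_fmeasurable[OF T E]
    have "sdist M (rep P ` E) (rep T ` E) \<le> sdist M (rep P ` E) (rep P ` A i) + sdist M (rep P ` A i) (rep T ` E)"
      by (rule sdist_triangle) (use fm in auto)
    also have "sdist M (rep P ` A i) (rep T ` E) \<le> sdist M (rep P ` A i) (A j) + sdist M (A j) (rep T ` E)"
      by (rule sdist_triangle) (use fm in auto)
    also have "sdist M (A j) (rep T ` E) \<le> sdist M (A j) (rep T ` A i) + sdist M (rep T ` A i) (rep T ` E)"
      by (rule sdist_triangle) (use fm in auto)
    also have "sdist M (rep P ` E) (rep P ` A i) = sdist M E (A i)"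
      by (rule sdist_image[OF rep_mp[OF P(1)]]) (use E A in auto)
    also have "sdist M (rep T ` A i) (rep T ` E) = sdist M E (A i)"
      by (subst sdist_commute, rule sdist_image[OF rep_mp[OF T]]) (use E A in auto)
    also have "sdist M (A j) (rep T ` A i) = sdist M (rep T ` A i) (A j)" by (rule sdist_commute)
    finally have "sdist M (rep P ` E) (rep T ` E) < e" using i j k P(2) by linarith
    then show ?thesis using D[of i j k] unfolding P_def by metis
  qed
  ultimately show ?thesis by (rule that)
qed

text \<open>Otherwise the union \<open>B\<close> of the images of a finite-measure part of
  \<open>P\<close> under the sequence would miss \<open>Q\<close> up to a null set. Density makes
  \<open>B\<close> invariant under the whole group modulo null sets, ergodicity then makes it
  conull, and \<open>Q\<close> would be null.\<close>

lemma weakly_dense_hits: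
  fixes D :: "nat \<Rightarrow> ('a \<Rightarrow> 'a) set"
  assumes D: "\<And>n. D n \<in> \<G>"
    and dense: "\<And>T E e. T \<in> \<G> \<Longrightarrow> E \<in> fmeasurable M \<Longrightarrow> e > 0 \<Longrightarrow> \<exists>n. sdist M (rep (D n) ` E) (rep T ` E) < e"
    and P: "P \<in> sets M" "0 < emeasure M P" and Q: "Q \<in> sets M" "0 < emeasure M Q"
  shows "\<exists>n. 0 < emeasure M (rep (D n) ` P \<inter> Q)"
proof (rule ccontr)
  assume "\<not> ?thesis"
  then have z: "emeasure M (rep (D n) ` P \<inter> Q) = 0" for n by (auto simp: zero_less_iff_neq_zero)
  obtain k where k: "0 < emeasure M (P \<inter> lev k)" using positive_Int_lev[OF P] .
  define P' where "P' = P \<inter> lev k"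
  have P': "P' \<in> fmeasurable M" unfolding P'_def by (rule Int_lev_fmeasurable[OF P(1)])
  define B where "B = (\<Union>n. rep (D n) ` P')"
  have DP: "rep (D n) ` P' \<in> fmeasurable M" for n by (rule rep_fmeasurable[OF D P'])
  have B: "B \<in> sets M"
    unfolding B_def by (rule sets.countable_nat_UN) (use fmeasurableD[OF DP] in blast)
  \<comment> \<open>If the image of \<open>P'\<close> under \<open>r\<close> left \<open>B\<close>
    in positive measure, the image of \<open>P'\<close> under some \<open>rep (D n)\<close> would be
    closer to it than that measure, although it lies in \<open>B\<close>. The statement is about all
    maps equal to \<open>rep R\<close> almost everywhere so that it covers composites;
    \<open>c2\<close> has the same form to cover inverses.\<close>
  have c1: "emeasure M (r ` P' - B) = 0" if r: "r \<in> mp_bij M" and R: "R \<in> \<G>" "AE x in M. r x = rep R x" for r R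
  proof (rule ccontr)
    assume nz: "emeasure M (r ` P' - B) \<noteq> 0"
    have rf: "r ` P' \<in> fmeasurable M" by (rule fmeasurable_image_mp_bij[OF r P'])
    then have fm: "r ` P' - B \<in> fmeasurable M" using B by (rule fmeasurable_Diff)
    then have "0 < measure M (r ` P' - B)" using nz emeasure_eq_measure2[OF fm]
      by (metis ennreal_0 measure_nonneg order_le_less)
    then obtain n where n: "sdist M (rep (D n) ` P') (rep R ` P') < measure M (r ` P' - B)"
      using dense[OF R(1) P'] by blast
    have "sdist M (rep (D n) ` P') (rep R ` P') = sdist M (r ` P') (rep (D n) ` P')"
      using sdist_AE_cong[OF r rep_mp[OF R(1)] R(2) fmeasurableD[OF P'] fmeasurableD[OF DP[of n]]]
      by (simp add: sdist_commute)
    moreover have "measure M (r ` P' - B) \<le> sdist M (r ` P') (rep (D n) ` P')"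
      unfolding sdist_def
    proof (rule measure_mono_fmeasurable)
      show "r ` P' - B \<subseteq> sym_diff (r ` P') (rep (D n) ` P')" unfolding B_def by blast
      show "sym_diff (r ` P') (rep (D n) ` P') \<in> fmeasurable M"
        using rf DP by (intro fmeasurable.Un fmeasurable.Diff) auto
    qed (use fm in auto)
    ultimately show False using n by simp
  qed
  have c2: "emeasure M (r ` B - B) = 0" if r: "r \<in> mp_bij M" and R: "R \<in> \<G>" "AE x in M. r x = rep R x" for r R
  proof -
    have "r ` rep (D n) ` P' - B \<in> null_sets M" for n
    proof -
      let ?c = "compose (space M) r (rep (D n))"
      have cm: "?c \<in> mp_bij M" by (rule compose_mp_bij[OF r rep_mp[OF D]])
      have "?c ` P' = r ` rep (D n) ` P'"
        using sets.sets_into_space[OF fmeasurableD[OF P']] by (force simp: compose_def image_iff)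
      moreover have "AE x in M. ?c x = rep (R \<odot> D n) x"
      proof -
        have "AE x in M. r (rep (D n) x) = rep R (rep (D n) x)"
          by (rule AE_rep[OF mem_carrier[OF D] R(2)])
        then have "AE x in M. r (rep (D n) x) = rep (R \<odot> D n) x"
          using rep_mult[OF mem_carrier[OF R(1)] mem_carrier[OF D[of n]]] by eventually_elim simp
        then show ?thesis by (rule AE_mp) (auto simp: compose_def)
      qed
      ultimately have "emeasure M (r ` rep (D n) ` P' - B) = 0"
        using c1[OF cm m_closed[OF R(1) D[of n]]] by simp
      moreover have "r ` rep (D n) ` P' - B \<in> sets M"
        using mp_bijD(3)[OF r fmeasurableD[OF DP[of n]]] B by blast
      ultimately show ?thesis by (rule null_setsI)
    qed
    then have "(\<Union>n. r ` rep (D n) ` P' - B) \<in> null_sets M" by (rule null_sets_UN)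
    moreover have "(\<Union>n. r ` rep (D n) ` P' - B) = r ` B - B" unfolding B_def by blast
    ultimately show ?thesis by auto
  qed
  have "emeasure M B = 0 \<or> emeasure M (space M - B) = 0"
  proof (rule erg[unfolded ergodic_group_def, rule_format, OF B])
    fix T assume T: "T \<in> \<G>"
    let ?t = "rep T"
    note t = rep_mp[OF T]
    have 1: "emeasure M (?t ` B - B) = 0" using c2[OF t T] by simp
    have "AE x in M. tinv M ?t x = rep (ainv T) x"
      using rep_inv_tinv[OF mem_carrier[OF T]] by eventually_elim simp
    then have 2: "emeasure M (tinv M ?t ` B - B) = 0"
      using c2[OF tinv(1)[OF t] m_inv_closed[OF T]] by simp
    have Bsp: "B \<subseteq> space M" by (rule sets.sets_into_space[OF B])
    have "B - ?t ` B = ?t ` (tinv M ?t ` B - B)"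
    proof (intro equalityI subsetI)
      fix x assume x: "x \<in> B - ?t ` B"
      then have "x = ?t (tinv M ?t x)" using tinv(3)[OF t] Bsp by auto
      moreover from this have "tinv M ?t x \<notin> B" using x by auto
      ultimately show "x \<in> ?t ` (tinv M ?t ` B - B)" using x by blast
    next
      fix x assume "x \<in> ?t ` (tinv M ?t ` B - B)"
      then obtain b where b: "b \<in> B" "x = ?t (tinv M ?t b)" "tinv M ?t b \<notin> B" by blast
      then have xb: "x = b" using tinv(3)[OF t] Bsp by auto
      have "b \<notin> ?t ` B"
      proof
        assume "b \<in> ?t ` B"
        then obtain c where "c \<in> B" "b = ?t c" by blast
        then show False using tinv(2)[OF t] Bsp b(3) by auto
      qed
      then show "x \<in> B - ?t ` B" using xb b by blast
    qed
    then have 3: "emeasure M (B - ?t ` B) = 0"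
      using mp_bijD(4)[OF t, of "tinv M ?t ` B - B"] 2 mp_bijD(3)[OF tinv(1)[OF t] B] B by auto
    have "emeasure M (sym_diff (?t ` B) B) \<le> emeasure M (?t ` B - B) + emeasure M (B - ?t ` B)"
      using mp_bijD(3)[OF t B] B by (intro emeasure_subadditive) auto
    then show "emeasure M (sym_diff (?t ` B) B) = 0" using 1 3 by simp
  qed
  moreover have "0 < emeasure M B"
  proof -
    have "0 < emeasure M (rep (D 0) ` P')"
      using k mp_bijD(4)[OF rep_mp[OF D[of 0]] fmeasurableD[OF P']] unfolding P'_def by simp
    also have "\<dots> \<le> emeasure M B" by (rule emeasure_mono[OF _ B]) (auto simp: B_def)
    finally show ?thesis .
  qed
  ultimately have n1: "space M - B \<in> null_sets M" using B by auto
  have "rep (D n) ` P' \<inter> Q \<in> null_sets M" for n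
  proof -
    have m: "rep (D n) ` P \<inter> Q \<in> sets M" using mp_bijD(3)[OF rep_mp[OF D] P(1)] Q by blast
    have "emeasure M (rep (D n) ` P' \<inter> Q) \<le> emeasure M (rep (D n) ` P \<inter> Q)"
      by (rule emeasure_mono[OF _ m]) (auto simp: P'_def)
    then show ?thesis using z[of n] fmeasurableD[OF DP[of n]] Q by auto
  qed
  then have "(\<Union>n. rep (D n) ` P' \<inter> Q) \<in> null_sets M" by (rule null_sets_UN)
  then have n2: "(\<Union>n. rep (D n) ` P' \<inter> Q) \<union> (space M - B) \<in> null_sets M" using n1 by (rule null_sets.Un)
  have "Q \<subseteq> (\<Union>n. rep (D n) ` P' \<inter> Q) \<union> (space M - B)"
    using sets.sets_into_space[OF Q(1)] unfolding B_def by blast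
  then have "emeasure M Q \<le> emeasure M ((\<Union>n. rep (D n) ` P' \<inter> Q) \<union> (space M - B))"
    using n2 by (intro emeasure_mono) auto
  then show False using n2 Q(2) by auto
qed

text \<open>
  The pieces of \<open>P\<close> and \<open>Q\<close> matched so far are removed while running through a weakly dense
  sequence; no element of that sequence carries a nonnull part of what remains of \<open>P\<close> into what
  remains of \<open>Q\<close>, so one of the two remainders is null.
\<close>

lemma exchange:
  assumes P: "P \<in> fmeasurable M" and Q: "Q \<in> fmeasurable M" and PQ: "P \<inter> Q = {}"
    and le: "measure M P \<le> measure M Q"
  obtains T where "T \<in> \<G>" "AE x in M. x \<notin> P \<union> Q \<longrightarrow> rep T x = x" "AE x in M. x \<in> P \<longrightarrow> rep T x \<in> Q"
    "measure M P = measure M Q \<Longrightarrow> AE x in M. x \<in> Q \<longrightarrow> rep T x \<in> P"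
proof -
  obtain D :: "nat \<Rightarrow> ('a \<Rightarrow> 'a) set" where D: "\<And>n. D n \<in> \<G>"
    and dense: "\<And>T E e. T \<in> \<G> \<Longrightarrow> E \<in> fmeasurable M \<Longrightarrow> e > 0 \<Longrightarrow> \<exists>n. sdist M (rep (D n) ` E) (rep T ` E) < e"
    using countable_weakly_dense by metis
  define t where "t n = rep (D n)" for n
  have t: "t n \<in> mp_bij M" for n unfolding t_def by (rule rep_mp[OF D])
  \<comment> \<open>Both remainders are updated from the old pair: what \<open>t n\<close> can match
    is removed on the two sides at once.\<close>
  define rc where "rc = rec_nat (P, Q) (\<lambda>n pq. (fst pq - t n -` snd pq, snd pq - t n ` fst pq))"
  define p where "p n = fst (rc n)" for n
  define q where "q n = snd (rc n)" for n
  have p0: "p 0 = P" and q0: "q 0 = Q" and pS: "p (Suc n) = p n - t n -` q n" and qS: "q (Suc n) = q n - t n ` p n" for n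
    unfolding p_def q_def rc_def by auto
  have pq: "p n \<in> sets M \<and> q n \<in> sets M \<and> p n \<subseteq> P \<and> q n \<subseteq> Q" for n
  proof (induction n)
    case (Suc n)
    have "p n - t n -` q n = p n - (t n -` q n \<inter> space M)"
      using Suc.IH sets.sets_into_space by blast
    then have "p (Suc n) \<in> sets M" unfolding pS
      using Suc.IH measurable_sets[OF mp_bijD(2)[OF t]] by auto
    moreover have "q (Suc n) \<in> sets M" unfolding qS using Suc.IH mp_bijD(3)[OF t] by auto
    ultimately show ?case using Suc.IH unfolding pS qS by blast
  qed (use P Q p0 q0 in auto)
  have pm: "p n \<in> sets M" "p n \<subseteq> P" "p n \<subseteq> space M" and qm: "q n \<in> sets M" "q n \<subseteq> Q" "q n \<subseteq> space M" for n
    using pq[of n] sets.sets_into_space by auto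
  have pdec: "p n \<subseteq> p m" and qdec: "q n \<subseteq> q m" if "m \<le> n" for m n
    using that by (induction rule: dec_induct) (auto simp: pS qS)
  define a where "a n = p n \<inter> t n -` q n" for n
  define b where "b n = t n ` a n" for n
  have b_eq: "b n = q n \<inter> t n ` p n" for n unfolding b_def a_def by auto
  have am: "a n \<in> sets M" for n
  proof -
    have "a n = p n \<inter> (t n -` q n \<inter> space M)" unfolding a_def using pm(3)[of n] by blast
    then show ?thesis using pm(1) measurable_sets[OF mp_bijD(2)[OF t] qm(1)] by simp
  qed
  have bm: "b n \<in> sets M" for n unfolding b_def by (rule mp_bijD(3)[OF t am])
  have asub: "a n \<subseteq> P" "a n \<subseteq> space M" and bsub: "b n \<subseteq> Q" "b n \<subseteq> space M" for n
    using pm(2,3)[of n] qm(2,3)[of n] unfolding b_eq a_def by auto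
  have adis': "a m \<inter> a n = {}" and bdis': "b m \<inter> b n = {}" if "m < n" for m n
  proof -
    have "p n \<subseteq> p (Suc m)" "q n \<subseteq> q (Suc m)" using pdec[of "Suc m" n] qdec[of "Suc m" n] that by auto
    then show "a m \<inter> a n = {}" "b m \<inter> b n = {}" unfolding a_def b_eq pS qS by auto
  qed
  have adis: "a m \<inter> a n = {}" and bdis: "b m \<inter> b n = {}" if "m \<noteq> n" for m n
    using that adis'[of m n] adis'[of n m] bdis'[of m n] bdis'[of n m] by (cases m n rule: linorder_cases; auto)+
  have tib: "tinv M (t n) ` b n = a n" for n
    unfolding b_def using tinv(2)[OF t[of n]] asub(2)[of n] by (force simp: image_iff)
  define R where "R = space M - ((\<Union>n. a n) \<union> (\<Union>n. b n))"
  have Rm: "R \<in> sets M" unfolding R_def using am bm by auto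
  \<comment> \<open>The index \<open>None\<close> stands for the untouched part,
    \<open>Some (True, n)\<close> for the piece moved by \<open>t n\<close>, and
    \<open>Some (False, n)\<close> for its image, moved back. So the glued map is an involution up
    to null sets, and \<open>F\<close> lists the images of the pieces.\<close>
  define E where "E i = (case i of None \<Rightarrow> R | Some (c, n) \<Rightarrow> if c then a n else b n)" for i :: "(bool \<times> nat) option"
  define f where "f i = (case i of None \<Rightarrow> restrict (\<lambda>x. x) (space M) | Some (c, n) \<Rightarrow> if c then t n else tinv M (t n))"
    for i :: "(bool \<times> nat) option"
  define S where "S i = (case i of None \<Rightarrow> \<one>\<^sub>A | Some (c, n) \<Rightarrow> if c then D n else ainv (D n))"
    for i :: "(bool \<times> nat) option"
  define F where "F i = (case i of None \<Rightarrow> R | Some (c, n) \<Rightarrow> if c then b n else a n)" for i :: "(bool \<times> nat) option"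
  have fE: "f i ` E i = F i" for i
  proof (cases i)
    case None
    then show ?thesis unfolding f_def E_def F_def R_def by auto
  next
    case (Some cn)
    then show ?thesis unfolding f_def E_def F_def using tib by (auto simp: b_def split: prod.split)
  qed
  have ab: "a m \<inter> b n = {}" for m n using asub(1)[of m] bsub(1)[of n] PQ by blast
  have Ra: "R \<inter> a n = {}" and Rb: "R \<inter> b n = {}" for n unfolding R_def by auto
  have dE: "disjoint_family E" and dF: "disjoint_family F"
    unfolding disjoint_family_on_def E_def F_def
    using adis bdis ab Ra Rb by (auto split: option.splits if_splits simp: Int_commute)
  have Em: "E i \<in> sets M" for i unfolding E_def using am bm Rm by (auto split: option.split)
  have Fm: "F i \<in> sets M" for i unfolding F_def using am bm Rm by (auto split: option.split)
  have uE: "(\<Union>i. E i) = space M"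
  proof (intro equalityI subsetI)
    fix x assume "x \<in> (\<Union>i. E i)"
    then obtain i where "x \<in> E i" by blast
    then show "x \<in> space M" using sets.sets_into_space[OF Em[of i]] by blast
  next
    fix x assume x: "x \<in> space M"
    then consider "x \<in> R" | n where "x \<in> a n" | n where "x \<in> b n" unfolding R_def by blast
    then show "x \<in> (\<Union>i. E i)"
    proof cases
      case 1 then show ?thesis by (intro UN_I[of None]) (auto simp: E_def)
    next
      case (2 n) then show ?thesis by (intro UN_I[of "Some (True, n)"]) (auto simp: E_def)
    next
      case (3 n) then show ?thesis by (intro UN_I[of "Some (False, n)"]) (auto simp: E_def)
    qed
  qed
  have uF: "(\<Union>i. F i) = space M"
  proof (intro equalityI subsetI)
    fix x assume "x \<in> (\<Union>i. F i)"
    then obtain i where "x \<in> F i" by blast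
    then show "x \<in> space M" using sets.sets_into_space[OF Fm[of i]] by blast
  next
    fix x assume x: "x \<in> space M"
    then consider "x \<in> R" | n where "x \<in> a n" | n where "x \<in> b n" unfolding R_def by blast
    then show "x \<in> (\<Union>i. F i)"
    proof cases
      case 1 then show ?thesis by (intro UN_I[of None]) (auto simp: F_def)
    next
      case (2 n) then show ?thesis by (intro UN_I[of "Some (False, n)"]) (auto simp: F_def)
    next
      case (3 n) then show ?thesis by (intro UN_I[of "Some (True, n)"]) (auto simp: F_def)
    qed
  qed
  have Sm: "S i \<in> \<G>" for i
    unfolding S_def using D one_closed m_inv_closed by (auto split: option.split)
  have fm: "f i \<in> mp_bij M" for i
    unfolding f_def using t tinv(1)[OF t] id_mp_bij by (auto split: option.split)
  have Sf: "AE x in M. rep (S i) x = f i x" for i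
  proof (cases i)
    case None
    show ?thesis using rep_one[of M] unfolding None S_def f_def by (auto intro: AE_mp)
  next
    case (Some cn)
    obtain c n where cn: "cn = (c, n)" by (cases cn)
    show ?thesis using rep_inv_tinv[OF mem_carrier[OF D[of n]]]
      unfolding Some cn S_def f_def t_def by auto
  qed
  obtain T where T: "T \<in> \<G>" "\<And>i. AE x in M. x \<in> E i \<longrightarrow> rep T x = f i x"
    using glue[of S f E, OF Sm fm Sf Em dE uE] dF uF unfolding fE by blast
  have TR: "AE x in M. x \<in> R \<longrightarrow> rep T x = x"
    using T(2)[of None] unfolding E_def f_def by (auto intro: AE_mp)
  have Ta: "AE x in M. x \<in> a n \<longrightarrow> rep T x \<in> b n" for n
    using T(2)[of "Some (True, n)"] unfolding E_def f_def b_def by (auto intro: AE_mp)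
  have Tb: "AE x in M. x \<in> b n \<longrightarrow> rep T x \<in> a n" for n
    using T(2)[of "Some (False, n)"]
  proof (rule AE_mp, intro AE_I2 impI)
    fix x assume x: "x \<in> E (Some (False, n)) \<longrightarrow> rep T x = f (Some (False, n)) x" "x \<in> b n"
    then have "rep T x = tinv M (t n) x" unfolding E_def f_def by simp
    then show "rep T x \<in> a n" using tib[of n] x(2) by blast
  qed
  let ?U = "\<Union>n. a n" and ?V = "\<Union>n. b n"
  have UV: "?U \<in> sets M" "?V \<in> sets M" using am bm by auto
  have dja: "disjoint_family a" and djb: "disjoint_family b"
    using adis bdis unfolding disjoint_family_on_def by auto
  have "emeasure M ?U = (\<Sum>n. emeasure M (a n))"
    by (rule suminf_emeasure[symmetric, OF _ dja]) (use am in blast)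
  also have "\<dots> = (\<Sum>n. emeasure M (b n))"
    unfolding b_def using mp_bijD(4)[OF t am] by simp
  also have "\<dots> = emeasure M ?V" by (rule suminf_emeasure[OF _ djb]) (use bm in blast)
  finally have eUV: "measure M ?U = measure M ?V" unfolding measure_def by simp
  have rem: "emeasure M (P - ?U) = 0 \<or> emeasure M (Q - ?V) = 0"
  proof (rule ccontr)
    assume "\<not> ?thesis"
    then have "0 < emeasure M (P - ?U)" "0 < emeasure M (Q - ?V)" by (auto simp: zero_less_iff_neq_zero)
    moreover have "P - ?U \<in> sets M" "Q - ?V \<in> sets M" using P Q UV by auto
    ultimately obtain n where "0 < emeasure M (t n ` (P - ?U) \<inter> (Q - ?V))"
      using weakly_dense_hits[OF D dense, of "P - ?U" "Q - ?V"] unfolding t_def by blast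
    \<comment> \<open>A point of \<open>P\<close> surviving all stages and sent by
      \<open>t n\<close> to a survivor in \<open>Q\<close> would have been matched at stage
      \<open>n\<close>.\<close>
    moreover have "t n ` (P - ?U) \<inter> (Q - ?V) = {}"
    proof -
      have pi: "x \<in> p n" if "x \<in> P - ?U" for x n
        by (induction n) (use that in \<open>auto simp: p0 pS a_def\<close>)
      have qi: "x \<in> q n" if "x \<in> Q - ?V" for x n
        by (induction n) (use that in \<open>auto simp: q0 qS b_eq\<close>)
      have "t n x \<notin> Q - ?V" if x: "x \<in> P - ?U" for x
      proof
        assume "t n x \<in> Q - ?V"
        then have "t n x \<in> q n" using qi by blast
        then have "x \<in> a n" unfolding a_def using pi[OF x, of n] by blast
        then show False using x by blast
      qed
      then show ?thesis by blast
    qed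
    ultimately show False by simp
  qed
  have Ps: "?U \<subseteq> P" and Qs: "?V \<subseteq> Q" using asub(1) bsub(1) by auto
  have mP: "measure M (P - ?U) = measure M P - measure M ?U"
    using P UV Ps by (intro measurable_measure_Diff) auto
  have mQ: "measure M (Q - ?V) = measure M Q - measure M ?V"
    using Q UV Qs by (intro measurable_measure_Diff) auto
  have PUf: "P - ?U \<in> fmeasurable M" and QVf: "Q - ?V \<in> fmeasurable M"
    using P Q UV by (auto intro: fmeasurable_Diff)
  have eP: "emeasure M (P - ?U) = 0 \<longleftrightarrow> measure M (P - ?U) = 0"
    using emeasure_eq_measure2[OF PUf] by simp
  have eQ: "emeasure M (Q - ?V) = 0 \<longleftrightarrow> measure M (Q - ?V) = 0"
    using emeasure_eq_measure2[OF QVf] by simp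
  have nn: "0 \<le> measure M (P - ?U)" "0 \<le> measure M (Q - ?V)" by auto
  \<comment> \<open>The matched parts have equal measure; so if the remainder of \<open>Q\<close> is
    null, then \<open>measure M P \<le> measure M Q\<close> leaves nothing over in
    \<open>P\<close>.\<close>
  have P0: "emeasure M (P - ?U) = 0" using rem eP eQ mP mQ eUV le nn by linarith
  have Q0: "emeasure M (Q - ?V) = 0" if "measure M P = measure M Q" using that rem eP eQ mP mQ eUV by linarith
  show ?thesis
  proof (rule that[OF T(1)])
    show "AE x in M. x \<notin> P \<union> Q \<longrightarrow> rep T x = x"
      using TR
    proof (rule AE_mp, intro AE_I2 impI)
      fix x assume x: "x \<in> space M" "x \<in> R \<longrightarrow> rep T x = x" "x \<notin> P \<union> Q"
      have "x \<in> R" unfolding R_def using x(1,3) Ps Qs by blast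
      then show "rep T x = x" using x(2) by blast
    qed
    have "AE x in M. x \<notin> P - ?U" using P0 AE_notin_iff[OF fmeasurableD[OF PUf]] by blast
    moreover have "AE x in M. \<forall>n. x \<in> a n \<longrightarrow> rep T x \<in> b n" using Ta by (simp add: AE_all_countable)
    ultimately show "AE x in M. x \<in> P \<longrightarrow> rep T x \<in> Q"
      by eventually_elim (use Qs in blast)
    assume "measure M P = measure M Q"
    then have "AE x in M. x \<notin> Q - ?V" using Q0 AE_notin_iff[OF fmeasurableD[OF QVf]] by blast
    moreover have "AE x in M. \<forall>n. x \<in> b n \<longrightarrow> rep T x \<in> a n" using Tb by (simp add: AE_all_countable)
    ultimately show "AE x in M. x \<in> Q \<longrightarrow> rep T x \<in> P"
      by eventually_elim (use Ps in blast)
  qed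
qed

end

section \<open>The weak topology\<close>

lemma sdist_eq_2_measure_diff:
  assumes X: "X \<in> fmeasurable M" and Y: "Y \<in> fmeasurable M" and eq: "measure M X = measure M Y"
  shows "sdist M X Y = 2 * measure M (X - Y)"
proof -
  have d: "X - Y \<in> fmeasurable M" "Y - X \<in> fmeasurable M" "X \<inter> Y \<in> fmeasurable M"
    using X Y by (auto intro: fmeasurable_Diff fmeasurable_Int_fmeasurable)
  have "measure M (sym_diff X Y) = measure M (X - Y) + measure M (Y - X)"
    by (rule measure_Un_AE) (use d in auto)
  moreover have "measure M X = measure M (X - Y) + measure M (X \<inter> Y)"
    using measure_Un_AE[of "X - Y" "X \<inter> Y" M] d by (simp add: Un_Diff_Int)
  moreover have "measure M Y = measure M (Y - X) + measure M (X \<inter> Y)"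
    using measure_Un_AE[of "Y - X" "Y \<inter> X" M] d by (simp add: Un_Diff_Int Int_commute[of X])
  ultimately show ?thesis unfolding sdist_def using eq by simp
qed

context std_space
begin

text \<open>A point of the first image outside the second comes from a point where the maps differ.
  This is one half of the symmetric difference, and the other half has the same measure. So uniform
  closeness on \<open>A\<close> bounds the weak distance.\<close>

lemma sdist_image_le:
  assumes s: "s \<in> mp_bij M" and t: "t \<in> mp_bij M" and A: "A \<in> fmeasurable M"
  shows "sdist M (s ` A) (t ` A) \<le> 2 * measure M (A \<inter> {x \<in> space M. s x \<noteq> t x})"
proof -
  let ?E = "A \<inter> {x \<in> space M. s x \<noteq> t x}"
  have E: "?E \<in> fmeasurable M"
    using A sets_neq_fun[OF mp_bijD(2)[OF s] mp_bijD(2)[OF t]] by (intro fmeasurable_Int_fmeasurable)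
  have f: "s ` A \<in> fmeasurable M" "t ` A \<in> fmeasurable M" "s ` ?E \<in> fmeasurable M"
    using fmeasurable_image_mp_bij[OF s A] fmeasurable_image_mp_bij[OF t A] fmeasurable_image_mp_bij[OF s E] by auto
  have "sdist M (s ` A) (t ` A) = 2 * measure M (s ` A - t ` A)"
    by (rule sdist_eq_2_measure_diff[OF f(1,2)])
      (use measure_image_mp_bij[OF s] measure_image_mp_bij[OF t] A in auto)
  also have "measure M (s ` A - t ` A) \<le> measure M (s ` ?E)"
  proof (rule measure_mono_fmeasurable)
    show "s ` A - t ` A \<subseteq> s ` ?E" using sets.sets_into_space[OF fmeasurableD[OF A]] by force
  qed (use f in auto)
  also have "measure M (s ` ?E) = measure M ?E" by (rule measure_image_mp_bij[OF s fmeasurableD[OF E]])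
  finally show ?thesis by simp
qed

text \<open>Where the maps differ, some member of the separating sequence contains
  \<open>s x\<close> but not \<open>t x\<close>. Countably many such cases cover a nonnull set, so
  one of them occurs on a nonnull subset of \<open>C\<close>, which is then cut down to finite
  measure.\<close>

lemma displaced_subset:
  assumes s: "s \<in> mp_bij M" and t: "t \<in> mp_bij M" and C: "C \<in> sets M"
    and pos: "\<not> (AE x in M. x \<in> C \<longrightarrow> s x = t x)"
  obtains A where "A \<in> fmeasurable M" "A \<subseteq> C" "0 < emeasure M A" "s ` A \<inter> t ` A = {}"
proof -
  obtain B :: "nat \<Rightarrow> 'a set" where B: "range B \<subseteq> sets M"
    and sep: "\<And>x y. x \<in> space M \<Longrightarrow> y \<in> space M \<Longrightarrow> x \<noteq> y \<Longrightarrow> \<exists>n. x \<in> B n \<and> y \<notin> B n"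
    using countable_separating_generator by metis
  define E where "E n = C \<inter> (s -` B n \<inter> space M) - (t -` B n \<inter> space M)" for n
  have Bn: "B n \<in> sets M" for n using B by blast
  have E: "E n \<in> sets M" for n
    unfolding E_def using C measurable_sets[OF mp_bijD(2)[OF s] Bn] measurable_sets[OF mp_bijD(2)[OF t] Bn]
    by auto
  have "\<exists>n. 0 < emeasure M (E n)"
  proof (rule ccontr)
    assume "\<not> ?thesis"
    then have "E n \<in> null_sets M" for n using E by (auto simp: zero_less_iff_neq_zero)
    then have "(\<Union>n. E n) \<in> null_sets M" by (rule null_sets_UN)
    then have "AE x in M. x \<notin> (\<Union>n. E n)" by (rule AE_not_in)
    then have "AE x in M. x \<in> C \<longrightarrow> s x = t x"
    proof (rule AE_mp, intro AE_I2 impI)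
      fix x assume x: "x \<in> space M" "x \<notin> (\<Union>n. E n)" "x \<in> C"
      show "s x = t x"
      proof (rule ccontr)
        assume "s x \<noteq> t x"
        then obtain n where "s x \<in> B n" "t x \<notin> B n"
          using sep[of "s x" "t x"] mp_bij_maps(3)[OF s x(1)] mp_bij_maps(3)[OF t x(1)] by blast
        then show False using x unfolding E_def by blast
      qed
    qed
    then show False using pos by blast
  qed
  then obtain n where n: "0 < emeasure M (E n)" by blast
  obtain k where k: "0 < emeasure M (E n \<inter> lev k)" using positive_Int_lev[OF E n] .
  show ?thesis
  proof (rule that[OF Int_lev_fmeasurable[OF E] _ k])
    show "E n \<inter> lev k \<subseteq> C" unfolding E_def by blast
    show "s ` (E n \<inter> lev k) \<inter> t ` (E n \<inter> lev k) = {}" unfolding E_def by auto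
  qed
qed

text \<open>A displaced set is carried by \<open>S\<close> and \<open>T\<close> to disjoint sets of
  the same positive measure. This makes the weak topology Hausdorff.\<close>

lemma weak_separation:
  assumes S: "S \<in> carrier (Aut M)" and T: "T \<in> carrier (Aut M)" and ne: "S \<noteq> T"
  obtains A where "A \<in> fmeasurable M" "0 < sdist M (rep S ` A) (rep T ` A)"
proof -
  have "\<not> (AE x in M. x \<in> space M \<longrightarrow> rep S x = rep T x)"
  proof
    assume "AE x in M. x \<in> space M \<longrightarrow> rep S x = rep T x"
    then have "AE x in M. rep S x = rep T x" by (rule AE_mp) auto
    then show False using Aut_eqI[OF S T] ne by blast
  qed
  then obtain A where A: "A \<in> fmeasurable M" "0 < emeasure M A" "rep S ` A \<inter> rep T ` A = {}"
    using displaced_subset[OF rep_mp_bij[OF S] rep_mp_bij[OF T] sets.top] by metis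
  note f = fmeasurable_image_mp_bij[OF rep_mp_bij[OF S] A(1)] fmeasurable_image_mp_bij[OF rep_mp_bij[OF T] A(1)]
  have "sdist M (rep S ` A) (rep T ` A) = 2 * measure M (rep S ` A - rep T ` A)"
    by (rule sdist_eq_2_measure_diff[OF f])
      (use measure_image_mp_bij[OF rep_mp_bij[OF S]] measure_image_mp_bij[OF rep_mp_bij[OF T]] A in auto)
  also have "rep S ` A - rep T ` A = rep S ` A" using A(3) by blast
  also have "measure M (rep S ` A) = measure M A"
    by (rule measure_image_mp_bij[OF rep_mp_bij[OF S]]) (use A in auto)
  also have "0 < 2 * measure M A" using A(2) emeasure_eq_measure2[OF A(1)] by simp
  finally show ?thesis using A(1) that by blast
qed

text \<open>Atomlessness splits a set into two nonnull pieces; one of at most half the measure is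
  kept, and this is iterated.\<close>

lemma small_positive_set:
  assumes e: "e > 0"
  obtains B where "B \<in> fmeasurable M" "0 < measure M B" "measure M B \<le> e"
proof -
  have at: "atomless M" and inf: "emeasure M (space M) = \<infinity>"
    using std unfolding standard_sigma_finite_space_def by auto
  obtain k where k: "0 < emeasure M (space M \<inter> lev k)"
    using positive_Int_lev[OF sets.top] inf by auto
  define c where "c = measure M (space M \<inter> lev k)"
  have "\<exists>B. B \<in> fmeasurable M \<and> 0 < emeasure M B \<and> measure M B \<le> c / 2 ^ n" for n
  proof (induction n)
    case 0
    show ?case using k Int_lev_fmeasurable[OF sets.top] unfolding c_def by auto
  next
    case (Suc n)
    then obtain B where B: "B \<in> fmeasurable M" "0 < emeasure M B" "measure M B \<le> c / 2 ^ n" by blast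
    obtain B1 where B1: "B1 \<in> sets M" "B1 \<subseteq> B" "0 < emeasure M B1" "emeasure M B1 < emeasure M B"
      using at[unfolded atomless_def, rule_format, OF fmeasurableD[OF B(1)] B(2)] by blast
    have f1: "B1 \<in> fmeasurable M" using fmeasurableI2[OF B(1) B1(2,1)] .
    have f2: "B - B1 \<in> fmeasurable M" by (rule fmeasurable_Diff[OF B(1) B1(1)])
    have m: "measure M (B - B1) = measure M B - measure M B1"
      using B B1 by (intro measurable_measure_Diff) auto
    have lt: "measure M B1 < measure M B"
      using B1(4) unfolding emeasure_eq_measure2[OF f1] emeasure_eq_measure2[OF B(1)]
      by (simp add: ennreal_less_iff)
    have p2: "0 < emeasure M (B - B1)" using m lt unfolding emeasure_eq_measure2[OF f2] by simp
    show ?case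
    proof (cases "measure M B1 \<le> measure M B / 2")
      case True
      then have "measure M B1 \<le> c / 2 ^ Suc n" using B(3) by simp
      then show ?thesis using f1 B1(3) by (intro exI[of _ B1] conjI)
    next
      case False
      then have "measure M (B - B1) \<le> c / 2 ^ Suc n" using m B(3) by simp
      then show ?thesis using f2 p2 by (intro exI[of _ "B - B1"] conjI)
    qed
  qed
  moreover obtain n where "c / 2 ^ n < e"
  proof -
    have "(\<lambda>n. c / 2 ^ n) \<longlonglongrightarrow> 0" by (rule LIMSEQ_divide_realpow_zero) simp
    then have "\<forall>\<^sub>F n in sequentially. c / 2 ^ n < e" using e by (rule order_tendstoD(2))
    then show ?thesis using that by (auto simp: eventually_sequentially)
  qed
  ultimately obtain B where "B \<in> fmeasurable M" "0 < emeasure M B" "measure M B \<le> c / 2 ^ n" by blast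
  then show ?thesis using that[of B] \<open>c / 2 ^ n < e\<close> emeasure_eq_measure2[of B M] by auto
qed

lemma sdist_rep_mult:
  assumes S: "S \<in> carrier (Aut M)" and T: "T \<in> carrier (Aut M)" and A: "A \<in> sets M" and B: "B \<in> sets M"
  shows "sdist M (rep (S \<odot> T) ` A) B = sdist M (rep S ` rep T ` A) B"
proof -
  interpret Aut: group "Aut M" by (rule Aut_group)
  let ?c = "compose (space M) (rep S) (rep T)"
  have c: "?c \<in> mp_bij M" by (rule compose_mp_bij[OF rep_mp_bij[OF S] rep_mp_bij[OF T]])
  have "AE x in M. rep (S \<odot> T) x = ?c x"
    using rep_mult[OF S T] by (rule AE_mp) (auto simp: compose_def)
  then have "sdist M (rep (S \<odot> T) ` A) B = sdist M (?c ` A) B"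
    using sdist_AE_cong[OF rep_mp_bij c _ A B] Aut.m_closed[OF S T] by blast
  also have "?c ` A = rep S ` rep T ` A"
    using sets.sets_into_space[OF A] by (force simp: compose_def image_iff)
  finally show ?thesis .
qed

lemma sdist_rep_inv_mult:
  assumes S: "S \<in> carrier (Aut M)" and T: "T \<in> carrier (Aut M)" and A: "A \<in> sets M"
  shows "sdist M (rep (ainv S \<odot> T) ` A) A = sdist M (rep T ` A) (rep S ` A)"
proof -
  interpret Aut: group "Aut M" by (rule Aut_group)
  let ?V = "ainv S \<odot> T"
  have V: "?V \<in> carrier (Aut M)" using S T by simp
  have VA: "rep ?V ` A \<in> sets M" by (rule mp_bijD(3)[OF rep_mp_bij[OF V] A])
  have SA: "rep S ` A \<in> sets M" by (rule mp_bijD(3)[OF rep_mp_bij[OF S] A])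
  have "sdist M (rep ?V ` A) A = sdist M (rep S ` rep ?V ` A) (rep S ` A)"
    by (rule sdist_image[symmetric, OF rep_mp_bij[OF S] VA A])
  also have "\<dots> = sdist M (rep (S \<odot> ?V) ` A) (rep S ` A)"
    by (rule sdist_rep_mult[symmetric, OF S V A SA])
  also have "S \<odot> ?V = T" using S T by (simp add: Aut.m_assoc[symmetric])
  finally show ?thesis .
qed

end

section \<open>Supports, stabilisers, and products that nearly preserve a set\<close>

context ergodic_full_group
begin

text \<open>\<open>setstab A\<close> is the stabiliser of \<open>A\<close> when \<open>A\<close> has finite measure.\<close>

definition supported :: "'a set \<Rightarrow> ('a \<Rightarrow> 'a) set set" where
  "supported A = {T \<in> \<G>. AE x in M. x \<notin> A \<longrightarrow> rep T x = x}"

definition setstab :: "'a set \<Rightarrow> ('a \<Rightarrow> 'a) set set" where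
  "setstab A = {T \<in> \<G>. AE x in M. x \<in> A \<longrightarrow> rep T x \<in> A}"

lemma supported_mono: "A \<subseteq> B \<Longrightarrow> supported A \<subseteq> supported B"
  unfolding supported_def by (auto elim: eventually_mono)

lemma one_supported: "\<one>\<^sub>A \<in> supported A"
  unfolding supported_def using rep_one[of M] one_closed by (auto elim: eventually_mono)

lemma supported_inv: "T \<in> supported A \<Longrightarrow> ainv T \<in> supported A"
proof -
  assume "T \<in> supported A"
  then have T: "T \<in> \<G>" "AE x in M. x \<notin> A \<longrightarrow> rep T x = x" unfolding supported_def by auto
  have "AE x in M. x \<notin> A \<longrightarrow> rep (ainv T) x = x"
    using T(2) rep_inv(1)[OF mem_carrier[OF T(1)]] by eventually_elim (metis)
  then show ?thesis unfolding supported_def using T(1) by simp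
qed

lemma supported_preserves:
  assumes T: "T \<in> supported A" shows "AE x in M. x \<in> A \<longrightarrow> rep T x \<in> A"
proof -
  have T': "T \<in> \<G>" "AE x in M. x \<notin> A \<longrightarrow> rep T x = x" using T unfolding supported_def by auto
  note c = mem_carrier[OF T'(1)]
  from AE_rep[OF c T'(2)] rep_inv(1)[OF c] AE_rep[OF c rep_inv(1)[OF c]] show ?thesis
    by eventually_elim metis
qed

lemma conj_supported:
  assumes g: "g \<in> \<G>" "AE x in M. x \<in> A \<longrightarrow> rep g x \<in> B" and s: "s \<in> supported A"
  shows "g \<odot> s \<odot> ainv g \<in> supported B"
proof -
  have s': "s \<in> \<G>" "AE x in M. x \<notin> A \<longrightarrow> rep s x = x" using s unfolding supported_def by auto
  note cg = mem_carrier[OF g(1)] and cs = mem_carrier[OF s'(1)]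
  have ci: "ainv g \<in> carrier (Aut M)" using cg by simp
  have cgs: "g \<odot> s \<in> carrier (Aut M)" using cg cs by simp
  have "AE x in M. x \<notin> B \<longrightarrow> rep (g \<odot> s \<odot> ainv g) x = x"
    using rep_mult[OF cgs ci] AE_rep[OF ci rep_mult[OF cg cs]] AE_rep[OF ci g(2)]
      AE_rep[OF ci s'(2)] rep_inv(2)[OF cg]
    by eventually_elim metis
  then show ?thesis unfolding supported_def using g(1) s'(1) by simp
qed

text \<open>Atomlessness cuts a finite-measure part of \<open>C\<close> into two nonnull pieces, and
  \<open>exchange\<close> carries the one that is not larger into the other.\<close>

lemma nontrivial_supported:
  assumes C: "C \<in> sets M" "0 < emeasure M C"
  obtains T where "T \<in> supported C" "\<not> (AE x in M. rep T x = x)"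
proof -
  obtain k where k: "0 < emeasure M (C \<inter> lev k)" using positive_Int_lev[OF C] .
  define C' where "C' = C \<inter> lev k"
  have C': "C' \<in> fmeasurable M" "0 < emeasure M C'" "C' \<subseteq> C"
    using k Int_lev_fmeasurable[OF C(1)] unfolding C'_def by auto
  have "atomless M" using std unfolding standard_sigma_finite_space_def by auto
  then obtain B where B: "B \<in> sets M" "B \<subseteq> C'" "0 < emeasure M B" "emeasure M B < emeasure M C'"
    unfolding atomless_def using C' fmeasurableD by metis
  have f1: "B \<in> fmeasurable M" using fmeasurableI2[OF C'(1) B(2,1)] .
  have f2: "C' - B \<in> fmeasurable M" by (rule fmeasurable_Diff[OF C'(1) B(1)])
  have p2: "0 < emeasure M (C' - B)"
    using emeasure_Diff[of M B C'] B C'(1) f1 by (auto simp: diff_gr0_ennreal fmeasurableD2)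
  have main: "\<exists>T. T \<in> supported C \<and> \<not> (AE x in M. rep T x = x)"
    if PQ: "P \<in> fmeasurable M" "Q \<in> fmeasurable M" "P \<inter> Q = {}" "measure M P \<le> measure M Q"
      and sub: "P \<subseteq> C'" "Q \<subseteq> C'" and pos: "0 < emeasure M P" for P Q
  proof -
    obtain T where T: "T \<in> \<G>" "AE x in M. x \<notin> P \<union> Q \<longrightarrow> rep T x = x" "AE x in M. x \<in> P \<longrightarrow> rep T x \<in> Q"
      by (rule exchange[OF PQ]) (rule that)
    have "T \<in> supported C" unfolding supported_def
      using T(1,2) sub C'(3) by (auto elim: eventually_mono)
    moreover have "\<not> (AE x in M. rep T x = x)"
    proof
      assume "AE x in M. rep T x = x"
      with T(3) have "AE x in M. x \<notin> P" by eventually_elim (use PQ(3) in auto)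
      then show False using AE_notin_iff[OF fmeasurableD[OF PQ(1)]] pos by auto
    qed
    ultimately show ?thesis by blast
  qed
  have "\<exists>T. T \<in> supported C \<and> \<not> (AE x in M. rep T x = x)"
  proof (cases "measure M B \<le> measure M (C' - B)")
    case True
    show ?thesis by (rule main[of B "C' - B"]) (use f1 f2 True B in auto)
  next
    case False
    show ?thesis by (rule main[of "C' - B" B]) (use f1 f2 False B p2 in auto)
  qed
  then show ?thesis using that by blast
qed

text \<open>If \<open>T\<close> moves points outside \<open>A\<close>, some nonnull \<open>C\<close>
  outside \<open>A\<close> is disjoint from its image under \<open>T\<close>. For \<open>S\<close>
  nontrivial and supported in \<open>C\<close>, commuting gives
  \<open>T (S x) = S (T x) = T x\<close> for almost all \<open>x\<close> in \<open>C\<close>, which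
  makes \<open>S\<close> trivial after all. The gain is a purely algebraic description of the
  support.\<close>

lemma supported_eq_centralizer:
  assumes A: "A \<in> sets M"
  shows "supported A = {T \<in> \<G>. \<forall>S\<in>supported (space M - A). T \<odot> S = S \<odot> T}"
proof (intro equalityI subsetI)
  fix T assume T: "T \<in> supported A"
  then have T': "T \<in> \<G>" "AE x in M. x \<notin> A \<longrightarrow> rep T x = x" unfolding supported_def by auto
  have "T \<odot> S = S \<odot> T" if S: "S \<in> supported (space M - A)" for S
  proof -
    have S': "S \<in> \<G>" "AE x in M. x \<notin> space M - A \<longrightarrow> rep S x = x" using S unfolding supported_def by auto
    note cT = mem_carrier[OF T'(1)] and cS = mem_carrier[OF S'(1)]
    have sp: "AE x in M. x \<in> space M" by simp
    have "AE x in M. rep (T \<odot> S) x = rep (S \<odot> T) x"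
      using rep_mult[OF cT cS] rep_mult[OF cS cT] T'(2) S'(2) AE_rep[OF cT S'(2)] AE_rep[OF cS T'(2)]
        supported_preserves[OF T] supported_preserves[OF S] sp
      by eventually_elim auto
    then show ?thesis using Aut_eqI cT cS Aut.m_closed by blast
  qed
  then show "T \<in> {T \<in> \<G>. \<forall>S\<in>supported (space M - A). T \<odot> S = S \<odot> T}" using T' by blast
next
  fix T assume "T \<in> {T \<in> \<G>. \<forall>S\<in>supported (space M - A). T \<odot> S = S \<odot> T}"
  then have T: "T \<in> \<G>" and com: "\<And>S. S \<in> supported (space M - A) \<Longrightarrow> T \<odot> S = S \<odot> T" by auto
  note cT = mem_carrier[OF T]
  show "T \<in> supported A"
  proof (rule ccontr)
    assume "T \<notin> supported A"
    then have "\<not> (AE x in M. x \<notin> A \<longrightarrow> rep T x = x)" using T unfolding supported_def by blast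
    then have "\<not> (AE x in M. x \<in> space M - A \<longrightarrow> rep T x = (\<lambda>x\<in>space M. x) x)"
      by (rule contrapos_nn) (rule AE_mp, assumption, auto)
    then obtain C where C: "C \<in> fmeasurable M" "C \<subseteq> space M - A" "0 < emeasure M C"
      and dis: "rep T ` C \<inter> (\<lambda>x\<in>space M. x) ` C = {}"
      using displaced_subset[OF rep_mp[OF T] id_mp_bij, of "space M - A"] A by blast
    have "(\<lambda>x\<in>space M. x) ` C = C" using C(2) by force
    then have dis': "\<And>x. x \<in> C \<Longrightarrow> rep T x \<notin> C" using dis by blast
    obtain S where S: "S \<in> supported C" "\<not> (AE x in M. rep S x = x)"
      using nontrivial_supported[OF fmeasurableD[OF C(1)] C(3)] .
    have S': "S \<in> \<G>" "AE x in M. x \<notin> C \<longrightarrow> rep S x = x" using S(1) unfolding supported_def by auto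
    note cS = mem_carrier[OF S'(1)]
    have eq: "T \<odot> S = S \<odot> T" using com S(1) supported_mono[OF C(2)] by blast
    have "AE x in M. rep S x = x"
      using rep_mult[OF cT cS] rep_mult[OF cS cT] AE_rep[OF cT S'(2)] S'(2) rep_inv(1)[OF cT]
        AE_rep[OF cS rep_inv(1)[OF cT]]
    proof eventually_elim
      case (elim x)
      show ?case
      proof (cases "x \<in> C")
        case True
        then have "rep S (rep T x) = rep T x" using elim(3) dis' by blast
        then have "rep T (rep S x) = rep T x" using elim(1,2) eq by simp
        then show ?thesis using elim(5,6) by simp
      qed (use elim in blast)
    qed
    then show False using S(2) by blast
  qed
qed

text \<open>A nonnull part of \<open>A\<close> carried outside \<open>A\<close> supports a
  nontrivial \<open>S\<close>, whose conjugate by \<open>T\<close> then moves points outside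
  \<open>A\<close>. In this form closedness passes from \<open>supported A\<close> to the
  stabiliser.\<close>

lemma setstab_eq:
  assumes A: "A \<in> sets M"
  shows "setstab A = {T \<in> \<G>. \<forall>S\<in>supported A. T \<odot> S \<odot> ainv T \<in> supported A}"
proof (intro equalityI subsetI)
  fix T assume "T \<in> setstab A"
  then have T: "T \<in> \<G>" "AE x in M. x \<in> A \<longrightarrow> rep T x \<in> A" unfolding setstab_def by auto
  show "T \<in> {T \<in> \<G>. \<forall>S\<in>supported A. T \<odot> S \<odot> ainv T \<in> supported A}"
    using conj_supported[OF T] T(1) by blast
next
  fix T assume "T \<in> {T \<in> \<G>. \<forall>S\<in>supported A. T \<odot> S \<odot> ainv T \<in> supported A}"
  then have T: "T \<in> \<G>" and cj: "\<And>S. S \<in> supported A \<Longrightarrow> T \<odot> S \<odot> ainv T \<in> supported A" by auto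
  note cT = mem_carrier[OF T]
  have ci: "ainv T \<in> carrier (Aut M)" using cT by simp
  define C where "C = A - (rep T -` A \<inter> space M)"
  have C: "C \<in> sets M" unfolding C_def using A measurable_sets[OF mp_bijD(2)[OF rep_mp[OF T]] A] by blast
  have nC: "emeasure M C = 0"
  proof (rule ccontr)
    assume "emeasure M C \<noteq> 0"
    then obtain S where S: "S \<in> supported C" "\<not> (AE x in M. rep S x = x)"
      using nontrivial_supported[OF C] by (auto simp: zero_less_iff_neq_zero)
    have S': "S \<in> \<G>" "AE x in M. x \<notin> C \<longrightarrow> rep S x = x" using S(1) unfolding supported_def by auto
    note cS = mem_carrier[OF S'(1)]
    have cTS: "T \<odot> S \<in> carrier (Aut M)" using cT cS by simp
    have "S \<in> supported A" using S(1) supported_mono[of C A] unfolding C_def by blast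
    then have R: "AE x in M. x \<notin> A \<longrightarrow> rep (T \<odot> S \<odot> ainv T) x = x"
      using cj unfolding supported_def by blast
    have nA: "AE x in M. x \<in> C \<longrightarrow> rep T x \<notin> A" by (rule AE_I2) (auto simp: C_def)
    have "AE x in M. rep S x = x"
      using AE_rep[OF cT R] AE_rep[OF cT rep_mult[OF cTS ci]] nA S'(2) rep_mult[OF cT cS] rep_inv(1)[OF cT]
        AE_rep[OF cS rep_inv(1)[OF cT]]
    proof eventually_elim
      case (elim x)
      show ?case
      proof (cases "x \<in> C")
        case True
        then have "rep T (rep S x) = rep T x" using elim by simp
        then show ?thesis using elim(6,7) by simp
      qed (use elim in blast)
    qed
    then show False using S(2) by blast
  qed
  then have "AE x in M. x \<notin> C" using AE_notin_iff[OF C] by blast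
  then have "AE x in M. x \<in> A \<longrightarrow> rep T x \<in> A" by (rule AE_mp) (auto simp: C_def)
  then show "T \<in> setstab A" using T unfolding setstab_def by blast
qed

text \<open>\<open>setstab A\<close> asks for an inclusion up to a null set; between sets of equal
  finite measure this is equality up to a null set.\<close>

lemma sdist_setstab:
  assumes A: "A \<in> fmeasurable M" and T: "T \<in> setstab A"
  shows "sdist M (rep T ` A) A = 0"
proof -
  have T': "T \<in> \<G>" "AE x in M. x \<in> A \<longrightarrow> rep T x \<in> A" using T unfolding setstab_def by auto
  note cT = mem_carrier[OF T'(1)]
  have TA: "rep T ` A \<in> fmeasurable M" by (rule rep_fmeasurable[OF T'(1) A])
  have ci: "ainv T \<in> carrier (Aut M)" using cT by simp
  have "AE x in M. x \<notin> rep T ` A - A"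
    using AE_rep[OF ci T'(2)] rep_inv(2)[OF cT] AE_rep[OF ci rep_inv(1)[OF cT]] rep_inv_tinv[OF cT]
  proof (eventually_elim, goal_cases)
    case (1 x)
    show ?case
    proof
      assume x: "x \<in> rep T ` A - A"
      then obtain a where a: "a \<in> A" "x = rep T a" by blast
      have "a \<in> space M" using a(1) sets.sets_into_space[OF fmeasurableD[OF A]] by blast
      then have "tinv M (rep T) x = a" using tinv(2)[OF rep_mp[OF T'(1)]] a(2) by simp
      then show False using 1 a x by auto
    qed
  qed
  then have "emeasure M (rep T ` A - A) = 0"
    using AE_notin_iff[of "rep T ` A - A" M] TA A by auto
  then have "measure M (rep T ` A - A) = 0" unfolding measure_def by simp
  then show ?thesis
    using sdist_eq_2_measure_diff[OF TA A] measure_image_mp_bij[OF rep_mp[OF T'(1)], of A] A by auto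
qed

abbreviation GG :: "('a \<Rightarrow> 'a) set monoid" where "GG \<equiv> Aut M\<lparr>carrier := \<G>\<rparr>"

lemma inv_GG: "x \<in> \<G> \<Longrightarrow> inv\<^bsub>GG\<^esub> x = ainv x"
  by (rule Aut.m_inv_consistent[OF subgroup_axioms])

text \<open>Only \<open>K - B\<close> has to be moved, into \<open>B - K\<close>: removing the
  common part keeps the inequality and provides the disjointness that \<open>exchange\<close> asks
  for.\<close>

lemma absorb_small_support:
  assumes K: "K \<in> fmeasurable M" and B: "B \<in> fmeasurable M" and le: "measure M K \<le> measure M B"
  obtains g where "g \<in> \<G>" "AE x in M. x \<in> K \<longrightarrow> rep g x \<in> B"
proof -
  have i: "K \<inter> B \<in> fmeasurable M" using K B by (auto intro: fmeasurable_Int_fmeasurable)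
  have f: "K - B \<in> fmeasurable M" "B - K \<in> fmeasurable M" using K B by (auto intro: fmeasurable_Diff)
  have "measure M (K - B) = measure M K - measure M (K \<inter> B)"
    using measurable_measure_Diff[OF K fmeasurableD[OF i]] by (simp add: Diff_Int)
  moreover have "measure M (B - K) = measure M B - measure M (K \<inter> B)"
    using measurable_measure_Diff[OF B fmeasurableD[OF i]] by (simp add: Diff_Int)
  ultimately have le': "measure M (K - B) \<le> measure M (B - K)" using le by simp
  have dj: "(K - B) \<inter> (B - K) = {}" by blast
  obtain g where g: "g \<in> \<G>" "AE x in M. x \<notin> (K - B) \<union> (B - K) \<longrightarrow> rep g x = x"
    "AE x in M. x \<in> K - B \<longrightarrow> rep g x \<in> B - K"
    by (rule exchange[OF f dj le']) (rule that)
  have "AE x in M. x \<in> K \<longrightarrow> rep g x \<in> B"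
    using g(2,3)
  proof eventually_elim
    case (elim x)
    show ?case using elim by (cases "x \<in> B") auto
  qed
  with g(1) show ?thesis by (rule that)
qed

text \<open>The halves \<open>P\<close> and \<open>Q\<close> of the symmetric difference have equal
  measure. An \<open>S\<close> carrying \<open>P\<close> into \<open>Q\<close> corrects
  \<open>R\<close>: the product \<open>S \<odot> R\<close> stabilises \<open>A\<close>, and the
  inverse of \<open>S\<close> is supported in \<open>P \<union> Q\<close>. That set is no larger
  than \<open>B\<close>, so conjugation by some \<open>g\<close> brings the support into
  \<open>B\<close>.\<close>

lemma mem_product_if_sdist_le:
  assumes A: "A \<in> fmeasurable M" and B: "B \<in> fmeasurable M" and R: "R \<in> \<G>"
    and le: "sdist M (rep R ` A) A \<le> measure M B"
  obtains g s u where "g \<in> \<G>" "s \<in> supported B" "u \<in> setstab A"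
    "R = g \<odot> s \<odot> ainv g \<odot> u"
proof -
  note cR = mem_carrier[OF R]
  have RA: "rep R ` A \<in> fmeasurable M" by (rule rep_fmeasurable[OF R A])
  define P where "P = rep R ` A - A"
  define Q where "Q = A - rep R ` A"
  have PQ: "P \<in> fmeasurable M" "Q \<in> fmeasurable M" "P \<inter> Q = {}"
    unfolding P_def Q_def using RA A by (auto intro: fmeasurable_Diff)
  have mRA: "measure M (rep R ` A) = measure M A" by (rule measure_image_mp_bij[OF rep_mp[OF R]]) (use A in auto)
  have "2 * measure M P = 2 * measure M Q"
    using sdist_eq_2_measure_diff[OF RA A mRA] sdist_eq_2_measure_diff[OF A RA mRA[symmetric]]
      sdist_commute[of M A "rep R ` A"] unfolding P_def Q_def by simp
  then have eq: "measure M P = measure M Q" by simp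
  then have le_PQ: "measure M P \<le> measure M Q" by simp
  obtain S where S: "S \<in> \<G>" "AE x in M. x \<notin> P \<union> Q \<longrightarrow> rep S x = x" "AE x in M. x \<in> P \<longrightarrow> rep S x \<in> Q"
    by (rule exchange[OF PQ le_PQ]) (rule that)
  note cS = mem_carrier[OF S(1)]
  define u where "u = S \<odot> R"
  have u: "u \<in> setstab A"
  proof -
    have "AE x in M. x \<in> space M" by simp
    then have "AE x in M. x \<in> A \<longrightarrow> rep u x \<in> A"
      using rep_mult[OF cS cR] AE_rep[OF cR S(2)] AE_rep[OF cR S(3)] unfolding u_def
    proof eventually_elim
      case (elim x)
      show ?case
      proof
        assume x: "x \<in> A"
        then have "rep R x \<notin> Q" unfolding Q_def by blast
        show "rep (S \<odot> R) x \<in> A"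
        proof (cases "rep R x \<in> A")
          case True
          then have "rep R x \<notin> P \<union> Q" using \<open>rep R x \<notin> Q\<close> unfolding P_def by blast
          then show ?thesis using elim True by simp
        next
          case False
          then have "rep R x \<in> P" using x unfolding P_def by blast
          then show ?thesis using elim unfolding Q_def by auto
        qed
      qed
    qed
    then show ?thesis using S(1) R unfolding setstab_def u_def by simp
  qed
  have SPQ: "ainv S \<in> supported (P \<union> Q)"
    by (rule supported_inv) (use S in \<open>simp add: supported_def\<close>)
  have PQf: "P \<union> Q \<in> fmeasurable M" using PQ by (auto intro: fmeasurable.Un)
  have "measure M (P \<union> Q) \<le> measure M B"
    using le unfolding sdist_def P_def Q_def by simp
  then obtain g where g: "g \<in> \<G>" "AE x in M. x \<in> P \<union> Q \<longrightarrow> rep g x \<in> B"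
    using absorb_small_support[OF PQf B] by blast
  note cg = mem_carrier[OF g(1)]
  define s where "s = g \<odot> ainv S \<odot> ainv g"
  have s: "s \<in> supported B" unfolding s_def by (rule conj_supported[OF g SPQ])
  have c: "x \<odot> (ainv x \<odot> y) = y" "ainv x \<odot> (x \<odot> y) = y"
    if "x \<in> carrier (Aut M)" "y \<in> carrier (Aut M)" for x y
    using that by (simp_all add: Aut.m_assoc[symmetric])
  \<comment> \<open>The conjugator in the conclusion is the inverse of \<open>g\<close>, since
    \<open>g\<close> brings the support into \<open>B\<close> and the product has to bring it
    back.\<close>
  have "ainv g \<odot> s \<odot> ainv (ainv g) \<odot> u = R"
    unfolding s_def u_def using cg cS cR by (simp add: Aut.m_assoc c)
  then show ?thesis using that[of "ainv g" s u] g(1) s u by simp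
qed

text \<open>The conjugate is supported in the image of \<open>B\<close> under \<open>g\<close>,
  which has the measure of \<open>B\<close>, so it displaces at most that much of \<open>A\<close>;
  \<open>u\<close> leaves \<open>A\<close> unchanged up to a null set. Together with
  \<open>mem_product_if_sdist_le\<close> this squeezes the products between two bounds on the
  distance.\<close>

lemma sdist_mem_product:
  assumes A: "A \<in> fmeasurable M" and B: "B \<in> fmeasurable M"
    and g: "g \<in> \<G>" and s: "s \<in> supported B" and u: "u \<in> setstab A"
  shows "sdist M (rep (g \<odot> s \<odot> ainv g \<odot> u) ` A) A \<le> 2 * measure M B"
proof -
  define r where "r = g \<odot> s \<odot> ainv g"
  have gB: "rep g ` B \<in> fmeasurable M" by (rule rep_fmeasurable[OF g B])
  have "AE x in M. x \<in> B \<longrightarrow> rep g x \<in> rep g ` B" by simp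
  then have rs: "r \<in> supported (rep g ` B)" unfolding r_def by (rule conj_supported[OF g _ s])
  then have r: "r \<in> \<G>" "AE x in M. x \<notin> rep g ` B \<longrightarrow> rep r x = x" unfolding supported_def by auto
  have uG: "u \<in> \<G>" using u unfolding setstab_def by blast
  have As: "A \<in> sets M" using A by auto
  note fm = rep_fmeasurable[OF r(1) rep_fmeasurable[OF uG A]] rep_fmeasurable[OF r(1) A]
  have "sdist M (rep (r \<odot> u) ` A) A = sdist M (rep r ` rep u ` A) A"
    by (rule sdist_rep_mult[OF mem_carrier[OF r(1)] mem_carrier[OF uG] As As])
  also have "\<dots> \<le> sdist M (rep r ` rep u ` A) (rep r ` A) + sdist M (rep r ` A) A"
    by (rule sdist_triangle) (use fm A in auto)
  also have "sdist M (rep r ` rep u ` A) (rep r ` A) = sdist M (rep u ` A) A"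
    by (rule sdist_image[OF rep_mp[OF r(1)] mp_bijD(3)[OF rep_mp[OF uG] As] As])
  also have "\<dots> = 0" by (rule sdist_setstab[OF A u])
  also have "sdist M (rep r ` A) A = sdist M (rep r ` A) (restrict (\<lambda>x. x) (space M) ` A)"
  proof -
    have "restrict (\<lambda>x. x) (space M) ` A = A" using sets.sets_into_space[OF As] by force
    then show ?thesis by simp
  qed
  also have "\<dots> \<le> 2 * measure M (A \<inter> {x \<in> space M. rep r x \<noteq> restrict (\<lambda>x. x) (space M) x})" (is "_ \<le> 2 * measure M ?E")
    by (rule sdist_image_le[OF rep_mp[OF r(1)] id_mp_bij A])
  also have "measure M ?E \<le> measure M (rep g ` B)"
  proof -
    have E: "?E \<in> sets M" using sets_neq_fun[OF mp_bijD(2)[OF rep_mp[OF r(1)]] mp_bijD(2)[OF id_mp_bij]] As by blast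
    have "AE x in M. x \<in> ?E \<longrightarrow> x \<in> rep g ` B" using r(2) by (rule AE_mp) auto
    then have "emeasure M ?E \<le> emeasure M (rep g ` B)" by (rule emeasure_mono_AE) (use gB in auto)
    then show ?thesis unfolding measure_def using fmeasurableD2[OF gB]
      by (intro enn2real_mono) (auto simp: less_top)
  qed
  also have "measure M (rep g ` B) = measure M B"
    by (rule measure_image_mp_bij[OF rep_mp[OF g]]) (use B in auto)
  finally show ?thesis unfolding r_def by simp
qed

end

section \<open>Polish group topologies on an ergodic full group refine the weak topology\<close>

locale polish_full_group = ergodic_full_group +
  fixes \<tau> :: "('a \<Rightarrow> 'a) set topology"
  assumes polish_topology: "polish_group_topology (Aut M\<lparr>carrier := \<G>\<rparr>) \<tau>"

sublocale polish_full_group \<subseteq> P: polish_group "Aut M\<lparr>carrier := \<G>\<rparr>" \<tau>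
proof -
  have "group (Aut M\<lparr>carrier := \<G>\<rparr>)" by (rule subgroup_is_group[OF Aut_group])
  then show "polish_group (Aut M\<lparr>carrier := \<G>\<rparr>) \<tau>"
    using polish_topology unfolding polish_group_topology_def
    by (simp add: polish_group_def top_group_def top_group_axioms_def polish_group_axioms_def)
qed

context polish_full_group
begin

lemma topspace_eq: "topspace \<tau> = \<G>"
  using P.topspace by simp

lemma cont_mult:
  "continuous_map X \<tau> f \<Longrightarrow> continuous_map X \<tau> g \<Longrightarrow> continuous_map X \<tau> (\<lambda>x. f x \<odot> g x)"
  using P.continuous_mult[of X f g] by simp

lemma cont_inv:
  assumes f: "continuous_map X \<tau> f" shows "continuous_map X \<tau> (\<lambda>x. ainv (f x))"
proof (rule continuous_map_eq[OF P.continuous_inv[OF f]])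
  fix x assume "x \<in> topspace X"
  then have "f x \<in> \<G>" using continuous_map_image_subset_topspace[OF f] topspace_eq by auto
  then show "inv\<^bsub>GG\<^esub> (f x) = ainv (f x)" by (rule inv_GG)
qed

lemma cont_const: "a \<in> \<G> \<Longrightarrow> continuous_map X \<tau> (\<lambda>x. a)"
  using topspace_eq by simp

text \<open>A centraliser is an intersection of sets on which two continuous maps into a Hausdorff
  space agree.\<close>

lemma closedin_supported:
  assumes A: "A \<in> sets M" shows "closedin \<tau> (supported A)"
proof -
  let ?I = "supported (space M - A)"
  have "supported A = (\<Inter>S\<in>?I. {T \<in> topspace \<tau>. T \<odot> S = S \<odot> T})"
    unfolding supported_eq_centralizer[OF A] topspace_eq using one_supported[of "space M - A"] by blast
  moreover have "closedin \<tau> {T \<in> topspace \<tau>. T \<odot> S = S \<odot> T}" if "S \<in> ?I" for S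
  proof (rule closedin_continuous_maps_eq)
    have S: "S \<in> \<G>" using that unfolding supported_def by blast
    show "Hausdorff_space \<tau>" by (rule polish_space_topD(3)[OF P.polish])
    show "continuous_map \<tau> \<tau> (\<lambda>T. T \<odot> S)" "continuous_map \<tau> \<tau> (\<lambda>T. S \<odot> T)"
      by (intro cont_mult cont_const S; simp)+
  qed
  moreover have "?I \<noteq> {}" using one_supported by blast
  ultimately show ?thesis by (metis (no_types, lifting) closedin_INT)
qed

lemma closedin_setstab:
  assumes A: "A \<in> sets M" shows "closedin \<tau> (setstab A)"
proof -
  have "setstab A = (\<Inter>S\<in>supported A. {T \<in> topspace \<tau>. T \<odot> S \<odot> ainv T \<in> supported A})"
    unfolding setstab_eq[OF A] topspace_eq using one_supported[of A] by blast
  moreover have "closedin \<tau> {T \<in> topspace \<tau>. T \<odot> S \<odot> ainv T \<in> supported A}"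
    if "S \<in> supported A" for S
  proof (rule closedin_continuous_map_preimage)
    have S: "S \<in> \<G>" using that unfolding supported_def by blast
    show "continuous_map \<tau> \<tau> (\<lambda>T. T \<odot> S \<odot> ainv T)"
      by (intro cont_mult cont_inv cont_const S) simp_all
    show "closedin \<tau> (supported A)" by (rule closedin_supported[OF A])
  qed
  moreover have "supported A \<noteq> {}" using one_supported by blast
  ultimately show ?thesis by (metis (no_types, lifting) closedin_INT)
qed

text \<open>
  The products of a conjugate of an element supported in a fixed small set \<open>B\<close> with an element
  stabilising \<open>A\<close> form an analytic set; it consists of elements that nearly preserve \<open>A\<close>, and
  countably many translates of it cover the group.
\<close>

lemma weak_nbhd_one:
  assumes A: "A \<in> fmeasurable M" and e: "e > 0"
  obtains V where "openin \<tau> V" "\<one>\<^sub>A \<in> V" "\<And>v. v \<in> V \<Longrightarrow> sdist M (rep v ` A) A < e"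
proof -
  \<comment> \<open>Products move \<open>A\<close> by at most
    \<open>2 * measure M B \<le> e / 4\<close>, and quotients of two of them by at most
    \<open>e / 2\<close>.\<close>
  obtain B where B: "B \<in> fmeasurable M" "0 < measure M B" "measure M B \<le> e / 8"
    using small_positive_set[of "e / 8"] e by auto
  have As: "A \<in> sets M" and Bs: "B \<in> sets M" using A B by auto
  define H where "H = prod_topology \<tau> (prod_topology (subtopology \<tau> (supported B)) (subtopology \<tau> (setstab A)))"
  define f where "f p = fst p \<odot> fst (snd p) \<odot> ainv (fst p) \<odot> snd (snd p)"
    for p :: "('a \<Rightarrow> 'a) set \<times> ('a \<Rightarrow> 'a) set \<times> ('a \<Rightarrow> 'a) set"
  have Hp: "polish_space_top H" unfolding H_def
    by (intro polish_space_top_prod polish_space_top_closedin P.polish closedin_supported closedin_setstab As Bs)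
  have c1: "continuous_map H \<tau> fst" unfolding H_def by (rule continuous_map_fst)
  have c0: "continuous_map H (prod_topology (subtopology \<tau> (supported B)) (subtopology \<tau> (setstab A))) snd"
    unfolding H_def by (rule continuous_map_snd)
  have c2: "continuous_map H \<tau> (\<lambda>p. fst (snd p))"
    using continuous_map_compose[OF c0 continuous_map_into_fulltopology[OF continuous_map_fst]] by (simp add: comp_def)
  have c3: "continuous_map H \<tau> (\<lambda>p. snd (snd p))"
    using continuous_map_compose[OF c0 continuous_map_into_fulltopology[OF continuous_map_snd]] by (simp add: comp_def)
  have fc: "continuous_map H \<tau> f" unfolding f_def by (intro cont_mult cont_inv c1 c2 c3)
  have sub: "supported B \<subseteq> \<G>" "setstab A \<subseteq> \<G>" unfolding supported_def setstab_def by auto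
  have tH: "topspace H = \<G> \<times> supported B \<times> setstab A"
    unfolding H_def using sub topspace_eq by auto
  have F_small: "sdist M (rep x ` A) A \<le> e / 4" if "x \<in> f ` topspace H" for x
  proof -
    obtain p where p: "p \<in> topspace H" "x = f p" using \<open>x \<in> f ` topspace H\<close> by blast
    obtain g s u where gsu: "p = (g, s, u)" by (cases p)
    then have "g \<in> \<G>" "s \<in> supported B" "u \<in> setstab A" using p(1) tH by simp_all
    from sdist_mem_product[OF A B(1) this] have "sdist M (rep x ` A) A \<le> 2 * measure M B"
      unfolding p(2) f_def gsu by simp
    then show ?thesis using B(3) by simp
  qed
  obtain D :: "nat \<Rightarrow> ('a \<Rightarrow> 'a) set" where D: "\<And>n. D n \<in> \<G>"
    and dense: "\<And>T E e. T \<in> \<G> \<Longrightarrow> E \<in> fmeasurable M \<Longrightarrow> e > 0 \<Longrightarrow> \<exists>n. sdist M (rep (D n) ` E) (rep T ` E) < e"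
    using countable_weakly_dense by metis
  \<comment> \<open>Multiplying \<open>T\<close> by the inverse of a weakly close \<open>D n\<close>
    yields an element that moves \<open>A\<close> by less than \<open>measure M B\<close>, and every
    such element is one of the products.\<close>
  have cover: "\<exists>c\<in>range D. inv\<^bsub>GG\<^esub> c \<otimes>\<^bsub>GG\<^esub> T \<in> f ` topspace H" if "T \<in> carrier GG" for T
  proof -
    have T: "T \<in> \<G>" using that by simp
    obtain n where n: "sdist M (rep (D n) ` A) (rep T ` A) < measure M B" using dense[OF T A B(2)] by blast
    define R where "R = ainv (D n) \<odot> T"
    have R: "R \<in> \<G>" unfolding R_def using D T by simp
    have "sdist M (rep R ` A) A = sdist M (rep T ` A) (rep (D n) ` A)"
      unfolding R_def by (rule sdist_rep_inv_mult[OF mem_carrier[OF D] mem_carrier[OF T] As])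
    then have "sdist M (rep R ` A) A \<le> measure M B" using n by (simp add: sdist_commute)
    then obtain g s u where gsu: "g \<in> \<G>" "s \<in> supported B" "u \<in> setstab A"
      "R = g \<odot> s \<odot> ainv g \<odot> u"
      using mem_product_if_sdist_le[OF A B(1) R] by blast
    then have "R = f (g, s, u)" "(g, s, u) \<in> topspace H" unfolding f_def tH by auto
    then have "R \<in> f ` topspace H" by blast
    then show ?thesis unfolding R_def using inv_GG[OF D] by auto
  qed
  have rD: "countable (range D)" "range D \<subseteq> carrier GG" using D by auto
  obtain V where V: "openin \<tau> V" "\<one>\<^bsub>GG\<^esub> \<in> V"
    "\<And>v. v \<in> V \<Longrightarrow> \<exists>x\<in>f ` topspace H. \<exists>y\<in>f ` topspace H. x \<in> carrier GG \<and> y \<in> carrier GG \<and> v = inv\<^bsub>GG\<^esub> x \<otimes>\<^bsub>GG\<^esub> y"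
    by (rule P.analytic_quotients_contain_nbhd[OF Hp fc rD], erule cover) (rule that)
  have "sdist M (rep v ` A) A < e" if v: "v \<in> V" for v
  proof -
    obtain x y where xy': "x \<in> f ` topspace H" "y \<in> f ` topspace H" "x \<in> carrier GG" "y \<in> carrier GG"
      "v = inv\<^bsub>GG\<^esub> x \<otimes>\<^bsub>GG\<^esub> y"
      using V(3)[OF v] by (elim bexE conjE)
    then have xy: "x \<in> f ` topspace H" "y \<in> f ` topspace H" "x \<in> \<G>" "y \<in> \<G>"
      "v = ainv x \<odot> y"
      using inv_GG[of x] by simp_all
    have "sdist M (rep v ` A) A = sdist M (rep y ` A) (rep x ` A)"
      unfolding xy(5) by (rule sdist_rep_inv_mult[OF mem_carrier[OF xy(3)] mem_carrier[OF xy(4)] As])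
    also have "\<dots> \<le> sdist M (rep y ` A) A + sdist M A (rep x ` A)"
      by (rule sdist_triangle[OF rep_fmeasurable[OF xy(4) A] A rep_fmeasurable[OF xy(3) A]])
    also have "\<dots> \<le> e / 4 + e / 4"
      using F_small[OF xy(1)] F_small[OF xy(2)] by (simp add: sdist_commute[of M A])
    finally show ?thesis using e by simp
  qed
  then show ?thesis using V(1,2) that by simp
qed

lemma weak_nbhd:
  assumes T: "T \<in> \<G>" and A: "A \<in> fmeasurable M" and e: "e > 0"
  obtains V where "openin \<tau> V" "T \<in> V" "\<And>S. S \<in> V \<Longrightarrow> sdist M (rep T ` A) (rep S ` A) < e"
proof -
  obtain V where V: "openin \<tau> V" "\<one>\<^sub>A \<in> V" "\<And>v. v \<in> V \<Longrightarrow> sdist M (rep v ` A) A < e"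
    by (rule weak_nbhd_one[OF A e]) (rule that)
  have VG: "V \<subseteq> \<G>" using openin_subset[OF V(1)] topspace_eq by simp
  show ?thesis
  proof (rule that[of "(\<lambda>x. T \<odot> x) ` V"])
    show "openin \<tau> ((\<lambda>x. T \<odot> x) ` V)" using P.openin_left_translate[of T V] V(1) T by simp
    show "T \<in> (\<lambda>x. T \<odot> x) ` V" using V(2) T by (intro image_eqI[of _ _ "\<one>\<^sub>A"]) auto
    fix S assume "S \<in> (\<lambda>x. T \<odot> x) ` V"
    then obtain v where v: "v \<in> V" "S = T \<odot> v" by blast
    have vG: "v \<in> \<G>" using v VG by blast
    have As: "A \<in> sets M" using A by auto
    have "sdist M (rep T ` A) (rep S ` A) = sdist M (rep S ` A) (rep T ` A)" by (rule sdist_commute)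
    also have "\<dots> = sdist M (rep T ` rep v ` A) (rep T ` A)"
      unfolding v(2) by (rule sdist_rep_mult[OF mem_carrier[OF T] mem_carrier[OF vG] As mp_bijD(3)[OF rep_mp[OF T] As]])
    also have "\<dots> = sdist M (rep v ` A) A"
      by (rule sdist_image[OF rep_mp[OF T] mp_bijD(3)[OF rep_mp[OF vG] As] As])
    finally show "sdist M (rep T ` A) (rep S ` A) < e" using V(3)[OF v(1)] by simp
  qed
qed

theorem refines_weak: "coarser (subtopology (weak_topology M) \<G>) \<tau>"
proof -
  have sG: "\<G> \<subseteq> carrier (Aut M)" using subset .
  have op: "openin \<tau> (U \<inter> \<G>)"
    if "generate_topology_on {{T \<in> carrier (Aut M). d_weak M A S T < r} | S A r.
        S \<in> carrier (Aut M) \<and> A \<in> finite_sets M \<and> r > 0} U" for U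
    using that
  proof induction
    case Empty show ?case by simp
  next
    case (Int a b)
    have eq: "a \<inter> b \<inter> \<G> = (a \<inter> \<G>) \<inter> (b \<inter> \<G>)" by blast
    show ?case unfolding eq by (rule openin_Int[OF Int.IH])
  next
    case (UN K)
    have eq: "\<Union>K \<inter> \<G> = \<Union>((\<lambda>k. k \<inter> \<G>) ` K)" by blast
    show ?case unfolding eq by (rule openin_Union) (use UN.IH in blast)
  next
    case (Basis s)
    then obtain S A r where s: "s = {T \<in> carrier (Aut M). d_weak M A S T < r}"
      and S: "S \<in> carrier (Aut M)" and A': "A \<in> finite_sets M" by blast
    have A: "A \<in> fmeasurable M" using A' by (simp add: finite_sets_fmeasurable)
    show ?case
    proof (subst openin_subopen, intro ballI)
      fix T assume T: "T \<in> s \<inter> \<G>"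
      \<comment> \<open>The margin by which \<open>T\<close> lies inside the subbasic set; by the
        triangle inequality elements weakly closer to \<open>T\<close> than this stay
        inside.\<close>
      define e where "e = r - d_weak M A S T"
      have e: "e > 0" using T unfolding s e_def by simp
      obtain V where V: "openin \<tau> V" "T \<in> V" "\<And>S. S \<in> V \<Longrightarrow> sdist M (rep T ` A) (rep S ` A) < e"
        by (rule weak_nbhd[OF _ A e, of T]) (use T in blast, rule that)
      have "V \<subseteq> s \<inter> \<G>"
      proof
        fix R assume R: "R \<in> V"
        then have RG: "R \<in> \<G>" using openin_subset[OF V(1)] topspace_eq by blast
        have "d_weak M A S R \<le> d_weak M A S T + d_weak M A T R"
          by (rule d_weak_triangle[OF S _ _ A']) (use T RG sG in auto)
        also have "d_weak M A T R < e" using V(3)[OF R] unfolding sdist_def d_weak_def .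
        finally show "R \<in> s \<inter> \<G>" using RG sG unfolding s e_def by auto
      qed
      then show "\<exists>V. openin \<tau> V \<and> T \<in> V \<and> V \<subseteq> s \<inter> \<G>" using V(1,2) by blast
    qed
  qed
  show ?thesis unfolding coarser_def
  proof (intro conjI allI impI)
    show "topspace (subtopology (weak_topology M) \<G>) = topspace \<tau>"
      using sG topspace_eq by (auto simp: topspace_weak_topology)
    fix U assume "openin (subtopology (weak_topology M) \<G>) U"
    then obtain W where "openin (weak_topology M) W" "U = W \<inter> \<G>" unfolding openin_subtopology by blast
    then show "openin \<tau> U" using op unfolding weak_topology_def openin_topology_generated_by_iff by blast
  qed
qed

end

section \<open>Closed graphs of identity maps, and uniqueness\<close>

context std_space
begin

text \<open>Distinct \<open>S\<close> and \<open>T\<close> are told apart by one set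
  \<open>A\<close>, and each topology has a neighbourhood in which the image of \<open>A\<close>
  moves by less than half the distance; a common point would violate the triangle inequality. Two
  carriers are allowed so that the lemma also serves inclusions of subgroups.\<close>

lemma closedin_identity_graph:
  assumes K: "topspace \<sigma> = K" "K \<subseteq> H" and H: "topspace \<tau> = H" "H \<subseteq> carrier (Aut M)"
    and w1: "\<And>T A e. T \<in> K \<Longrightarrow> A \<in> fmeasurable M \<Longrightarrow> e > 0 \<Longrightarrow>
      \<exists>V. openin \<sigma> V \<and> T \<in> V \<and> (\<forall>S\<in>V. sdist M (rep T ` A) (rep S ` A) < e)"
    and w2: "\<And>T A e. T \<in> H \<Longrightarrow> A \<in> fmeasurable M \<Longrightarrow> e > 0 \<Longrightarrow>
      \<exists>V. openin \<tau> V \<and> T \<in> V \<and> (\<forall>S\<in>V. sdist M (rep T ` A) (rep S ` A) < e)"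
  shows "closedin (prod_topology \<sigma> \<tau>) ((\<lambda>x. (x, x)) ` K)"
proof -
  have "openin (prod_topology \<sigma> \<tau>) (topspace (prod_topology \<sigma> \<tau>) - (\<lambda>x. (x, x)) ` K)"
  proof (subst openin_subopen, intro ballI)
    fix p assume p: "p \<in> topspace (prod_topology \<sigma> \<tau>) - (\<lambda>x. (x, x)) ` K"
    obtain S T where ST: "p = (S, T)" by (cases p)
    have S: "S \<in> K" and T: "T \<in> H" and ne: "S \<noteq> T" using p K H unfolding ST by auto
    obtain A where A: "A \<in> fmeasurable M" "0 < sdist M (rep S ` A) (rep T ` A)"
      using weak_separation[of S T] S T K H ne by blast
    define c where "c = sdist M (rep S ` A) (rep T ` A) / 2"
    have c: "c > 0" using A unfolding c_def by simp
    obtain U where U: "openin \<sigma> U" "S \<in> U" "\<forall>R\<in>U. sdist M (rep S ` A) (rep R ` A) < c"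
      using w1[OF S A(1) c] by blast
    obtain V where V: "openin \<tau> V" "T \<in> V" "\<forall>R\<in>V. sdist M (rep T ` A) (rep R ` A) < c"
      using w2[OF T A(1) c] by blast
    have dis: "R \<notin> V" if R: "R \<in> U" for R
    proof
      assume RV: "R \<in> V"
      have f: "rep Q ` A \<in> fmeasurable M" if "Q \<in> H" for Q
        using fmeasurable_image_mp_bij[OF rep_mp_bij A(1), of Q] that H by blast
      have RH: "R \<in> H" using openin_subset[OF V(1)] H RV by blast
      have SH: "S \<in> H" using S K by blast
      have "sdist M (rep S ` A) (rep T ` A) \<le> sdist M (rep S ` A) (rep R ` A) + sdist M (rep R ` A) (rep T ` A)"
        by (rule sdist_triangle[OF f[OF SH] f[OF RH] f[OF T]])
      moreover have "sdist M (rep S ` A) (rep R ` A) < c" using U(3) R by blast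
      moreover have "sdist M (rep R ` A) (rep T ` A) < c"
        using V(3) RV by (subst sdist_commute) blast
      ultimately show False unfolding c_def by simp
    qed
    have "openin (prod_topology \<sigma> \<tau>) (U \<times> V)" using U V by (simp add: openin_prod_Times_iff)
    moreover have "p \<in> U \<times> V" using ST U V by blast
    moreover have "U \<times> V \<subseteq> topspace (prod_topology \<sigma> \<tau>) - (\<lambda>x. (x, x)) ` K"
      using dis openin_subset[OF U(1)] openin_subset[OF V(1)] by auto
    ultimately show "\<exists>W. openin (prod_topology \<sigma> \<tau>) W \<and> p \<in> W \<and>
        W \<subseteq> topspace (prod_topology \<sigma> \<tau>) - (\<lambda>x. (x, x)) ` K" by blast
  qed
  moreover have "(\<lambda>x. (x, x)) ` K \<subseteq> topspace (prod_topology \<sigma> \<tau>)" using K H by auto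
  ultimately show ?thesis unfolding closedin_def by blast
qed

end

text \<open>Both topologies refine the weak one, so the identity from \<open>\<sigma>\<close> to
  \<open>\<tau>\<close> has closed graph and is continuous. Exchanging the roles gives
  uniqueness.\<close>

lemma (in ergodic_full_group) polish_topology_coarser:
  assumes "polish_full_group M \<G> \<sigma>" "polish_full_group M \<G> \<tau>" and U: "openin \<tau> U"
  shows "openin \<sigma> U"
proof -
  interpret S: polish_full_group M \<G> \<sigma> by fact
  interpret T: polish_full_group M \<G> \<tau> by fact
  have "closedin (prod_topology \<sigma> \<tau>) ((\<lambda>x. (x, x)) ` \<G>)"
  proof (rule closedin_identity_graph[OF S.topspace_eq order_refl T.topspace_eq subset])
    fix T A and e :: real assume a: "T \<in> \<G>" "A \<in> fmeasurable M" "e > 0"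
    show "\<exists>V. openin \<sigma> V \<and> T \<in> V \<and> (\<forall>S\<in>V. sdist M (rep T ` A) (rep S ` A) < e)"
      by (rule S.weak_nbhd[OF a]) blast
    show "\<exists>V. openin \<tau> V \<and> T \<in> V \<and> (\<forall>S\<in>V. sdist M (rep T ` A) (rep S ` A) < e)"
      by (rule T.weak_nbhd[OF a]) blast
  qed
  then have "closedin (prod_topology \<sigma> \<tau>) ((\<lambda>x. (x, (\<lambda>x. x) x)) ` carrier GG)" by simp
  moreover have "(\<lambda>x. x) \<in> hom GG GG" by (auto simp: hom_def)
  ultimately have "continuous_map \<sigma> \<tau> (\<lambda>x. x)"
    by (intro closed_graph_polish_groups[OF S.P.polish_group_axioms T.P.polish_group_axioms])
  then have "openin \<sigma> {x \<in> topspace \<sigma>. x \<in> U}" using U by (rule openin_continuous_map_preimage)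
  moreover have "{x \<in> topspace \<sigma>. x \<in> U} = U" using openin_subset[OF U] S.topspace_eq T.topspace_eq by blast
  ultimately show ?thesis by simp
qed

section \<open>The uniform topology\<close>

context std_space
begin

text \<open>By Borel-Cantelli almost every point changes its image only finitely often. A limit of
  bijections may fail to be onto, so only a bound on preimages is claimed; invertibility comes later
  from the limit of the inverses.\<close>

lemma eventually_constant_limit:
  fixes s :: "nat \<Rightarrow> 'a \<Rightarrow> 'a"
  assumes s: "\<And>n. s n \<in> mp_bij M"
    and sm: "summable (\<lambda>n. measure nu {x \<in> space M. s n x \<noteq> s (Suc n) x})"
  obtains T where "T \<in> measurable M M" "\<And>A. A \<in> sets M \<Longrightarrow> emeasure M (T -` A \<inter> space M) \<le> emeasure M A"
    "AE x in M. \<exists>n. \<forall>m\<ge>n. s m x = T x"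
proof -
  define st where "st n x \<longleftrightarrow> (\<forall>m\<ge>n. s m x = s n x)" for n x
  define ev where "ev = {x \<in> space M. \<exists>n. st n x}"
  have eqs: "{x \<in> space M. s m x = s n x} \<in> sets M" for m n
    by (rule sets_eq_fun[OF mp_bijD(2)[OF s] mp_bijD(2)[OF s]])
  have "ev = (\<Union>n. \<Inter>m\<in>{n..}. {x \<in> space M. s m x = s n x})"
    unfolding ev_def st_def by auto
  moreover have "(\<Inter>m\<in>{n..}. {x \<in> space M. s m x = s n x}) \<in> sets M" for n
    by (rule sets.countable_INT') (use eqs in auto)
  ultimately have evm: "ev \<in> sets M" by auto
  have "AE x in nu. eventually (\<lambda>n. x \<in> space nu - {x \<in> space M. s n x \<noteq> s (Suc n) x}) sequentially"
  proof (rule borel_cantelli_AE1)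
    show "{x \<in> space M. s n x \<noteq> s (Suc n) x} \<in> sets nu" for n
      using sets_neq_fun[OF mp_bijD(2)[OF s] mp_bijD(2)[OF s]] by simp
  qed (use sm in \<open>auto simp: nu.emeasure_eq_measure\<close>)
  then have "AE x in M. eventually (\<lambda>n. x \<in> space M - {x \<in> space M. s n x \<noteq> s (Suc n) x}) sequentially"
    unfolding AE_nu_iff by simp
  then have AEev: "AE x in M. x \<in> ev"
  proof (rule AE_mp, intro AE_I2 impI)
    fix x assume x: "x \<in> space M" "eventually (\<lambda>n. x \<in> space M - {x \<in> space M. s n x \<noteq> s (Suc n) x}) sequentially"
    then obtain n where n: "\<And>m. m \<ge> n \<Longrightarrow> s m x = s (Suc m) x" by (auto simp: eventually_sequentially)
    have "s m x = s n x" if "m \<ge> n" for m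
      using that
    proof (induction rule: dec_induct)
      case (step m)
      then show ?case using n[of m] by simp
    qed simp
    then have "st n x" unfolding st_def by blast
    then show "x \<in> ev" using x(1) unfolding ev_def by blast
  qed
  \<comment> \<open>Off \<open>ev\<close>, a null set, the identity is the default.\<close>
  define T where "T x = (if x \<in> ev then s (LEAST n. st n x) x else x)" for x
  have Tst: "st (LEAST n. st n x) x" if "x \<in> ev" for x
    using that unfolding ev_def by (auto intro: LeastI)
  have Tev: "\<exists>n. \<forall>m\<ge>n. s m x = T x" if "x \<in> ev" for x
  proof -
    define k where "k = (LEAST n. st n x)"
    have "st k x" unfolding k_def by (rule Tst[OF that])
    then have k: "\<forall>m\<ge>k. s m x = s k x" unfolding st_def .
    have eq: "T x = s k x" using that unfolding T_def k_def by simp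
    show ?thesis unfolding eq by (rule exI[of _ k], rule k)
  qed
  have Tsp: "T x \<in> space M" if "x \<in> space M" for x
    using that mp_bij_maps(3)[OF s that] unfolding T_def by auto
  \<comment> \<open>A Fatou argument: \<open>G A n\<close> increases with \<open>n\<close>, its
    union agrees almost everywhere with the preimage of \<open>A\<close> under \<open>T\<close>, and
    it lies in the preimage under \<open>s n\<close>, which has the measure of
    \<open>A\<close>.\<close>
  define G where "G A n = (\<Inter>m\<in>{n..}. s m -` A \<inter> space M)" for A n
  have sA: "s m -` A \<inter> space M \<in> sets M" if "A \<in> sets M" for m A
    by (rule measurable_sets[OF mp_bijD(2)[OF s] that])
  have Gm: "G A n \<in> sets M" if "A \<in> sets M" for A n
    unfolding G_def by (rule sets.countable_INT') (use sA[OF that] in auto)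
  have TG: "x \<in> T -` A \<longleftrightarrow> x \<in> (\<Union>n. G A n)" if x: "x \<in> ev" for x A
  proof -
    obtain n where n: "\<And>m. m \<ge> n \<Longrightarrow> s m x = T x" using Tev[OF x] by blast
    have xs: "x \<in> space M" using x unfolding ev_def by blast
    show ?thesis
    proof
      assume "x \<in> T -` A"
      then have "s m x \<in> A" if "m \<ge> n" for m using n[OF that] by simp
      then have "x \<in> G A n" unfolding G_def using xs by simp
      then show "x \<in> (\<Union>n. G A n)" by blast
    next
      assume "x \<in> (\<Union>n. G A n)"
      then obtain k where "x \<in> G A k" by blast
      then have "s (max k n) x \<in> A" unfolding G_def by auto
      then show "x \<in> T -` A" using n[of "max k n"] by simp
    qed
  qed
  have GU: "(\<Union>n. G A n) \<in> sets M" if "A \<in> sets M" for A using Gm[OF that] by auto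
  have Tm: "T \<in> measurable M M"
  proof (rule measurableI)
    fix A assume A: "A \<in> sets M"
    have "x \<in> T -` A \<inter> space M \<longleftrightarrow> x \<in> (ev \<inter> (\<Union>n. G A n)) \<union> (A - ev)" for x
    proof (cases "x \<in> ev")
      case True
      then have "x \<in> space M" unfolding ev_def by blast
      then show ?thesis using TG[OF True, of A] True by blast
    next
      case False
      then have "T x = x" unfolding T_def by simp
      then show ?thesis using False sets.sets_into_space[OF A] by auto
    qed
    then have "T -` A \<inter> space M = (ev \<inter> (\<Union>n. G A n)) \<union> (A - ev)" by blast
    then show "T -` A \<inter> space M \<in> sets M" using evm GU[OF A] A by auto
  qed (rule Tsp)
  have Tle: "emeasure M (T -` A \<inter> space M) \<le> emeasure M A" if A: "A \<in> sets M" for A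
  proof -
    have "emeasure M (T -` A \<inter> space M) \<le> emeasure M (\<Union>n. G A n)"
    proof (rule emeasure_mono_AE)
      show "AE x in M. x \<in> T -` A \<inter> space M \<longrightarrow> x \<in> (\<Union>n. G A n)"
        using AEev by (rule AE_mp) (use TG[of _ A] in auto)
    qed (rule GU[OF A])
    also have "\<dots> = (SUP n. emeasure M (G A n))"
    proof (rule SUP_emeasure_incseq[symmetric])
      show "range (G A) \<subseteq> sets M" using Gm[OF A] by blast
      show "incseq (G A)" unfolding G_def by (rule incseq_SucI) auto
    qed
    also have "\<dots> \<le> emeasure M A"
    proof (rule SUP_least)
      fix n
      have "emeasure M (G A n) \<le> emeasure M (s n -` A \<inter> space M)"
        by (rule emeasure_mono[OF _ sA[OF A]]) (auto simp: G_def)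
      then show "emeasure M (G A n) \<le> emeasure M A" using mp_bijD(5)[OF s A] by simp
    qed
    finally show ?thesis .
  qed
  have "AE x in M. \<exists>n. \<forall>m\<ge>n. s m x = T x" using AEev by (rule AE_mp) (use Tev in auto)
  then show ?thesis using that[OF Tm Tle] by blast
qed

end

section \<open>The uniform metric and its completeness\<close>

context ergodic_full_group
begin

text \<open>A single distance for the finite measure \<open>nu\<close> in place of the family
  \<open>d_unif\<close>; it is invariant under left translations, but right translations pull the
  set of disagreement back.\<close>

definition nd :: "('a \<Rightarrow> 'a) set \<Rightarrow> ('a \<Rightarrow> 'a) set \<Rightarrow> real" where
  "nd S T = measure nu {x \<in> space M. rep S x \<noteq> rep T x}"

text \<open>The second summand makes the metric complete: it controls the inverses of a Cauchy sequence.\<close>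

definition du :: "('a \<Rightarrow> 'a) set \<Rightarrow> ('a \<Rightarrow> 'a) set \<Rightarrow> real" where
  "du S T = nd S T + nd (ainv S) (ainv T)"

lemma sets_neq_rep:
  assumes "S \<in> \<G>" "T \<in> \<G>" shows "{x \<in> space M. rep S x \<noteq> rep T x} \<in> sets M"
  by (rule sets_neq_fun[OF mp_bijD(2)[OF rep_mp[OF assms(1)]] mp_bijD(2)[OF rep_mp[OF assms(2)]]])

lemma nd_nonneg [simp]: "0 \<le> nd S T" unfolding nd_def by simp

lemma nd_commute: "nd S T = nd T S" unfolding nd_def by (simp add: eq_commute)

lemma nd_triangle:
  assumes "R \<in> \<G>" "S \<in> \<G>" "T \<in> \<G>" shows "nd R T \<le> nd R S + nd S T"
proof -
  have "nd R T \<le> measure nu ({x \<in> space M. rep R x \<noteq> rep S x} \<union> {x \<in> space M. rep S x \<noteq> rep T x})"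
    unfolding nd_def by (rule nu.finite_measure_mono) (use sets_neq_rep assms in auto)
  also have "\<dots> \<le> nd R S + nd S T"
    unfolding nd_def by (rule measure_Un_le) (use sets_neq_rep assms in auto)
  finally show ?thesis .
qed

lemma nd_eq_0_iff:
  assumes "S \<in> \<G>" "T \<in> \<G>" shows "nd S T = 0 \<longleftrightarrow> S = T"
proof
  assume "nd S T = 0"
  then have "emeasure M {x \<in> space M. rep S x \<noteq> rep T x} = 0"
    unfolding nd_def using null_nu_iff[OF sets_neq_rep[OF assms]] by simp
  then have "AE x in M. x \<notin> {x \<in> space M. rep S x \<noteq> rep T x}"
    using AE_notin_iff[OF sets_neq_rep[OF assms]] by blast
  then have "AE x in M. rep S x = rep T x" by (rule AE_mp) auto
  then show "S = T" by (rule Aut_eqI[OF mem_carrier[OF assms(1)] mem_carrier[OF assms(2)]])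
qed (simp add: nd_def)

lemma nd_eq_measure:
  assumes ST: "S \<in> \<G>" "T \<in> \<G>" and E: "E \<in> sets M"
    and ae: "AE x in M. rep S x \<noteq> rep T x \<longleftrightarrow> x \<in> E"
  shows "nd S T = measure nu E"
  unfolding nd_def
proof (rule measure_eq_AE)
  show "AE x in nu. x \<in> {x \<in> space M. rep S x \<noteq> rep T x} \<longleftrightarrow> x \<in> E"
    unfolding AE_nu_iff using ae by (rule AE_mp) auto
qed (use sets_neq_rep[OF ST] E in auto)

lemma nd_mult_left:
  assumes R: "R \<in> \<G>" and S: "S \<in> \<G>" and T: "T \<in> \<G>"
  shows "nd (R \<odot> S) (R \<odot> T) = nd S T"
proof -
  note c = mem_carrier[OF R] mem_carrier[OF S] mem_carrier[OF T]
  have "nd (R \<odot> S) (R \<odot> T) = measure nu {x \<in> space M. rep S x \<noteq> rep T x}"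
  proof (rule nd_eq_measure[OF m_closed[OF R S] m_closed[OF R T] sets_neq_rep[OF S T]])
    have sp: "AE x in M. x \<in> space M" by simp
    show "AE x in M. rep (R \<odot> S) x \<noteq> rep (R \<odot> T) x \<longleftrightarrow> x \<in> {x \<in> space M. rep S x \<noteq> rep T x}"
      using rep_mult[OF c(1,2)] rep_mult[OF c(1,3)] AE_rep[OF c(2) rep_inv(1)[OF c(1)]]
        AE_rep[OF c(3) rep_inv(1)[OF c(1)]] sp
    proof eventually_elim
      case (elim x)
      have "rep R (rep S x) = rep R (rep T x) \<longleftrightarrow> rep S x = rep T x" using elim(3,4) by metis
      then show ?case using elim by simp
    qed
  qed
  then show ?thesis unfolding nd_def .
qed

lemma nd_mult_right:
  assumes R: "R \<in> \<G>" and S: "S \<in> \<G>" and T: "T \<in> \<G>"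
  shows "nd (S \<odot> R) (T \<odot> R) = measure nu (rep R -` {x \<in> space M. rep S x \<noteq> rep T x} \<inter> space M)"
proof (rule nd_eq_measure[OF m_closed[OF S R] m_closed[OF T R]])
  note c = mem_carrier[OF R] mem_carrier[OF S] mem_carrier[OF T]
  show "rep R -` {x \<in> space M. rep S x \<noteq> rep T x} \<inter> space M \<in> sets M"
    by (rule measurable_sets[OF mp_bijD(2)[OF rep_mp[OF R]] sets_neq_rep[OF S T]])
  show "AE x in M. rep (S \<odot> R) x \<noteq> rep (T \<odot> R) x \<longleftrightarrow>
      x \<in> rep R -` {x \<in> space M. rep S x \<noteq> rep T x} \<inter> space M"
    using AE_conjI[OF rep_mult[OF c(2,1)] rep_mult[OF c(3,1)]]
    by (rule AE_mp) (use mp_bij_maps(3)[OF rep_mp[OF R]] in auto)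
qed

text \<open>Almost everywhere, the inverses disagree at \<open>x\<close> exactly when the maps
  disagree at the point that \<open>T\<close> sends to \<open>x\<close>. So the second summand of
  \<open>du\<close> is the \<open>nu\<close> measure of a preimage under the map
  \<open>rep (ainv T)\<close>, which does not depend on \<open>S\<close>.\<close>

lemma nd_inv:
  assumes S: "S \<in> \<G>" and T: "T \<in> \<G>"
  shows "nd (ainv S) (ainv T) =
    measure nu (rep (ainv T) -` {x \<in> space M. rep S x \<noteq> rep T x} \<inter> space M)"
proof (rule nd_eq_measure[OF m_inv_closed[OF S] m_inv_closed[OF T]])
  note c = mem_carrier[OF S] mem_carrier[OF T] and iT = m_inv_closed[OF T]
  show "rep (ainv T) -` {x \<in> space M. rep S x \<noteq> rep T x} \<inter> space M \<in> sets M"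
    by (rule measurable_sets[OF mp_bijD(2)[OF rep_mp[OF iT]] sets_neq_rep[OF S T]])
  have sp: "AE x in M. x \<in> space M" by simp
  show "AE x in M. rep (ainv S) x \<noteq> rep (ainv T) x \<longleftrightarrow>
      x \<in> rep (ainv T) -` {x \<in> space M. rep S x \<noteq> rep T x} \<inter> space M"
    using rep_inv(2)[OF c(1)] rep_inv(2)[OF c(2)] AE_rep[OF mem_carrier[OF iT] rep_inv(1)[OF c(1)]] sp
  proof eventually_elim
    case (elim x)
    have "rep (ainv S) x = rep (ainv T) x \<longleftrightarrow>
        rep S (rep (ainv T) x) = rep T (rep (ainv T) x)"
      using elim(1-3) by metis
    then show ?case using elim(4) mp_bij_maps(3)[OF rep_mp[OF iT]] by auto
  qed
qed

text \<open>By \<open>nd_inv\<close> and smallness of preimages under a fixed map, the first summand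
  of \<open>du\<close> controls the second near a fixed \<open>T\<close>; so \<open>du\<close> and
  \<open>nd\<close> have the same neighbourhoods.\<close>

lemma du_small_if_nd_small:
  assumes T: "T \<in> \<G>" and e: "e > 0"
  obtains d where "d > 0" "\<And>S. S \<in> \<G> \<Longrightarrow> nd S T < d \<Longrightarrow> du S T < e"
proof -
  obtain d where d: "d > 0" "\<And>D. D \<in> sets M \<Longrightarrow> measure nu D < d \<Longrightarrow>
      measure nu (rep (ainv T) -` D \<inter> space M) < e / 2"
    using measure_nu_vimage_small[OF rep_mp[OF m_inv_closed[OF T]], of "e / 2"] e by auto
  show ?thesis
  proof (rule that[of "min d (e / 2)"])
    show "min d (e / 2) > 0" using d e by simp
    fix S assume S: "S \<in> \<G>" "nd S T < min d (e / 2)"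
    then have "nd (ainv S) (ainv T) < e / 2"
      unfolding nd_inv[OF S(1) T] using d(2)[OF sets_neq_rep[OF S(1) T]] unfolding nd_def by simp
    then show "du S T < e" using S(2) unfolding du_def by simp
  qed
qed

end

sublocale ergodic_full_group \<subseteq> U: Metric_space \<G> du
proof
  show "0 \<le> du S T" for S T unfolding du_def by simp
  show "du S T = du T S" for S T unfolding du_def by (simp add: nd_commute)
  show "du S T = 0 \<longleftrightarrow> S = T" if "S \<in> \<G>" "T \<in> \<G>" for S T
  proof
    assume "du S T = 0"
    then have "nd S T = 0" unfolding du_def using nd_nonneg[of S T]
        nd_nonneg[of "ainv S" "ainv T"] by linarith
    then show "S = T" using nd_eq_0_iff[OF that] by blast
  qed (simp add: du_def nd_def)
  show "du R T \<le> du R S + du S T" if "R \<in> \<G>" "S \<in> \<G>" "T \<in> \<G>" for R S T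
    using nd_triangle[OF that] nd_triangle[of "ainv R" "ainv S" "ainv T"] that
    unfolding du_def by simp
qed

context ergodic_full_group
begin

lemma top_group_uniform: "top_group GG U.mtopology"
proof -
  have "continuous_map (prod_topology U.mtopology U.mtopology) U.mtopology (\<lambda>(x, y). x \<odot> y)"
    unfolding U.continuous_map_to_metric
  proof (intro ballI allI impI)
    fix p and e :: real assume "p \<in> topspace (prod_topology U.mtopology U.mtopology)" and e: "e > 0"
    then obtain S0 T0 where p: "p = (S0, T0)" and S0: "S0 \<in> \<G>" and T0: "T0 \<in> \<G>" by auto
    have ST: "S0 \<odot> T0 \<in> \<G>" using S0 T0 by simp
    obtain d where d: "d > 0" "\<And>S. S \<in> \<G> \<Longrightarrow> nd S (S0 \<odot> T0) < d \<Longrightarrow> du S (S0 \<odot> T0) < e"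
      using du_small_if_nd_small[OF ST e] by blast
    obtain d1 where d1: "d1 > 0" "\<And>D. D \<in> sets M \<Longrightarrow> measure nu D < d1 \<Longrightarrow>
        measure nu (rep T0 -` D \<inter> space M) < d / 2"
      using measure_nu_vimage_small[OF rep_mp[OF T0], of "d / 2"] d(1) by auto
    have "(case q of (x, y) \<Rightarrow> x \<odot> y) \<in> U.mball (case p of (x, y) \<Rightarrow> x \<odot> y) e"
      if q: "q \<in> U.mball S0 d1 \<times> U.mball T0 (d / 2)" for q
    proof -
      obtain S T where ST: "q = (S, T)" "S \<in> \<G>" "T \<in> \<G>" "du S0 S < d1" "du T0 T < d / 2" using q by auto
      have nS: "nd S S0 < d1"
        using ST(4) nd_nonneg[of "ainv S0" "ainv S"] nd_commute[of S S0]
        unfolding du_def by linarith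
      have nT: "nd T T0 < d / 2"
        using ST(5) nd_nonneg[of "ainv T0" "ainv T"] nd_commute[of T T0]
        unfolding du_def by linarith
      \<comment> \<open>Passing through \<open>S \<odot> T0\<close> leaves only a right translation
        by the fixed \<open>T0\<close>, for which \<open>d1\<close> was chosen; the left translation
        by the varying \<open>S\<close> costs nothing.\<close>
      have "nd (S \<odot> T) (S0 \<odot> T0) \<le>
          nd (S \<odot> T) (S \<odot> T0) + nd (S \<odot> T0) (S0 \<odot> T0)"
        by (rule nd_triangle) (use ST S0 T0 in auto)
      also have "nd (S \<odot> T) (S \<odot> T0) = nd T T0" by (rule nd_mult_left[OF ST(2,3) T0])
      also have "nd (S \<odot> T0) (S0 \<odot> T0) < d / 2"
        unfolding nd_mult_right[OF T0 ST(2) S0]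
        using d1(2)[OF sets_neq_rep[OF ST(2) S0]] nS unfolding nd_def by blast
      finally have "du (S \<odot> T) (S0 \<odot> T0) < e"
        using nT by (intro d(2)) (use ST in auto)
      then show ?thesis unfolding ST(1) p using ST S0 T0 by (simp add: U.commute)
    qed
    moreover have "openin (prod_topology U.mtopology U.mtopology) (U.mball S0 d1 \<times> U.mball T0 (d / 2))"
      by (simp add: openin_prod_Times_iff)
    moreover have "p \<in> U.mball S0 d1 \<times> U.mball T0 (d / 2)" using S0 T0 d d1 p by simp
    ultimately show "\<exists>W. openin (prod_topology U.mtopology U.mtopology) W \<and> p \<in> W \<and>
        (\<forall>q\<in>W. (case q of (x, y) \<Rightarrow> x \<odot> y) \<in> U.mball (case p of (x, y) \<Rightarrow> x \<odot> y) e)"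
      by (intro exI[of _ "U.mball S0 d1 \<times> U.mball T0 (d / 2)"] conjI ballI)
  qed
  moreover have "continuous_map U.mtopology U.mtopology (\<lambda>x. inv\<^bsub>GG\<^esub> x)"
    unfolding U.continuous_map_to_metric
  proof (intro ballI allI impI)
    fix T and e :: real assume "T \<in> topspace U.mtopology" and e: "e > 0"
    then have T: "T \<in> \<G>" by simp
    have inv_ball: "inv\<^bsub>GG\<^esub> S \<in> U.mball (inv\<^bsub>GG\<^esub> T) e" if "S \<in> U.mball T e" for S
    proof -
      have S: "S \<in> \<G>" "du T S < e" using that by auto
      then show ?thesis using T inv_GG[OF T] inv_GG[OF S(1)] mem_carrier[OF T] mem_carrier[OF S(1)]
        by (simp add: du_def)
    qed
    show "\<exists>W. openin U.mtopology W \<and> T \<in> W \<and> (\<forall>S\<in>W. inv\<^bsub>GG\<^esub> S \<in> U.mball (inv\<^bsub>GG\<^esub> T) e)"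
    proof (intro exI[of _ "U.mball T e"] conjI ballI)
      show "T \<in> U.mball T e" using T e by simp
    qed (rule U.openin_mball, rule inv_ball)
  qed
  ultimately have "group_topology GG U.mtopology" unfolding group_topology_def by simp
  then show ?thesis
    using subgroup_is_group[OF Aut_group] by (simp add: top_group_def top_group_axioms_def)
qed

text \<open>Fullness is applied to the partition by the first index from which the sequence agrees
  with \<open>t\<close>; the distance to the limit is at most the \<open>nu\<close> measure of the
  points not yet settled.\<close>

lemma mem_if_eventually_eq:
  assumes \<rho>: "\<And>n. \<rho> n \<in> \<G>" and t: "t \<in> mp_bij M"
    and ev: "AE x in M. \<exists>n. \<forall>m\<ge>n. rep (\<rho> m) x = t x"
  shows "cls M t \<in> \<G>" "(\<lambda>n. nd (\<rho> n) (cls M t)) \<longlonglongrightarrow> 0"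
proof -
  define Q where "Q = cls M t"
  have Q: "Q \<in> carrier (Aut M)" unfolding Q_def by (rule cls_carrier[OF t])
  have Qt: "AE x in M. rep Q x = t x" unfolding Q_def by (rule rep_cls[OF t])
  define H where "H n = (\<Inter>m\<in>{n..}. {x \<in> space M. rep (\<rho> m) x = t x})" for n
  have Hm: "H n \<in> sets M" for n
    unfolding H_def
    by (rule sets.countable_INT') (use sets_eq_fun[OF mp_bijD(2)[OF rep_mp[OF \<rho>]] mp_bijD(2)[OF t]] in auto)
  have Hin: "incseq H" unfolding H_def by (rule incseq_SucI) auto
  have AEH: "AE x in M. x \<in> (\<Union>n. H n)" using ev by (rule AE_mp) (auto simp: H_def)
  define N where "N = space M - (\<Union>n. H n)"
  have Nm: "N \<in> sets M" unfolding N_def using Hm by auto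
  have AEN: "AE x in M. x \<notin> N" using AEH by (rule AE_mp) (auto simp: N_def)
  have Hsp: "H n \<subseteq> space M" for n by (rule sets.sets_into_space[OF Hm])
  define Dj where "Dj = disjointed H"
  \<comment> \<open>The null set of points that never settle joins the first piece, so that the
    pieces cover the space.\<close>
  define A where "A n = (if n = 0 then Dj 0 \<union> N else Dj n)" for n
  have "range H \<subseteq> sets M" using Hm by blast
  then have dH: "Dj n \<in> sets M" for n unfolding Dj_def using sets.range_disjointed_sets[of H M] by blast
  have dsub: "Dj n \<subseteq> H n" for n unfolding Dj_def by (rule disjointed_subset)
  have "Q \<in> \<G>"
  proof (rule full[unfolded full_group_def, THEN conjunct2, rule_format, of Q A \<rho>])
    have "disjoint_family A"
    proof -
      have "Dj m \<inter> Dj n = {}" if "m \<noteq> n" for m n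
        unfolding Dj_def using disjoint_family_disjointed[of H] that unfolding disjoint_family_on_def by blast
      moreover have "N \<inter> Dj n = {}" for n using dsub[of n] unfolding N_def by blast
      ultimately show ?thesis unfolding disjoint_family_on_def A_def by auto
    qed
    moreover have "(\<Union>n. A n) = space M"
    proof (intro equalityI subsetI)
      fix x assume "x \<in> (\<Union>n. A n)"
      then obtain n where "x \<in> A n" by blast
      then show "x \<in> space M" using dsub[of n] Hsp[of n] unfolding A_def N_def by (auto split: if_splits)
    next
      fix x assume x: "x \<in> space M"
      show "x \<in> (\<Union>n. A n)"
      proof (cases "x \<in> N")
        case True then show ?thesis by (intro UN_I[of 0]) (auto simp: A_def)
      next
        case False
        then have "x \<in> (\<Union>n. Dj n)" using x unfolding Dj_def UN_disjointed_eq N_def by blast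
        then obtain n where "x \<in> Dj n" by blast
        then show ?thesis by (intro UN_I[of n]) (auto simp: A_def)
      qed
    qed
    moreover have "AE x in M. x \<in> A n \<longrightarrow> rep Q x = rep (\<rho> n) x" for n
      using Qt AEN
    proof eventually_elim
      case (elim x)
      show ?case
      proof
        assume "x \<in> A n"
        then have "x \<in> H n" using dsub[of n] elim(2) unfolding A_def by (auto split: if_splits)
        then show "rep Q x = rep (\<rho> n) x" using elim(1) unfolding H_def by auto
      qed
    qed
    moreover have "A n \<in> sets M" for n unfolding A_def using dH Nm by auto
    ultimately show "(\<forall>n. A n \<in> sets M) \<and> disjoint_family A \<and> (\<Union>n. A n) = space M \<and> (\<forall>n. \<rho> n \<in> \<G>) \<and>
        (\<forall>n. AE x in M. x \<in> A n \<longrightarrow> rep Q x = rep (\<rho> n) x)" using \<rho> by blast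
  qed (rule Q)
  then show "cls M t \<in> \<G>" unfolding Q_def .
  have "(\<lambda>n. measure nu (space M - H n)) \<longlonglongrightarrow> measure nu (\<Inter>n. space M - H n)"
    by (rule nu.finite_Lim_measure_decseq) (use Hm Hin in \<open>auto simp: incseq_def decseq_def\<close>)
  moreover have "(\<Inter>n. space M - H n) = N" unfolding N_def by auto
  moreover have "measure nu N = 0" using null_nu_iff[OF Nm] AE_notin_iff[OF Nm] AEN by blast
  ultimately have lim: "(\<lambda>n. measure nu (space M - H n)) \<longlonglongrightarrow> 0" by simp
  have bound: "nd (\<rho> n) Q \<le> measure nu (space M - H n)" for n
  proof -
    have E: "{x \<in> space M. rep (\<rho> n) x \<noteq> t x} \<in> sets M"
      by (rule sets_neq_fun[OF mp_bijD(2)[OF rep_mp[OF \<rho>]] mp_bijD(2)[OF t]])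
    have "nd (\<rho> n) Q = measure nu {x \<in> space M. rep (\<rho> n) x \<noteq> t x}"
    proof (rule nd_eq_measure[OF \<rho> \<open>Q \<in> \<G>\<close> E])
      show "AE x in M. rep (\<rho> n) x \<noteq> rep Q x \<longleftrightarrow> x \<in> {x \<in> space M. rep (\<rho> n) x \<noteq> t x}"
        using Qt by (rule AE_mp) auto
    qed
    also have "\<dots> \<le> measure nu (space M - H n)"
      by (rule nu.finite_measure_mono) (use Hm in \<open>auto simp: H_def\<close>)
    finally show ?thesis .
  qed
  show "(\<lambda>n. nd (\<rho> n) (cls M t)) \<longlonglongrightarrow> 0"
    using lim bound unfolding Q_def[symmetric]
    by (intro tendsto_sandwich[OF _ _ tendsto_const lim]) auto
qed

lemma mcomplete_uniform: "U.mcomplete"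
  unfolding U.mcomplete_def
proof (intro allI impI)
  fix \<sigma> assume C: "U.MCauchy \<sigma>"
  then have \<sigma>: "\<sigma> n \<in> \<G>" for n unfolding U.MCauchy_def by blast
  have "\<exists>N. \<forall>n n'. N \<le> n \<longrightarrow> N \<le> n' \<longrightarrow> du (\<sigma> n) (\<sigma> n') < (1 / 2) ^ k" for k
    using C unfolding U.MCauchy_def by simp
  then obtain N where N: "\<And>k n n'. N k \<le> n \<Longrightarrow> N k \<le> n' \<Longrightarrow> du (\<sigma> n) (\<sigma> n') < (1 / 2) ^ k" by metis
  \<comment> \<open>Along this subsequence consecutive distances are below
    \<open>(1 / 2) ^ k\<close>, so the measures of the sets of disagreement are summable, for the
    maps and for their inverses.\<close>
  define r where "r = rec_nat (N 0) (\<lambda>k m. max (Suc m) (N (Suc k)))"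
  have rS: "r (Suc k) = max (Suc (r k)) (N (Suc k))" for k unfolding r_def by simp
  have rN: "N k \<le> r k" for k by (cases k) (auto simp: r_def)
  have r: "strict_mono r" by (rule strict_monoI_Suc) (simp add: rS)
  define \<rho> where "\<rho> k = \<sigma> (r k)" for k
  have \<rho>: "\<rho> k \<in> \<G>" for k unfolding \<rho>_def by (rule \<sigma>)
  have step: "du (\<rho> k) (\<rho> (Suc k)) < (1 / 2) ^ k" for k
    unfolding \<rho>_def by (rule N) (use rN[of k] strict_monoD[OF r, of k "Suc k"] in auto)
  have nn: "nd (\<rho> k) (\<rho> (Suc k)) \<le> (1 / 2) ^ k" "nd (ainv \<rho> k) (ainv \<rho> (Suc k)) \<le> (1 / 2) ^ k" for k
    using step[of k] nd_nonneg[of "\<rho> k" "\<rho> (Suc k)"] nd_nonneg[of "ainv \<rho> k" "ainv \<rho> (Suc k)"]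
    unfolding du_def by linarith+
  have geo: "summable (\<lambda>k. (1 / 2 :: real) ^ k)" by (rule summable_geometric) simp
  have sm1: "summable (\<lambda>k. measure nu {x \<in> space M. rep (\<rho> k) x \<noteq> rep (\<rho> (Suc k)) x})"
    by (rule summable_comparison_test'[OF geo, of 0]) (use nn(1) in \<open>simp add: nd_def\<close>)
  have sm2: "summable (\<lambda>k. measure nu {x \<in> space M. rep (ainv \<rho> k) x \<noteq> rep (ainv \<rho> (Suc k)) x})"
    by (rule summable_comparison_test'[OF geo, of 0]) (use nn(2) in \<open>simp add: nd_def\<close>)
  obtain T where T: "T \<in> measurable M M" "\<And>A. A \<in> sets M \<Longrightarrow> emeasure M (T -` A \<inter> space M) \<le> emeasure M A"
    "AE x in M. \<exists>n. \<forall>m\<ge>n. rep (\<rho> m) x = T x"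
    by (rule eventually_constant_limit[of "\<lambda>k. rep (\<rho> k)", OF rep_mp[OF \<rho>] sm1]) (rule that)
  obtain S where S: "S \<in> measurable M M" "\<And>A. A \<in> sets M \<Longrightarrow> emeasure M (S -` A \<inter> space M) \<le> emeasure M A"
    "AE x in M. \<exists>n. \<forall>m\<ge>n. rep (ainv \<rho> m) x = S x"
    by (rule eventually_constant_limit[of "\<lambda>k. rep (ainv \<rho> k)", OF rep_mp[OF m_inv_closed[OF \<rho>]] sm2])
      (rule that)
  have i1: "AE x in M. \<forall>n. rep (ainv \<rho> n) (rep (\<rho> n) x) = x"
    unfolding AE_all_countable using rep_inv(1)[OF mem_carrier[OF \<rho>]] by blast
  have i2: "AE x in M. \<forall>n. rep (\<rho> n) (rep (ainv \<rho> n) x) = x"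
    unfolding AE_all_countable using rep_inv(2)[OF mem_carrier[OF \<rho>]] by blast
  have ST': "AE x in M. \<exists>n. \<forall>m\<ge>n. rep (ainv \<rho> m) (T x) = S (T x)"
    by (rule AE_compose[OF T(1) _ S(3)]) (rule T(2))
  have TS': "AE x in M. \<exists>n. \<forall>m\<ge>n. rep (\<rho> m) (S x) = T (S x)"
    by (rule AE_compose[OF S(1) _ T(3)]) (rule S(2))
  \<comment> \<open>At almost every \<open>x\<close> one sequence has settled at \<open>x\<close>
    and the other at \<open>T x\<close>; a common late index shows that \<open>S\<close> undoes
    \<open>T\<close>.\<close>
  have ST: "AE x in M. S (T x) = x"
    using T(3) ST' i1
  proof eventually_elim
    case (elim x)
    obtain m n where "\<forall>k\<ge>m. rep (\<rho> k) x = T x" "\<forall>k\<ge>n. rep (ainv \<rho> k) (T x) = S (T x)"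
      using elim(1,2) by blast
    then have "rep (\<rho> (max m n)) x = T x" "rep (ainv \<rho> (max m n)) (T x) = S (T x)" by auto
    then show ?case using elim(3) by metis
  qed
  have TS: "AE x in M. T (S x) = x"
    using S(3) TS' i2
  proof eventually_elim
    case (elim x)
    obtain m n where "\<forall>k\<ge>m. rep (ainv \<rho> k) x = S x" "\<forall>k\<ge>n. rep (\<rho> k) (S x) = T (S x)"
      using elim(1,2) by blast
    then have "rep (ainv \<rho> (max m n)) x = S x" "rep (\<rho> (max m n)) (S x) = T (S x)" by auto
    then show ?case using elim(3) by metis
  qed
  obtain t where t: "t \<in> mp_bij M" "AE x in M. t x = T x"
    by (rule mp_bij_of_AE_inverse[OF T(1) S(1) ST TS], erule T(2), erule S(2)) (rule that)
  have "AE x in M. \<exists>n. \<forall>m\<ge>n. rep (\<rho> m) x = t x" using T(3) t(2) by eventually_elim simp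
  note lim = mem_if_eventually_eq[of \<rho>, OF \<rho> t(1) this]
  have "limitin U.mtopology \<rho> (cls M t) sequentially"
    unfolding U.limitin_metric
  proof (intro conjI allI impI)
    fix e :: real assume "e > 0"
    then obtain d where d: "d > 0" "\<And>S. S \<in> \<G> \<Longrightarrow> nd S (cls M t) < d \<Longrightarrow> du S (cls M t) < e"
      using du_small_if_nd_small[OF lim(1)] by blast
    have "\<forall>\<^sub>F n in sequentially. nd (\<rho> n) (cls M t) < d" by (rule order_tendstoD(2)[OF lim(2) d(1)])
    then show "\<forall>\<^sub>F n in sequentially. \<rho> n \<in> \<G> \<and> du (\<rho> n) (cls M t) < e"
      by eventually_elim (use d(2) \<rho> in blast)
  qed (rule lim(1))
  then have "limitin U.mtopology (\<sigma> \<circ> r) (cls M t) sequentially" unfolding \<rho>_def comp_def .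
  then have "limitin U.mtopology \<sigma> (cls M t) sequentially" by (rule U.MCauchy_convergent_subsequence[OF C r])
  then show "\<exists>x. limitin U.mtopology \<sigma> x sequentially" by blast
qed

text \<open>A set of disagreement that is small for \<open>nu\<close> meets \<open>A\<close> in a
  small set for \<open>M\<close>, and this bounds the distance of the images.\<close>

lemma uniform_weak_nbhd:
  assumes T: "T \<in> \<G>" and A: "A \<in> fmeasurable M" and e: "e > 0"
  obtains d where "d > 0" "\<And>S. S \<in> \<G> \<Longrightarrow> du T S < d \<Longrightarrow> sdist M (rep T ` A) (rep S ` A) < e"
proof -
  obtain d where d: "d > 0" "\<And>D. D \<in> sets M \<Longrightarrow> measure nu D < d \<Longrightarrow> measure M (A \<inter> D) < e / 2"
    using measure_Int_le_if_nu_small[OF A, of "e / 2"] e by auto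
  show ?thesis
  proof (rule that[OF d(1)])
    fix S assume S: "S \<in> \<G>" "du T S < d"
    then have "nd T S < d" unfolding du_def using nd_nonneg[of "ainv T" "ainv S"] by linarith
    then have "measure M (A \<inter> {x \<in> space M. rep T x \<noteq> rep S x}) < e / 2"
      using d(2)[OF sets_neq_rep[OF T S(1)]] unfolding nd_def by blast
    then show "sdist M (rep T ` A) (rep S ` A) < e"
      using sdist_image_le[OF rep_mp[OF T] rep_mp[OF S(1)] A] by linarith
  qed
qed

end

section \<open>Comparison with the uniform topology\<close>

context polish_full_group
begin

text \<open>
  The closure of a countable subgroup for the uniform topology is a Polish group, to which the
  closed graph theorem applies; the whole group need not be separable.
\<close>

lemma uniform_nbhd_one:
  assumes W: "openin \<tau> W" "\<one>\<^sub>A \<in> W"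
  obtains d where "d > 0" "\<And>T. T \<in> \<G> \<Longrightarrow> nd T \<one>\<^sub>A < d \<Longrightarrow> T \<in> W"
proof (rule ccontr)
  assume no: "\<not> thesis"
  interpret TU: top_group GG U.mtopology by (rule top_group_uniform)
  \<comment> \<open>If the claim fails, elements tending uniformly to the identity stay outside
    \<open>W\<close>. They generate a countable subgroup, whose uniform closure suffices to bring
    one of them into \<open>W\<close>.\<close>
  have "\<exists>T. T \<in> \<G> \<and> nd T \<one>\<^sub>A < inverse (real (Suc n)) \<and> T \<notin> W" for n
  proof (rule ccontr)
    assume "\<not> ?thesis"
    then have "\<And>T. T \<in> \<G> \<Longrightarrow> nd T \<one>\<^sub>A < inverse (real (Suc n)) \<Longrightarrow> T \<in> W" by blast
    then show False using that[of "inverse (real (Suc n))"] no by simp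
  qed
  then obtain T where T: "\<And>n. T n \<in> \<G>" "\<And>n. nd (T n) \<one>\<^sub>A < inverse (real (Suc n))" "\<And>n. T n \<notin> W"
    by metis
  obtain L where L: "subgroup L GG" "countable L" "range T \<subseteq> L"
    using P.countable_subgroup_containing[of "range T"] T(1) by auto
  define K where "K = U.mtopology closure_of L"
  have K: "subgroup K GG" unfolding K_def by (rule TU.subgroup_closure_of[OF L(1)])
  have KG: "K \<subseteq> \<G>" using subgroup.subset[OF K] by simp
  have LG: "L \<subseteq> \<G>" using subgroup.subset[OF L(1)] by simp
  have LK: "L \<subseteq> K" unfolding K_def by (rule closure_of_subset) (simp add: LG)
  define \<sigma> where "\<sigma> = subtopology U.mtopology K"
  have t\<sigma>: "topspace \<sigma> = K" unfolding \<sigma>_def using KG by auto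
  have "completely_metrizable_space \<sigma>" unfolding \<sigma>_def
    by (rule completely_metrizable_space_closedin[OF U.completely_metrizable_space_mtopology[OF mcomplete_uniform]])
      (simp add: K_def)
  moreover have "separable_space \<sigma>" unfolding separable_space_def
  proof (intro exI[of _ L] conjI L(2))
    show "L \<subseteq> topspace \<sigma>" using LK t\<sigma> by simp
    have "\<sigma> closure_of L = K \<inter> U.mtopology closure_of L" unfolding \<sigma>_def
      using LK by (simp add: closure_of_subtopology Int_absorb1)
    then show "\<sigma> closure_of L = topspace \<sigma>" using t\<sigma> unfolding K_def by simp
  qed
  ultimately have \<sigma>p: "polish_space_top \<sigma>" unfolding polish_space_top_def by blast
  have KK: "GG\<lparr>carrier := K\<rparr> = Aut M\<lparr>carrier := K\<rparr>" by simp
  have "top_group (Aut M\<lparr>carrier := K\<rparr>) \<sigma>"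
    using TU.top_group_subgroup[OF K] unfolding \<sigma>_def KK .
  then have Kpol: "polish_group (Aut M\<lparr>carrier := K\<rparr>) \<sigma>"
    using \<sigma>p by (simp add: polish_group_def polish_group_axioms_def)
  have "closedin (prod_topology \<sigma> \<tau>) ((\<lambda>x. (x, x)) ` K)"
  proof (rule closedin_identity_graph[OF t\<sigma> KG topspace_eq subset])
    fix S A and e :: real assume a: "S \<in> K" "A \<in> fmeasurable M" "e > 0"
    have SG: "S \<in> \<G>" using a KG by blast
    obtain d where d: "d > 0" "\<And>R. R \<in> \<G> \<Longrightarrow> du S R < d \<Longrightarrow> sdist M (rep S ` A) (rep R ` A) < e"
      by (rule uniform_weak_nbhd[OF SG a(2,3)]) (rule that)
    have "openin \<sigma> (U.mball S d \<inter> K)" unfolding \<sigma>_def openin_subtopology by blast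
    moreover have "S \<in> U.mball S d \<inter> K" using SG a d by simp
    moreover have "\<forall>R\<in>U.mball S d \<inter> K. sdist M (rep S ` A) (rep R ` A) < e" using d(2) by simp
    ultimately show "\<exists>V. openin \<sigma> V \<and> S \<in> V \<and> (\<forall>R\<in>V. sdist M (rep S ` A) (rep R ` A) < e)" by blast
  next
    fix S A and e :: real assume a: "S \<in> \<G>" "A \<in> fmeasurable M" "e > 0"
    show "\<exists>V. openin \<tau> V \<and> S \<in> V \<and> (\<forall>R\<in>V. sdist M (rep S ` A) (rep R ` A) < e)"
      by (rule weak_nbhd[OF a]) blast
  qed
  then have "closedin (prod_topology \<sigma> \<tau>) ((\<lambda>x. (x, (\<lambda>x. x) x)) ` carrier (Aut M\<lparr>carrier := K\<rparr>))" by simp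
  moreover have "(\<lambda>x. x) \<in> hom (Aut M\<lparr>carrier := K\<rparr>) GG" using KG by (auto simp: hom_def)
  ultimately have "continuous_map \<sigma> \<tau> (\<lambda>x. x)"
    by (intro closed_graph_polish_groups[OF Kpol P.polish_group_axioms])
  then have "openin \<sigma> {x \<in> topspace \<sigma>. x \<in> W}" using W(1) by (rule openin_continuous_map_preimage)
  then have "openin \<sigma> {x \<in> K. x \<in> W}" unfolding t\<sigma> .
  then obtain O' where O': "openin U.mtopology O'" "{x \<in> K. x \<in> W} = O' \<inter> K"
    unfolding \<sigma>_def openin_subtopology by blast
  have "\<one>\<^sub>A \<in> K" using subgroup.one_closed[OF K] by simp
  then have "\<one>\<^sub>A \<in> O'" using O'(2) W(2) by blast
  then obtain e where e: "e > 0" "U.mball \<one>\<^sub>A e \<subseteq> O'" using O'(1) unfolding U.openin_mtopology by blast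
  \<comment> \<open>The sequence tends to the identity for \<open>nd\<close>, whereas the ball found
    is one of \<open>du\<close>.\<close>
  obtain d where d: "d > 0" "\<And>S. S \<in> \<G> \<Longrightarrow> nd S \<one>\<^sub>A < d \<Longrightarrow> du S \<one>\<^sub>A < e"
    by (rule du_small_if_nd_small[OF one_closed e(1)]) (rule that)
  obtain n where n: "inverse (real (Suc n)) < d" using reals_Archimedean[OF d(1)] by blast
  have "nd (T n) \<one>\<^sub>A < d" using T(2)[of n] n by linarith
  then have "du (T n) \<one>\<^sub>A < e" by (rule d(2)[OF T(1)])
  then have "T n \<in> U.mball \<one>\<^sub>A e" using T(1) by (simp add: U.commute)
  then have "T n \<in> O' \<inter> K" using e(2) L(3) LK by blast
  then have "T n \<in> W" using O'(2) by blast
  then show False using T(3) by blast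
qed

text \<open>Left translation moves the question from \<open>T\<close> to the identity, where
  \<open>uniform_nbhd_one\<close> applies; left invariance of \<open>nd\<close> moves the distances
  along.\<close>

theorem coarser_than_uniform: "coarser \<tau> (subtopology (uniform_topology M) \<G>)"
proof -
  have gen: "{T \<in> carrier (Aut M). d_unif M C S T < r} \<in> {{T \<in> carrier (Aut M). d_unif M C S T < r} | S C r.
        S \<in> carrier (Aut M) \<and> C \<in> finite_sets M \<and> r > 0}"
    if "S \<in> carrier (Aut M)" "C \<in> finite_sets M" "r > 0" for S C r using that by blast
  have opb: "openin (uniform_topology M) {T \<in> carrier (Aut M). d_unif M C S T < r}"
    if "S \<in> carrier (Aut M)" "C \<in> finite_sets M" "r > 0" for S C r
    unfolding uniform_topology_def by (rule topology_generated_by_Basis) (rule gen[OF that])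
  have self: "d_unif M C S S = 0" for C S unfolding d_unif_def by simp
  have sub: "topspace (uniform_topology M) \<subseteq> carrier (Aut M)"
    unfolding uniform_topology_def topology_generated_by_topspace by auto
  have "carrier (Aut M) \<subseteq> topspace (uniform_topology M)"
  proof
    fix S assume S: "S \<in> carrier (Aut M)"
    have "{} \<in> finite_sets M" by (simp add: finite_sets_def)
    from openin_subset[OF opb[OF S this zero_less_one]] show "S \<in> topspace (uniform_topology M)"
      using S self by auto
  qed
  with sub have tu: "topspace (uniform_topology M) = carrier (Aut M)" by (rule antisym)
  show ?thesis unfolding coarser_def
  proof (intro conjI allI impI)
    show "topspace \<tau> = topspace (subtopology (uniform_topology M) \<G>)"
      using tu topspace_eq subset by auto
    fix W assume W: "openin \<tau> W"
    have WG: "W \<subseteq> \<G>" using openin_subset[OF W] topspace_eq by simp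
    show "openin (subtopology (uniform_topology M) \<G>) W"
    proof (subst openin_subopen, intro ballI)
      fix T assume T: "T \<in> W"
      then have TG: "T \<in> \<G>" using WG by blast
      note cT = mem_carrier[OF TG]
      let ?W = "{v \<in> \<G>. T \<odot> v \<in> W}"
      have "openin \<tau> {v \<in> topspace \<tau>. T \<odot> v \<in> W}"
        by (rule openin_continuous_map_preimage[OF _ W]) (intro cont_mult cont_const TG, simp)
      then have "openin \<tau> ?W" unfolding topspace_eq .
      moreover have "\<one>\<^sub>A \<in> ?W" using T cT by simp
      ultimately obtain d where d: "d > 0" "\<And>S. S \<in> \<G> \<Longrightarrow> nd S \<one>\<^sub>A < d \<Longrightarrow> S \<in> ?W"
        by (rule uniform_nbhd_one) (rule that)
      \<comment> \<open>The uniform topology sees only sets of finite measure: off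
        \<open>lev k\<close> there is less than \<open>d / 2\<close> of \<open>nu\<close>, and on
        \<open>lev k\<close> it is at most \<open>M\<close>, so radius \<open>d / 2\<close> for the
        set \<open>lev k\<close> is enough.\<close>
      obtain k where k: "measure nu (space M - lev k) < d / 2" using measure_nu_diff_lev[of "d / 2"] d(1) by auto
      let ?B = "{S \<in> carrier (Aut M). d_unif M (lev k) T S < d / 2}"
      have lf: "lev k \<in> finite_sets M" by (rule lev_finite_sets)
      have "?B \<inter> \<G> \<subseteq> W"
      proof
        fix S assume S: "S \<in> ?B \<inter> \<G>"
        then have SG: "S \<in> \<G>" by blast
        note cS = mem_carrier[OF SG]
        define v where "v = ainv T \<odot> S"
        have v: "v \<in> \<G>" unfolding v_def using TG SG by simp
        have "nd v \<one>\<^sub>A = nd (ainv T \<odot> S) (ainv T \<odot> T)"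
          unfolding v_def using cT by simp
        also have "\<dots> = nd T S"
          using nd_mult_left[OF m_inv_closed[OF TG] SG TG] nd_commute by simp
        also have "\<dots> \<le> measure nu ((space M - lev k) \<union> (lev k \<inter> {x \<in> space M. rep T x \<noteq> rep S x}))"
          unfolding nd_def by (rule nu.finite_measure_mono) (use sets_neq_rep[OF TG SG] in auto)
        also have "\<dots> \<le> measure nu (space M - lev k) + measure nu (lev k \<inter> {x \<in> space M. rep T x \<noteq> rep S x})"
          by (rule measure_Un_le) (use sets_neq_rep[OF TG SG] in auto)
        also have "measure nu (lev k \<inter> {x \<in> space M. rep T x \<noteq> rep S x}) \<le>
            measure M (lev k \<inter> {x \<in> space M. rep T x \<noteq> rep S x})"
          by (rule measure_nu_le[OF fmeasurable_Int_fmeasurable[OF finite_setsD(2)[OF lf] sets_neq_rep[OF TG SG]]])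
        also have "lev k \<inter> {x \<in> space M. rep T x \<noteq> rep S x} = {x \<in> lev k. rep T x \<noteq> rep S x}"
          unfolding lev_def by auto
        also have "measure M \<dots> < d / 2" using S unfolding d_unif_def by simp
        finally have "nd v \<one>\<^sub>A < d" using k by simp
        then have "T \<odot> v \<in> W" using d(2)[OF v] by blast
        moreover have "T \<odot> v = S" unfolding v_def using cT cS by (simp add: Aut.m_assoc[symmetric])
        ultimately show "S \<in> W" by simp
      qed
      moreover have "openin (subtopology (uniform_topology M) \<G>) (?B \<inter> \<G>)"
        unfolding openin_subtopology using opb[OF cT lf, of "d / 2"] d(1) by auto
      moreover have "T \<in> ?B \<inter> \<G>" using cT TG self d(1) by simp
      ultimately show "\<exists>V. openin (subtopology (uniform_topology M) \<G>) V \<and> T \<in> V \<and> V \<subseteq> W" by blast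
    qed
  qed
qed

end

theorem theorem4:
  fixes M :: "'a measure" and \<G> :: "('a \<Rightarrow> 'a) set set"
  assumes "standard_sigma_finite_space M"
    and "full_group M \<G>"
    and "ergodic_group M \<G>"
  shows "(\<forall>\<tau>\<^sub>1 \<tau>\<^sub>2. polish_group_topology (Aut M \<lparr>carrier := \<G>\<rparr>) \<tau>\<^sub>1 \<and>
              polish_group_topology (Aut M \<lparr>carrier := \<G>\<rparr>) \<tau>\<^sub>2 \<longrightarrow> \<tau>\<^sub>1 = \<tau>\<^sub>2) \<and>
         (\<forall>\<tau>. polish_group_topology (Aut M \<lparr>carrier := \<G>\<rparr>) \<tau> \<longrightarrow>
              coarser \<tau> (subtopology (uniform_topology M) \<G>) \<and>
              coarser (subtopology (weak_topology M) \<G>) \<tau>)"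
proof -
  interpret ergodic_full_group M \<G>
    using assms by unfold_locales
  have pfg: "polish_full_group M \<G> \<tau>" if "polish_group_topology (Aut M \<lparr>carrier := \<G>\<rparr>) \<tau>" for \<tau>
    using that by unfold_locales
  show ?thesis
  proof (intro conjI allI impI)
    fix \<tau>\<^sub>1 \<tau>\<^sub>2
    assume "polish_group_topology (Aut M \<lparr>carrier := \<G>\<rparr>) \<tau>\<^sub>1 \<and>
      polish_group_topology (Aut M \<lparr>carrier := \<G>\<rparr>) \<tau>\<^sub>2"
    then have "polish_full_group M \<G> \<tau>\<^sub>1" "polish_full_group M \<G> \<tau>\<^sub>2" using pfg by auto
    then show "\<tau>\<^sub>1 = \<tau>\<^sub>2" unfolding topology_eq using polish_topology_coarser by blast
  next
    fix \<tau> assume "polish_group_topology (Aut M \<lparr>carrier := \<G>\<rparr>) \<tau>"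
    then show "coarser \<tau> (subtopology (uniform_topology M) \<G>)" "coarser (subtopology (weak_topology M) \<G>) \<tau>"
      by (rule polish_full_group.coarser_than_uniform[OF pfg], rule polish_full_group.refines_weak[OF pfg])
  qed
qed

end
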